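(* Let $\mathcal F$ be the family of all codes of length $N=2n$ of one of the six Types $q^E_{\rm I}$, $q^E_{\rm II}$, $q^E$, $q^E_{\bf 1}$, $q^H$, $q^H_{\bf 1}$ over $\mathbb F_q$ (see context). For $0\le m\le n$ let $\mathcal M^0_m$, $\alpha_m$ and $\nu_m$ be given by the following table: $$\begin{array}{|c|c|c|c|}\hline \text{Type} & \mathcal M_m^0 & \alpha_m(q-1) & \nu_m(q-1)\\ \hline q^E_{\rm I} & \mathcal M_m^1 & q^{n-m}-q & q^{n-m}-q-q^m+1\\ q^E_{\rm II} & \mathcal M_m^1 & q^{n-m-1}-1 & q^{n-m-1}-q^m\\ q^E & \mathcal M_m^* & q^{n-m}-1 & q^{n-m}-q^m\\ q^E_{\bf 1} & \mathcal M_m^1 & q^{n-m-1}-1 & q^{n-m-1}-q^m\\ q^H & \mathcal M_m^* & \sqrt q\,(q^{n-m}-1) & q^{n-m+1/2}-q^m-q^{1/2}+1\\ q^H_{\bf 1} & \mathcal M_m^1 & \sqrt q\,(q^{n-m-1}-1) & q^{n-m-1/2}-q^m-q^{1/2}+1\\ \hline\end{array}$$ Then for every $0\le m\le n$: (1) $\mathcal V_m=\{v\in\mathcal V_{m-1}: a_X(v)=0\text{ for all }X\in\mathcal M_m^0\}$; (2) for all $C\in\mathcal F$ and all $\underline c\in C^m$ with $\operatorname{mon}(\underline c)\in\mathcal M_m^0$ one has $\sum_{E\in\mathcal E_C(\underline c)}\alpha_E(C)=\alpha_m$ (in particular this sum does not depend on $C$ and $\underline c$); (3) the eigenvalue of $T$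 on $\mathcal Y_m$ is $\nu_m=\alpha_m-\frac{q^m-1}{q-1}$, i.e. $T(v)=\nu_m v$ for all $v\in\mathcal Y_m$.
   Context: Types. $N=2n$ is a positive even integer, ${\bf 1}=(1,\dots,1)\in\mathbb F_q^N$. Codes are $\mathbb F_q$-subspaces $C\le\mathbb F_q^N$. - $q^E$: $q$ odd, $\mathcal F$ is the set of all $C=C^\perp\le\mathbb F_q^N$, with dual taken with respect to $b(x,y)=\sum_i x_iy_i$. - $q^E_{\bf 1}$: as $q^E$ ($q$ odd), with the additional condition ${\bf 1}\in C$. - $q^E_{\rm I}$: as $q^E$, but $q$ is even. - $q^E_{\rm II}$: as $q^E_{\rm I}$ ($q$ even), with the additional condition that $C$ is generalized doubly-even, i.e. $\sum_{i=1}^N c_i=0$ and $\sum_{i<j}c_ic_j=0$ for all $c\in C$. - $q^H$: $q=r^2$ is a square, $\mathcal F$ is the set of all $C=C^\perp\le\mathbb F_q^N$, with dual taken with respect to the Hermitian form $b(x,y)=\sum_i x_i\overline{y_i}$, $\overline{x}=x^r$. - $q^H_{\bf 1}$: as $q^H$, with the additional condition ${\bf 1}\in C$. Write $\mathbb F=\mathbb F_q$. All codes in $\mathcal F$ have dimension $n$. Vector space and operator. Two codes are equivalent if a coordinate permutation in $S_N$ maps one onto the other; $[C]$ is the equivalence class of $C$; $\operatorname{Aut}(C)=\{\pi\in S_N:\pi(C)=C\}$. $\mathcal V$ is the $\mathbb C$-vector space with basis $\mathcal B=\{[C]:C\in\mathcal F\}$, with the positive definite Hermitian scalar product given by $([C],[D])=|\operatorname{Aut}(C)|\,\delta_{[C],[D]}$.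 $T:\mathcal V\to\mathcal V$ (the Kneser-Hecke-operator) is the linear operator with $T([C])=\sum_D[D]$, the sum over all $D\in\mathcal F$ with $\dim(C\cap D)=n-1$. Weight-enumerators. For $m\ge0$ let $\mathcal P_m=\mathbb C[x_a: a\in\mathbb F^m]$. For $\underline c=(c^{(1)},\dots,c^{(m)})\in(\mathbb F^N)^m$ let $\operatorname{mon}(\underline c)=\prod_{v\in\mathbb F^m}x_v^{a_v(\underline c)}$, where $a_v(\underline c)$ is the number of $i\in\{1,\dots,N\}$ with $(c^{(1)}_i,\dots,c^{(m)}_i)=v$. Let $\operatorname{cwe}_m:\mathcal V\to\mathcal P_m$ be the linear map with $\operatorname{cwe}_m([C])=\sum_{\underline c\in C^m}\operatorname{mon}(\underline c)$ for $m\ge1$ and $\operatorname{cwe}_0([C])=1$. Put $\mathcal V_{-1}=\mathcal V$, $\mathcal V_m=\ker(\operatorname{cwe}_m)$ for $m\ge0$, $\mathcal W_m=\mathcal V_m^\perp$ (orthogonal complement in $\mathcal V$), and $\mathcal Y_m=\mathcal W_m\cap\mathcal V_{m-1}$ for $0\le m\le n$. Monomials. $\mathcal M_m$ is the set of monomials of degree $N$ in $\mathcal P_m$; the rank of $X=\prod_a x_a^{e_a}$ is $\dim\langle a\in\mathbb F^m:e_a>0\rangle$; $\mathcal M_m^*$ is the set of $X\in\mathcal M_m$ of rank $m$. Moreover $\mathcal M_m^1=\{\operatorname{mon}(\underline c): \underline c\in(\mathbb F^N)^m,\ \dim\langle{\bf 1},c^{(1)},\dots,c^{(m)}\rangle=m+1\}$.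 For $X\in\mathcal M_m$, $a_X:\mathcal V\to\mathbb C$ is the linear map with $a_X([C])=|\{\underline c\in C^m:\operatorname{mon}(\underline c)=X\}|$. For $C\in\mathcal F$ and $\underline c\in C^m$: $\mathcal E_C(\underline c)$ is the set of subspaces $E\le C$ with $\dim E=n-1$ and $\underline c\in E^m$; $\alpha_E(C)$ is the number of $D\in\mathcal F$ with $D\cap C=E$. *)

theory Defs
  imports
    "HOL-Analysis.Analysis"
    "HOL-Library.Poly_Mapping"
    "HOL-Library.FuncSet"
    "HOL-Library.Discrete_Functions"
begin

text \<open>
  The field of \<open>q\<close> elements is a type \<open>'a\<close> of sort \<open>{field, finite}\<close>, with \<open>q = CARD('a)\<close>;
  the coordinates are indexed by a finite linearly ordered type \<open>'N\<close> with \<open>CARD('N) = N\<close>.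
  The order is used only for the sum over \<open>i < j\<close> in the doubly-even condition.
\<close>

datatype code_type = qE_I | qE_II | qE | qE_1 | qH | qH_1

fun admissible :: "code_type \<Rightarrow> nat \<Rightarrow> bool" where
  "admissible qE_I q \<longleftrightarrow> even q"
| "admissible qE_II q \<longleftrightarrow> even q"
| "admissible qE q \<longleftrightarrow> odd q"
| "admissible qE_1 q \<longleftrightarrow> odd q"
| "admissible qH q \<longleftrightarrow> (\<exists>r. q = r\<^sup>2)"
| "admissible qH_1 q \<longleftrightarrow> (\<exists>r. q = r\<^sup>2)"

definition euclidean_form :: "'a::{field,finite} ^ 'N::finite \<Rightarrow> 'a ^ 'N \<Rightarrow> 'a" where
  "euclidean_form x y = (\<Sum>i\<in>UNIV. x $ i * y $ i)"

text \<open>For \<open>q = r\<^sup>2\<close>, \<open>floor_sqrt q\<close> is \<open>r\<close>.\<close>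

definition hermitian_form :: "'a::{field,finite} ^ 'N::finite \<Rightarrow> 'a ^ 'N \<Rightarrow> 'a" where
  "hermitian_form x y = (\<Sum>i\<in>UNIV. x $ i * (y $ i) ^ floor_sqrt (CARD('a)))"

definition dual :: "('v \<Rightarrow> 'v \<Rightarrow> 'a::zero) \<Rightarrow> 'v set \<Rightarrow> 'v set" where
  "dual b C = {x. \<forall>c\<in>C. b x c = 0}"

definition self_dual :: "('a::field ^ 'N \<Rightarrow> 'a ^ 'N \<Rightarrow> 'a) \<Rightarrow> ('a ^ 'N) set \<Rightarrow> bool" where
  "self_dual b C \<longleftrightarrow> vec.subspace C \<and> C = dual b C"

definition all_one :: "'a::one ^ 'N" where
  "all_one = (\<chi> i. 1)"

definition doubly_even :: "('a::field ^ 'N::{finite,linorder}) set \<Rightarrow> bool" where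
  "doubly_even C \<longleftrightarrow>
    (\<forall>c\<in>C. (\<Sum>i\<in>UNIV. c $ i) = 0 \<and> (\<Sum>(i, j)\<in>{(i, j). i < j}. c $ i * c $ j) = 0)"

fun family :: "code_type \<Rightarrow> ('a::{field,finite} ^ 'N::{finite,linorder}) set set" where
  "family qE_I = {C. self_dual euclidean_form C}"
| "family qE_II = {C. self_dual euclidean_form C \<and> doubly_even C}"
| "family qE = {C. self_dual euclidean_form C}"
| "family qE_1 = {C. self_dual euclidean_form C \<and> all_one \<in> C}"
| "family qH = {C. self_dual hermitian_form C}"
| "family qH_1 = {C. self_dual hermitian_form C \<and> all_one \<in> C}"

definition perm :: "('N \<Rightarrow> 'N) \<Rightarrow> 'a ^ 'N \<Rightarrow> 'a ^ 'N" where
  "perm \<pi> c = (\<chi> i. c $ inv \<pi> i)"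

definition code_class :: "('a ^ 'N) set \<Rightarrow> ('a ^ 'N) set set" where
  "code_class C = {perm \<pi> ` C |\<pi>. bij \<pi>}"

definition Aut :: "('a ^ 'N) set \<Rightarrow> ('N \<Rightarrow> 'N) set" where
  "Aut C = {\<pi>. bij \<pi> \<and> perm \<pi> ` C = C}"

text \<open>
  The linear maps below are given on basis elements through a representative; the lemmas at the end
  of the theory show that the choice does not matter.
\<close>

definition rep :: "('a ^ 'N) set set \<Rightarrow> ('a ^ 'N) set set \<Rightarrow> ('a ^ 'N) set" where
  "rep \<F> K = inv_into \<F> code_class K"

text \<open>
  \<open>'k \<Rightarrow>\<^sub>0 'f\<close> is the \<open>'f\<close>-vector space with basis the elements \<open>Poly_Mapping.single k 1\<close>.
  It is used for the space \<open>\<F>\<^sup>m\<close> of column vectors (\<open>'k = nat\<close>), for the space spanned by the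
  classes of codes, and for polynomials (\<open>'k\<close> the exponent vectors of monomials).
\<close>

definition scale :: "'f::field \<Rightarrow> ('k \<Rightarrow>\<^sub>0 'f) \<Rightarrow> 'k \<Rightarrow>\<^sub>0 'f" where
  "scale c v = Poly_Mapping.map ((*) c) v"

lemma lookup_scale [simp]:
  "Poly_Mapping.lookup (scale c v) k = c * Poly_Mapping.lookup v k"
  by (simp add: scale_def map.rep_eq when_def)

global_interpretation pm: vector_space scale
  by unfold_locales (auto intro!: poly_mapping_eqI simp: lookup_add algebra_simps)

definition class_space :: "('a ^ 'N) set set \<Rightarrow> (('a ^ 'N) set set \<Rightarrow>\<^sub>0 complex) set" where
  "class_space \<F> = {v. Poly_Mapping.keys v \<subseteq> code_class ` \<F>}"

definition basis_vec :: "('a ^ 'N) set \<Rightarrow> ('a ^ 'N) set set \<Rightarrow>\<^sub>0 complex" where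
  "basis_vec C = Poly_Mapping.single (code_class C) 1"

definition class_inner ::
  "('a ^ 'N) set set \<Rightarrow> (('a ^ 'N) set set \<Rightarrow>\<^sub>0 complex) \<Rightarrow> (('a ^ 'N) set set \<Rightarrow>\<^sub>0 complex) \<Rightarrow> complex" where
  "class_inner \<F> v w = (\<Sum>K\<in>code_class ` \<F>.
     of_nat (card (Aut (rep \<F> K))) * Poly_Mapping.lookup v K * cnj (Poly_Mapping.lookup w K))"

definition kneser_hecke ::
  "nat \<Rightarrow> ('a::field ^ 'N::finite) set set \<Rightarrow> (('a ^ 'N) set set \<Rightarrow>\<^sub>0 complex) \<Rightarrow> ('a ^ 'N) set set \<Rightarrow>\<^sub>0 complex" where
  "kneser_hecke n \<F> v = (\<Sum>K\<in>code_class ` \<F>. scale (Poly_Mapping.lookup v K)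
     (\<Sum>D\<in>{D\<in>\<F>. vec.dim (rep \<F> K \<inter> D) = n - 1}. basis_vec D))"

text \<open>
  An \<open>m\<close>-tuple of codewords in \<open>C\<close> is an element of \<open>{..<m} \<rightarrow>\<^sub>E C\<close>. The monomial
  \<open>\<Prod>\<^sub>v x\<^sub>v ^ e\<^sub>v\<close> is the finitely supported exponent function \<open>v \<mapsto> e\<^sub>v\<close>.
\<close>

type_synonym 'a monomial = "(nat \<Rightarrow>\<^sub>0 'a) \<Rightarrow>\<^sub>0 nat"

definition field_power :: "nat \<Rightarrow> (nat \<Rightarrow>\<^sub>0 'a::zero) set" where
  "field_power m = {v. Poly_Mapping.keys v \<subseteq> {..<m}}"

definition column :: "nat \<Rightarrow> (nat \<Rightarrow> 'a::field ^ 'N) \<Rightarrow> 'N \<Rightarrow> nat \<Rightarrow>\<^sub>0 'a" where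
  "column m c i = (\<Sum>k<m. Poly_Mapping.single k (c k $ i))"

definition mon :: "nat \<Rightarrow> (nat \<Rightarrow> 'a::{field,finite} ^ 'N::finite) \<Rightarrow> 'a monomial" where
  "mon m c = (\<Sum>v\<in>field_power m. Poly_Mapping.single v (card {i. column m c i = v}))"

definition cwe_code :: "nat \<Rightarrow> ('a::{field,finite} ^ 'N::finite) set \<Rightarrow> 'a monomial \<Rightarrow>\<^sub>0 complex" where
  "cwe_code m C = (if m = 0 then 1 else (\<Sum>c\<in>{..<m} \<rightarrow>\<^sub>E C. Poly_Mapping.single (mon m c) 1))"

definition cwe ::
  "('a::{field,finite} ^ 'N::finite) set set \<Rightarrow> nat \<Rightarrow> (('a ^ 'N) set set \<Rightarrow>\<^sub>0 complex) \<Rightarrow> 'a monomial \<Rightarrow>\<^sub>0 complex" where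
  "cwe \<F> m v = (\<Sum>K\<in>code_class ` \<F>. scale (Poly_Mapping.lookup v K) (cwe_code m (rep \<F> K)))"

definition mon_coeff ::
  "('a::{field,finite} ^ 'N::finite) set set \<Rightarrow> nat \<Rightarrow> 'a monomial \<Rightarrow> (('a ^ 'N) set set \<Rightarrow>\<^sub>0 complex) \<Rightarrow> complex" where
  "mon_coeff \<F> m X v = (\<Sum>K\<in>code_class ` \<F>. Poly_Mapping.lookup v K *
     of_nat (card {c \<in> {..<m} \<rightarrow>\<^sub>E rep \<F> K. mon m c = X}))"

text \<open>The spaces \<open>\<V>\<^sub>m\<close> for \<open>m \<ge> -1\<close>, \<open>\<W>\<^sub>m\<close> and \<open>\<Y>\<^sub>m\<close>.\<close>

definition V_space ::
  "('a::{field,finite} ^ 'N::finite) set set \<Rightarrow> int \<Rightarrow> (('a ^ 'N) set set \<Rightarrow>\<^sub>0 complex) set" where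
  "V_space \<F> m = (if m < 0 then class_space \<F> else {v \<in> class_space \<F>. cwe \<F> (nat m) v = 0})"

definition W_space ::
  "('a::{field,finite} ^ 'N::finite) set set \<Rightarrow> int \<Rightarrow> (('a ^ 'N) set set \<Rightarrow>\<^sub>0 complex) set" where
  "W_space \<F> m = {w \<in> class_space \<F>. \<forall>v\<in>V_space \<F> m. class_inner \<F> w v = 0}"

definition Y_space ::
  "('a::{field,finite} ^ 'N::finite) set set \<Rightarrow> int \<Rightarrow> (('a ^ 'N) set set \<Rightarrow>\<^sub>0 complex) set" where
  "Y_space \<F> m = W_space \<F> m \<inter> V_space \<F> (m - 1)"

definition monomials :: "'N::finite itself \<Rightarrow> nat \<Rightarrow> 'a::field monomial set" where
  "monomials _ m = {X. Poly_Mapping.keys X \<subseteq> field_power m \<and>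
     (\<Sum>v\<in>Poly_Mapping.keys X. Poly_Mapping.lookup X v) = CARD('N)}"

definition mon_rank :: "'a::field monomial \<Rightarrow> nat" where
  "mon_rank X = pm.dim (pm.span (Poly_Mapping.keys X))"

definition monomials_star :: "'N::finite itself \<Rightarrow> nat \<Rightarrow> 'a::field monomial set" where
  "monomials_star N m = {X \<in> monomials N m. mon_rank X = m}"

definition monomials_one :: "'N::finite itself \<Rightarrow> nat \<Rightarrow> 'a::{field,finite} monomial set" where
  "monomials_one _ m = {mon m c |c :: nat \<Rightarrow> 'a ^ 'N.
     c \<in> {..<m} \<rightarrow>\<^sub>E UNIV \<and> vec.dim (vec.span (insert all_one (c ` {..<m}))) = m + 1}"

definition hyperplanes_through ::
  "nat \<Rightarrow> nat \<Rightarrow> ('a::field ^ 'N::finite) set \<Rightarrow> (nat \<Rightarrow> 'a ^ 'N) \<Rightarrow> ('a ^ 'N) set set" where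
  "hyperplanes_through n m C c =
     {E. vec.subspace E \<and> E \<subseteq> C \<and> vec.dim E = n - 1 \<and> c \<in> {..<m} \<rightarrow>\<^sub>E E}"

definition num_neighbours :: "('a ^ 'N) set set \<Rightarrow> ('a ^ 'N) set \<Rightarrow> ('a ^ 'N) set \<Rightarrow> nat" where
  "num_neighbours \<F> E C = card {D \<in> \<F>. D \<inter> C = E}"

text \<open>
  The exponents of \<open>q\<close> may be negative or half-integral, so real powers are used. In
  \<open>alpha_num\<close> and \<open>nu_num\<close> the arguments are \<open>q\<close>, \<open>n\<close> and \<open>m\<close>.
\<close>

fun mon0 :: "code_type \<Rightarrow> 'N::finite itself \<Rightarrow> nat \<Rightarrow> 'a::{field,finite} monomial set" where
  "mon0 qE_I N m = monomials_one N m"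
| "mon0 qE_II N m = monomials_one N m"
| "mon0 qE N m = monomials_star N m"
| "mon0 qE_1 N m = monomials_one N m"
| "mon0 qH N m = monomials_star N m"
| "mon0 qH_1 N m = monomials_one N m"

fun alpha_num :: "code_type \<Rightarrow> real \<Rightarrow> real \<Rightarrow> real \<Rightarrow> real" where
  "alpha_num qE_I q n m = q powr (n - m) - q"
| "alpha_num qE_II q n m = q powr (n - m - 1) - 1"
| "alpha_num qE q n m = q powr (n - m) - 1"
| "alpha_num qE_1 q n m = q powr (n - m - 1) - 1"
| "alpha_num qH q n m = sqrt q * (q powr (n - m) - 1)"
| "alpha_num qH_1 q n m = sqrt q * (q powr (n - m - 1) - 1)"

fun nu_num :: "code_type \<Rightarrow> real \<Rightarrow> real \<Rightarrow> real \<Rightarrow> real" where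
  "nu_num qE_I q n m = q powr (n - m) - q - q powr m + 1"
| "nu_num qE_II q n m = q powr (n - m - 1) - q powr m"
| "nu_num qE q n m = q powr (n - m) - q powr m"
| "nu_num qE_1 q n m = q powr (n - m - 1) - q powr m"
| "nu_num qH q n m = q powr (n - m + 1 / 2) - q powr m - q powr (1 / 2) + 1"
| "nu_num qH_1 q n m = q powr (n - m - 1 / 2) - q powr m - q powr (1 / 2) + 1"

definition alpha_val :: "code_type \<Rightarrow> nat \<Rightarrow> nat \<Rightarrow> nat \<Rightarrow> real" where
  "alpha_val ty q n m = alpha_num ty (real q) (real n) (real m) / (real q - 1)"

definition nu_val :: "code_type \<Rightarrow> nat \<Rightarrow> nat \<Rightarrow> nat \<Rightarrow> real" where
  "nu_val ty q n m = nu_num ty (real q) (real n) (real m) / (real q - 1)"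

lemma perm_id [simp]: "perm id c = c"
  by (simp add: perm_def)

lemma perm_comp: "bij \<pi> \<Longrightarrow> bij \<sigma> \<Longrightarrow> perm \<pi> (perm \<sigma> c) = perm (\<pi> \<circ> \<sigma>) c"
  by (simp add: perm_def vec_eq_iff o_inv_distrib)

lemma perm_inv [simp]:
  assumes "bij \<pi>"
  shows "perm (inv \<pi>) (perm \<pi> c) = c" "perm \<pi> (perm (inv \<pi>) c) = c"
proof -
  have "inv \<pi> \<circ> \<pi> = id" "\<pi> \<circ> inv \<pi> = id"
    using assms by (auto simp: fun_eq_iff bij_is_inj bij_is_surj surj_f_inv_f)
  then show "perm (inv \<pi>) (perm \<pi> c) = c" "perm \<pi> (perm (inv \<pi>) c) = c"
    using assms by (simp_all add: perm_comp bij_imp_bij_inv)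
qed

lemma bij_perm:
  assumes "bij \<pi>" shows "bij (perm \<pi>)"
  by (rule o_bij[where g = "perm (inv \<pi>)"]) (auto simp: assms fun_eq_iff)

lemma mem_code_class: "C \<in> code_class C"
proof -
  have "C = perm id ` C" by simp
  then show ?thesis
    unfolding code_class_def using bij_id by blast
qed

lemma rep_code_class:
  assumes "C \<in> \<F>"
  shows "rep \<F> (code_class C) \<in> \<F>" "\<exists>\<pi>. bij \<pi> \<and> rep \<F> (code_class C) = perm \<pi> ` C"
proof -
  show "rep \<F> (code_class C) \<in> \<F>"
    unfolding rep_def using assms by (intro inv_into_into) auto
  have "code_class (rep \<F> (code_class C)) = code_class C"
    unfolding rep_def using assms by (intro f_inv_into_f) auto
  then have "rep \<F> (code_class C) \<in> code_class C"
    using mem_code_class by metis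
  then show "\<exists>\<pi>. bij \<pi> \<and> rep \<F> (code_class C) = perm \<pi> ` C"
    by (auto simp: code_class_def)
qed

lemma code_class_perm:
  fixes C :: "('a ^ 'N::finite) set"
  assumes "bij \<pi>" shows "code_class (perm \<pi> ` C) = code_class C"
proof -
  have *: "code_class (perm \<pi> ` C) \<subseteq> code_class C" if "bij \<pi>" for \<pi> and C :: "('a ^ 'N) set"
    using that by (auto simp: code_class_def image_image perm_comp) (metis bij_comp)
  have "code_class (perm (inv \<pi>) ` perm \<pi> ` C) \<subseteq> code_class (perm \<pi> ` C)"
    using assms by (intro *) (rule bij_imp_bij_inv)
  then show ?thesis
    using *[OF assms, of C] assms by (auto simp: image_image)
qed

lemma sum_perm: "bij \<pi> \<Longrightarrow> (\<Sum>i\<in>UNIV. f (inv \<pi> i)) = (\<Sum>i\<in>(UNIV :: 'N::finite set). f i)"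
  by (rule sum.reindex_bij_betw) (rule bij_imp_bij_inv)

lemma sum_less_perm:
  fixes f :: "'N::{finite,linorder} \<Rightarrow> 'N \<Rightarrow> 'b::comm_monoid_add" and \<sigma> :: "'N \<Rightarrow> 'N"
  assumes "bij \<sigma>" and "\<And>i j. f i j = f j i"
  shows "(\<Sum>(i, j)\<in>{(i, j). i < j}. f (\<sigma> i) (\<sigma> j)) = (\<Sum>(i, j)\<in>{(i, j). i < j}. f i j)"
proof -
  have inj: "\<sigma> x = \<sigma> y \<longleftrightarrow> x = y" for x y
    using assms(1) by (simp add: bij_is_inj inj_eq)
  have inj': "inv \<sigma> x = inv \<sigma> y \<longleftrightarrow> x = y" for x y
    using assms(1) by (metis bij_inv_eq_iff)
  have [simp]: "\<sigma> (inv \<sigma> x) = x" "inv \<sigma> (\<sigma> x) = x" for x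
    using assms(1) by (simp_all add: bij_is_surj surj_f_inv_f bij_is_inj)
  define u where "u = (\<lambda>(i, j). (min (inv \<sigma> i) (inv \<sigma> j), max (inv \<sigma> i) (inv \<sigma> j)))"
  define w where "w = (\<lambda>(i, j). (min (\<sigma> i) (\<sigma> j), max (\<sigma> i) (\<sigma> j)))"
  show ?thesis
    by (rule sum.reindex_bij_witness[of _ u w])
      (auto simp: u_def w_def min_def max_def inj inj' assms(2) order.order_iff_strict split: if_splits,
        (metis inj inj' neq_iff)+)
qed

lemma perm_form:
  fixes x y :: "'a::{field,finite} ^ 'N::finite"
  assumes "bij \<pi>"
  shows "euclidean_form (perm \<pi> x) (perm \<pi> y) = euclidean_form x y"
    "hermitian_form (perm \<pi> x) (perm \<pi> y) = hermitian_form x y"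
  using sum_perm[OF assms, of "\<lambda>i. x $ i * y $ i"]
    sum_perm[OF assms, of "\<lambda>i. x $ i * (y $ i) ^ floor_sqrt (CARD('a))"]
  by (simp_all add: euclidean_form_def hermitian_form_def perm_def)

lemma linear_perm: "Vector_Spaces.linear (*s) (*s) (perm \<pi> :: 'a::field ^ 'N::finite \<Rightarrow> _)"
  by unfold_locales (simp_all add: perm_def vec_eq_iff algebra_simps)

lemma self_dual_perm:
  fixes C :: "('a::field ^ 'N::finite) set"
  assumes "bij \<pi>" and "\<And>x y. b (perm \<pi> x) (perm \<pi> y) = b x y" and "self_dual b C"
  shows "self_dual b (perm \<pi> ` C)"
  unfolding self_dual_def
proof
  have mem: "x \<in> perm \<pi> ` C \<longleftrightarrow> perm (inv \<pi>) x \<in> C" for x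
    using assms(1) by (auto intro!: image_eqI[of x _ "perm (inv \<pi>) x"])
  have lin: "perm \<sigma> 0 = 0" "perm \<sigma> (x + y) = perm \<sigma> x + perm \<sigma> y" "perm \<sigma> (a *s x) = a *s perm \<sigma> x"
    for \<sigma> and x y :: "('a, 'N) vec" and a
    by (simp_all add: perm_def vec_eq_iff)
  have "vec.subspace C"
    using assms(3) by (simp add: self_dual_def)
  then show "vec.subspace (perm \<pi> ` C)"
    by (simp add: vec.subspace_def mem lin)
  have C: "C = dual b C"
    using assms(3) by (simp add: self_dual_def)
  show "perm \<pi> ` C = dual b (perm \<pi> ` C)"
  proof (intro set_eqI)
    fix x
    have "x \<in> perm \<pi> ` C \<longleftrightarrow> perm (inv \<pi>) x \<in> C"
      by (rule mem)
    also have "\<dots> \<longleftrightarrow> (\<forall>c\<in>C. b (perm (inv \<pi>) x) c = 0)"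
      using C by (auto simp: dual_def)
    also have "\<dots> \<longleftrightarrow> (\<forall>c\<in>C. b x (perm \<pi> c) = 0)"
      using assms(1) assms(2)[of "perm (inv \<pi>) x"] by simp
    finally show "x \<in> perm \<pi> ` C \<longleftrightarrow> x \<in> dual b (perm \<pi> ` C)"
      by (simp add: dual_def)
  qed
qed

lemma doubly_even_perm:
  fixes C :: "('a::field ^ 'N::{finite,linorder}) set"
  assumes "bij \<pi>" and "doubly_even C"
  shows "doubly_even (perm \<pi> ` C)"
proof -
  have "(\<Sum>i\<in>UNIV. c $ inv \<pi> i) = (\<Sum>i\<in>UNIV. c $ i)" for c :: "('a, 'N) vec"
    using assms(1) by (rule sum_perm)
  moreover have "(\<Sum>(i, j)\<in>{(i, j). i < j}. c $ inv \<pi> i * c $ inv \<pi> j) =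
      (\<Sum>(i, j)\<in>{(i, j). i < j}. c $ i * c $ j)" for c :: "('a, 'N) vec"
    using sum_less_perm[OF bij_imp_bij_inv[OF assms(1)], of "\<lambda>i j. c $ i * c $ j"]
    by (simp add: mult.commute)
  ultimately show ?thesis
    using assms(2) by (simp add: doubly_even_def perm_def)
qed

lemma family_perm:
  fixes C :: "('a::{field,finite} ^ 'N::{finite,linorder}) set"
  assumes "bij \<pi>" and "C \<in> family ty"
  shows "perm \<pi> ` C \<in> family ty"
proof -
  have "all_one \<in> perm \<pi> ` C" if "all_one \<in> C"
  proof -
    have "perm \<pi> all_one = (all_one :: ('a, 'N) vec)"
      by (simp add: perm_def all_one_def)
    then show ?thesis
      using that by (metis image_eqI)
  qed
  then show ?thesis
    using assms by (cases ty) (auto intro!: self_dual_perm doubly_even_perm simp: perm_form)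
qed

lemma sum_basis_vec:
  fixes f :: "_ \<Rightarrow> 'b::ab_group_add"
  assumes "C \<in> (\<F> :: ('a::finite ^ 'N::finite) set set)"
    and "\<And>x. s 1 x = x" and "\<And>x. s 0 x = 0"
  shows "(\<Sum>K\<in>code_class ` \<F>. s (Poly_Mapping.lookup (basis_vec C) K) (f K)) = f (code_class C)"
proof -
  have "(\<Sum>K\<in>code_class ` \<F>. s (Poly_Mapping.lookup (basis_vec C) K) (f K)) =
      (\<Sum>K\<in>code_class ` \<F>. if K = code_class C then f K else 0)"
    by (intro sum.cong) (auto simp: basis_vec_def lookup_single assms(2,3))
  also have "\<dots> = f (code_class C)"
    using assms(1) by (simp add: sum.delta)
  finally show ?thesis .
qed

lemma kneser_hecke_basis_vec:
  fixes \<F> :: "('a::{field,finite} ^ 'N::{finite,linorder}) set set"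
  assumes \<F>: "\<F> = family ty" and C: "C \<in> \<F>"
  shows "kneser_hecke n \<F> (basis_vec C) = (\<Sum>D\<in>{D\<in>\<F>. vec.dim (C \<inter> D) = n - 1}. basis_vec D)"
proof -
  obtain \<pi> where \<pi>: "bij \<pi>" and R: "rep \<F> (code_class C) = perm \<pi> ` C"
    using rep_code_class[OF C] by blast
  have dim: "vec.dim (perm \<pi> ` S) = vec.dim S" for S :: "('a, 'N) vec set"
    using vec.dim_image_eq[OF linear_perm, of \<pi> S] inj_on_subset[OF bij_is_inj[OF bij_perm[OF \<pi>]] subset_UNIV]
    by blast
  have dim': "vec.dim (perm \<pi> ` C \<inter> perm \<pi> ` D) = vec.dim (C \<inter> D)" for D
    using dim[of "C \<inter> D"] image_Int[OF bij_is_inj[OF bij_perm[OF \<pi>]], of C D] by metis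
  have inv: "perm \<pi> ` perm (inv \<pi>) ` D = D" "perm (inv \<pi>) ` perm \<pi> ` D = D" for D :: "('a, 'N) vec set"
    using \<pi> by (simp_all add: image_image)
  have "kneser_hecke n \<F> (basis_vec C) =
      (\<Sum>D\<in>{D\<in>\<F>. vec.dim (perm \<pi> ` C \<inter> D) = n - 1}. basis_vec D)"
    unfolding kneser_hecke_def using C R by (subst sum_basis_vec) simp_all
  also have "\<dots> = (\<Sum>D\<in>{D\<in>\<F>. vec.dim (C \<inter> D) = n - 1}. basis_vec D)"
  proof (rule sum.reindex_bij_witness[where i = "image (perm \<pi>)" and j = "image (perm (inv \<pi>))"])
    fix D assume D: "D \<in> {D\<in>\<F>. vec.dim (perm \<pi> ` C \<inter> D) = n - 1}"
    then have "perm (inv \<pi>) ` D \<in> \<F>"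
      using family_perm[OF bij_imp_bij_inv[OF \<pi>]] \<F> by blast
    then show "perm (inv \<pi>) ` D \<in> {D\<in>\<F>. vec.dim (C \<inter> D) = n - 1}"
      using D dim'[of "perm (inv \<pi>) ` D"] inv by simp
    show "basis_vec (perm (inv \<pi>) ` D) = basis_vec D"
      by (simp add: basis_vec_def code_class_perm[OF bij_imp_bij_inv[OF \<pi>]])
  next
    fix D assume D: "D \<in> {D\<in>\<F>. vec.dim (C \<inter> D) = n - 1}"
    then have "perm \<pi> ` D \<in> \<F>"
      using family_perm[OF \<pi>] \<F> by blast
    then show "perm \<pi> ` D \<in> {D\<in>\<F>. vec.dim (perm \<pi> ` C \<inter> D) = n - 1}"
      using D dim' by simp
  qed (simp_all add: inv)
  finally show ?thesis .
qed

lemma mon_perm: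
  assumes "bij \<pi>"
  shows "mon m (\<lambda>k\<in>{..<m}. perm \<pi> (c k)) = mon m c"
proof -
  have col: "column m (\<lambda>k\<in>{..<m}. perm \<pi> (c k)) i = column m c (inv \<pi> i)" for i
    by (simp add: column_def perm_def)
  have "{i. column m c (inv \<pi> i) = v} = \<pi> ` {i. column m c i = v}" for v
    using bij_image_Collect_eq[OF assms] by simp
  then have "card {i. column m c (inv \<pi> i) = v} = card {i. column m c i = v}" for v
    using assms by (simp add: card_image inj_on_subset[OF bij_is_inj[OF assms]])
  then show ?thesis
    by (simp add: mon_def col)
qed

lemma bij_betw_tuples:
  assumes "bij \<pi>"
  shows "bij_betw (\<lambda>c. \<lambda>k\<in>{..<m::nat}. perm \<pi> (c k)) ({..<m} \<rightarrow>\<^sub>E C) ({..<m} \<rightarrow>\<^sub>E perm \<pi> ` C)"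
proof (rule bij_betw_byWitness[where f' = "\<lambda>c. \<lambda>k\<in>{..<m}. perm (inv \<pi>) (c k)"])
  show "\<forall>c\<in>{..<m} \<rightarrow>\<^sub>E C. (\<lambda>k\<in>{..<m}. perm (inv \<pi>) ((\<lambda>k\<in>{..<m}. perm \<pi> (c k)) k)) = c"
    "\<forall>c\<in>{..<m} \<rightarrow>\<^sub>E perm \<pi> ` C. (\<lambda>k\<in>{..<m}. perm \<pi> ((\<lambda>k\<in>{..<m}. perm (inv \<pi>) (c k)) k)) = c"
    by (intro ballI extensionalityI[where A = "{..<m}"]; use assms in \<open>simp add: PiE_iff\<close>)+
  show "(\<lambda>c. \<lambda>k\<in>{..<m}. perm \<pi> (c k)) ` ({..<m} \<rightarrow>\<^sub>E C) \<subseteq> {..<m} \<rightarrow>\<^sub>E perm \<pi> ` C"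
    by (intro image_subsetI) (simp add: PiE_iff)
  have "perm (inv \<pi>) x \<in> C" if "x \<in> perm \<pi> ` C" for x
    using that assms by auto
  then show "(\<lambda>c. \<lambda>k\<in>{..<m}. perm (inv \<pi>) (c k)) ` ({..<m} \<rightarrow>\<^sub>E perm \<pi> ` C) \<subseteq> {..<m} \<rightarrow>\<^sub>E C"
    by (intro image_subsetI) (simp add: PiE_iff)
qed

lemma cwe_basis_vec:
  assumes "C \<in> \<F>"
  shows "cwe \<F> m (basis_vec C) = cwe_code m C"
proof -
  obtain \<pi> where \<pi>: "bij \<pi>" and R: "rep \<F> (code_class C) = perm \<pi> ` C"
    using rep_code_class[OF assms] by blast
  have "cwe \<F> m (basis_vec C) = cwe_code m (perm \<pi> ` C)"
    unfolding cwe_def using assms R by (subst sum_basis_vec) simp_all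
  also have "\<dots> = cwe_code m C"
    using sum.reindex_bij_betw[OF bij_betw_tuples[OF \<pi>, of m C],
        of "\<lambda>c. Poly_Mapping.single (mon m c) (1::complex)"]
    by (simp add: cwe_code_def mon_perm[OF \<pi>])
  finally show ?thesis .
qed

lemma mon_coeff_basis_vec:
  assumes "C \<in> \<F>"
  shows "mon_coeff \<F> m X (basis_vec C) = of_nat (card {c \<in> {..<m} \<rightarrow>\<^sub>E C. mon m c = X})"
proof -
  obtain \<pi> where \<pi>: "bij \<pi>" and R: "rep \<F> (code_class C) = perm \<pi> ` C"
    using rep_code_class[OF assms] by blast
  have *: "bij_betw h {c \<in> A. Q c} {c \<in> B. Q c}"
    if "bij_betw h A B" and "\<And>c. Q (h c) = Q c" for h :: "'x \<Rightarrow> 'x" and A B Q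
    using that by (auto simp: bij_betw_def inj_on_def)
  have "card {c \<in> {..<m} \<rightarrow>\<^sub>E C. mon m c = X} = card {c \<in> {..<m} \<rightarrow>\<^sub>E perm \<pi> ` C. mon m c = X}"
    by (rule bij_betw_same_card[OF *[OF bij_betw_tuples[OF \<pi>]]]) (simp only: mon_perm[OF \<pi>])
  then show ?thesis
    unfolding mon_coeff_def using assms R
    by (subst sum_basis_vec[where s = "(*)"]) simp_all
qed

lemma card_Aut_perm:
  assumes "bij \<pi>"
  shows "card (Aut (perm \<pi> ` C)) = card (Aut C)"
proof (rule bij_betw_same_card[symmetric], rule bij_betw_byWitness[where
      f = "\<lambda>\<sigma>. \<pi> \<circ> \<sigma> \<circ> inv \<pi>" and f' = "\<lambda>\<sigma>. inv \<pi> \<circ> \<sigma> \<circ> \<pi>"])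
  have [simp]: "inv \<pi> (\<pi> x) = x" "\<pi> (inv \<pi> x) = x" for x
    using assms by (simp_all add: bij_is_inj bij_is_surj surj_f_inv_f)
  note b = assms bij_imp_bij_inv[OF assms]
  show "\<forall>\<sigma>\<in>Aut C. inv \<pi> \<circ> (\<pi> \<circ> \<sigma> \<circ> inv \<pi>) \<circ> \<pi> = \<sigma>"
    "\<forall>\<sigma>\<in>Aut (perm \<pi> ` C). \<pi> \<circ> (inv \<pi> \<circ> \<sigma> \<circ> \<pi>) \<circ> inv \<pi> = \<sigma>"
    by (auto simp: fun_eq_iff)
  show "(\<lambda>\<sigma>. \<pi> \<circ> \<sigma> \<circ> inv \<pi>) ` Aut C \<subseteq> Aut (perm \<pi> ` C)"
  proof clarify
    fix \<sigma> assume "\<sigma> \<in> Aut C"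
    then have \<sigma>: "bij \<sigma>" "perm \<sigma> ` C = C" by (auto simp: Aut_def)
    have "perm (\<pi> \<circ> \<sigma> \<circ> inv \<pi>) ` perm \<pi> ` C = perm \<pi> ` perm \<sigma> ` C"
      using b \<sigma>(1) by (simp add: image_image perm_comp[symmetric] bij_comp)
    then show "\<pi> \<circ> \<sigma> \<circ> inv \<pi> \<in> Aut (perm \<pi> ` C)"
      using b \<sigma> by (simp add: Aut_def bij_comp)
  qed
  show "(\<lambda>\<sigma>. inv \<pi> \<circ> \<sigma> \<circ> \<pi>) ` Aut (perm \<pi> ` C) \<subseteq> Aut C"
  proof clarify
    fix \<sigma> assume "\<sigma> \<in> Aut (perm \<pi> ` C)"
    then have \<sigma>: "bij \<sigma>" "perm \<sigma> ` perm \<pi> ` C = perm \<pi> ` C" by (auto simp: Aut_def)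
    have "perm (inv \<pi> \<circ> \<sigma> \<circ> \<pi>) ` C = perm (inv \<pi>) ` perm \<sigma> ` perm \<pi> ` C"
      using b \<sigma>(1) by (simp add: image_image perm_comp[symmetric] bij_comp)
    also have "\<dots> = C"
      using b by (simp only: \<sigma>(2)) (simp add: image_image)
    finally show "inv \<pi> \<circ> \<sigma> \<circ> \<pi> \<in> Aut C"
      using b \<sigma> by (simp add: Aut_def bij_comp)
  qed
qed

lemma class_inner_basis_vec:
  assumes "C \<in> (\<F> :: ('a::finite ^ 'N::finite) set set)"
  shows "class_inner \<F> (basis_vec C) (basis_vec D) =
    (if code_class C = code_class D then of_nat (card (Aut C)) else 0)"
proof -
  have "card (Aut (rep \<F> (code_class C))) = card (Aut C)"
    using rep_code_class(2)[OF assms] card_Aut_perm by metis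
  moreover have "class_inner \<F> (basis_vec C) (basis_vec D) =
      (\<Sum>K\<in>code_class ` \<F>. Poly_Mapping.lookup (basis_vec C) K *
        (of_nat (card (Aut (rep \<F> K))) * cnj (Poly_Mapping.lookup (basis_vec D) K)))"
    unfolding class_inner_def by (intro sum.cong) simp_all
  ultimately show ?thesis
    using assms by (subst (asm) sum_basis_vec[where s = "(*)"])
      (simp_all add: basis_vec_def lookup_single)
qed

end

theory Submission
  imports Defs "HOL-Combinatorics.Permutations"
begin

text \<open>
  For \<open>C \<in> \<F>\<close> and \<open>X = mon(c)\<close> with \<open>c\<close> independent modulo \<open>u\<close>, consider the tuples \<open>c\<close> with monomial
  \<open>X\<close> in the neighbours \<open>D\<close> of \<open>C\<close>. A tuple in \<open>C\<^sup>m\<close> lies in \<open>\<alpha>\<^sub>m\<close> neighbours. A tuple not in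
  \<open>C\<^sup>m\<close> lies in at most one neighbour, \<open>D = (C \<inter> x\<^sup>\<bottom>) + \<langle>x\<rangle>\<close> for any entry \<open>x \<notin> C\<close>, and it does
  so iff \<open>C\<close> contains a hyperplane of \<open>\<langle>c\<rangle>\<close>. Hence \<open>a\<^sub>X(T[C])\<close> is \<open>\<alpha>\<^sub>m a\<^sub>X([C])\<close> plus the number of pairs of
  a tuple \<open>c\<close> with monomial \<open>X\<close> and a hyperplane of \<open>\<langle>c\<rangle>\<close> in \<open>C\<close>, where the \<open>(q\<^sup>m - 1)/(q - 1)\<close>
  hyperplanes for \<open>c \<in> C\<^sup>m\<close> have to be subtracted. The number of pairs depends on \<open>(m-1)\<close>-tuples of
  codewords only and so vanishes on \<open>\<V>\<^sub>m\<^sub>-\<^sub>1\<close>. Thus \<open>T\<close> acts on \<open>\<V>\<^sub>m\<^sub>-\<^sub>1\<close> as \<open>\<nu>\<^sub>m\<close> modulo \<open>\<V>\<^sub>m\<close>, and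
  self-adjointness of \<open>T\<close> turns this into an equation on \<open>\<Y>\<^sub>m\<close>.
\<close>

section \<open>Subspaces of vector spaces over finite fields\<close>

text \<open>The value \<alpha>_m is a product. Every code of the family contains u, so the
  intersection of C with a neighbour through c is a hyperplane of C through the span of u and c.
  With e = 0 for u = 0 and e = 1 otherwise, there are (q^(n-m-e) - 1)/(q - 1) such hyperplanes, and
  each belongs to \<open>\<kappa>\<close> neighbours. Counting isotropic vectors gives
  \<open>\<kappa>\<close> = 1 for the types q^E, q^E_1 and q^E_II, q for q^E_I, and sqrt q for the
  two Hermitian types. In even characteristic a self-dual code always contains the all-one vector,
  which is why q^E_I is treated with u equal to that vector although its definition does not mention
  it. Equality of monomials is used throughout as equality of tuples up to a coordinate permutation;
  this requires u and the family to be stable under permutations. An obstacle at the boundary: for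
  nonzero u and m = n the table contains q^(-1) and counts nothing. There the claim on the sum is
  vacuous and the one on T concerns the zero space.\<close>

lemma card_span_independent:
  fixes B :: "('a::{field,finite} ^ 'N::finite) set"
  assumes "vec.independent B"
  shows "card (vec.span B) = CARD('a) ^ card B"
  using vec.finiteI_independent[OF assms] assms
proof (induction B rule: finite_induct)
  case empty
  then show ?case by simp
next
  case (insert x B)
  have ind: "vec.independent B" and x: "x \<notin> vec.span B"
    using insert.prems insert.hyps by (simp_all add: vec.independent_insert)
  let ?h = "\<lambda>(k, y). k *s x + y"
  have "vec.span (insert x B) = ?h ` (UNIV \<times> vec.span B)"
  proof (intro set_eqI iffI)
    fix z assume "z \<in> vec.span (insert x B)"
    then obtain k where "z - k *s x \<in> vec.span B"
      by (auto simp: vec.span_insert)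
    then show "z \<in> ?h ` (UNIV \<times> vec.span B)"
      by (intro image_eqI[of _ _ "(k, z - k *s x)"]) auto
  next
    fix z assume "z \<in> ?h ` (UNIV \<times> vec.span B)"
    then obtain k y where "z = k *s x + y" "y \<in> vec.span B" by auto
    then show "z \<in> vec.span (insert x B)"
      by (auto simp: vec.span_insert intro!: exI[of _ k])
  qed
  moreover have "inj_on ?h (UNIV \<times> vec.span B)"
  proof (rule inj_onI, clarify)
    fix k l y z assume yz: "y \<in> vec.span B" "z \<in> vec.span B" and eq: "k *s x + y = l *s x + z"
    have "(k - l) *s x = z - y"
      using eq by (simp add: vec.scale_left_diff_distrib algebra_simps)
    then have *: "(k - l) *s x \<in> vec.span B"
      using yz by (simp add: vec.span_diff)
    have "k = l"
    proof (rule ccontr)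
      assume "k \<noteq> l"
      then have "x = (1 / (k - l)) *s ((k - l) *s x)"
        by (simp only: vec.scale_scale) simp
      then show False using * x by (metis vec.span_scale)
    qed
    then show "k = l \<and> y = z" using eq by simp
  qed
  ultimately have "card (vec.span (insert x B)) = card ((UNIV :: 'a set) \<times> vec.span B)"
    by (simp only: card_image)
  then show ?case
    using insert.IH[OF ind] insert.hyps by (simp add: card_cartesian_product)
qed

lemma card_subspace:
  fixes S :: "('a::{field,finite} ^ 'N::finite) set"
  assumes "vec.subspace S"
  shows "card S = CARD('a) ^ vec.dim S"
proof -
  obtain B where "finite B" "B \<subseteq> S" "vec.independent B" "vec.span B = S" "card B = vec.dim S"
    by (rule vec.basis_subspace_exists[OF assms])
  then show ?thesis
    using card_span_independent[of B] by simp
qed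

lemma one_less_card_field: "1 < CARD('a::{field,finite})"
proof -
  have "card {0, 1 :: 'a} \<le> CARD('a)"
    by (intro card_mono) auto
  then show ?thesis by simp
qed

lemma span_insert_hyperplane:
  fixes x :: "'a::field ^ 'N::finite"
  assumes "vec.subspace E" "vec.subspace D" "E \<subseteq> D" "vec.dim D \<le> vec.dim E + 1" "x \<in> D" "x \<notin> E"
  shows "vec.span (insert x E) = D"
proof (rule vec.subspace_dim_equal)
  show "vec.span (insert x E) \<subseteq> D"
    using assms by (intro vec.span_minimal) auto
  have "x \<notin> vec.span E"
    using assms(1,6) by (simp add: vec.span_eq_iff[THEN iffD2])
  then show "vec.dim D \<le> vec.dim (vec.span (insert x E))"
    using assms(4) by (simp add: vec.dim_insert)
qed (use assms(2) in auto)

lemma dim_kernel_ge: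
  fixes f :: "'a::field ^ 'N::finite \<Rightarrow> 'a"
  assumes W: "vec.subspace W"
    and add: "\<And>x y. f (x + y) = f x + f y" and scale: "\<And>a x. f (a *s x) = a * f x"
  shows "vec.subspace {x \<in> W. f x = 0}" "vec.dim W \<le> vec.dim {x \<in> W. f x = 0} + 1"
proof -
  let ?K = "{x \<in> W. f x = 0}"
  have f0: "f 0 = 0" using scale[of 0 0] by simp
  show K: "vec.subspace ?K"
    using W by (auto simp: vec.subspace_def add scale f0)
  show "vec.dim W \<le> vec.dim ?K + 1"
  proof (cases "W \<subseteq> ?K")
    case True
    then show ?thesis using vec.dim_subset[OF True] by simp
  next
    case False
    then obtain w where w: "w \<in> W" "f w \<noteq> 0" using W by auto
    have "W \<subseteq> vec.span (insert w ?K)"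
    proof
      fix x assume x: "x \<in> W"
      define k where "k = f x / f w"
      have "x - k *s w \<in> ?K"
        using x w vec.subspace_diff[OF W x vec.subspace_scale[OF W w(1)]] add[of "x - k *s w" "k *s w"]
        by (simp add: scale k_def)
      then have "x - k *s w \<in> vec.span ?K" by (rule vec.span_base)
      then show "x \<in> vec.span (insert w ?K)"
        unfolding vec.span_insert by blast
    qed
    then have "vec.dim W \<le> vec.dim (insert w ?K)"
      by (rule vec.dim_mono)
    also have "\<dots> \<le> vec.dim ?K + 1"
      by (simp add: vec.dim_insert)
    finally show ?thesis .
  qed
qed

section \<open>Counting hyperplanes between two subspaces\<close>

text \<open>Adding 1 on the left instead of subtracting on the right leaves the zero space without
  hyperplanes, in accordance with the count (q^0 - 1)/(q - 1) = 0. \<open>U\<close> may be any set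
  of vectors.\<close>

definition hyperplanes :: "('a::field ^ 'N::finite) set \<Rightarrow> ('a ^ 'N) set \<Rightarrow> ('a ^ 'N) set set" where
  "hyperplanes U W = {E. vec.subspace E \<and> U \<subseteq> E \<and> E \<subseteq> W \<and> vec.dim E + 1 = vec.dim W}"

lemma hyperplanes_span: "hyperplanes (vec.span U) W = hyperplanes U W"
  unfolding hyperplanes_def using vec.span_minimal vec.span_superset by blast

text \<open>Double counting of the pairs (E, x) with x in E but not in U. With d the codimension of
  U, each E contributes q^(dim U) (q^(d-1) - 1) vectors, while the E through a given x are the
  hyperplanes over the span of U and x, of codimension d - 1. The factor q^(d-1) - 1 is cancelled at
  the end, so d = 0 and d = 1 are treated separately.\<close>

lemma card_hyperplanes_subspace:
  fixes U W :: "('a::{field,finite} ^ 'N::finite) set"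
  assumes "vec.subspace U" "vec.subspace W" "U \<subseteq> W"
  shows "card (hyperplanes U W) * (CARD('a) - 1) = CARD('a) ^ (vec.dim W - vec.dim U) - 1"
  using assms
proof (induction "vec.dim W - vec.dim U" arbitrary: U rule: less_induct)
  case less
  let ?q = "CARD('a)"
  have le: "vec.dim U \<le> vec.dim W"
    by (rule vec.dim_subset[OF less.prems(3)])
  consider "vec.dim W = vec.dim U" | "vec.dim W = vec.dim U + 1" | "vec.dim W \<ge> vec.dim U + 2"
    using le by linarith
  then show ?case
  proof cases
    case 1
    have "False" if "E \<in> hyperplanes U W" for E
      using 1 that vec.dim_subset[of U E] by (simp add: hyperplanes_def)
    then have "hyperplanes U W = {}" by blast
    then show ?thesis using 1 by simp
  next
    case 2
    have "hyperplanes U W = {U}"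
    proof (intro set_eqI iffI)
      fix E assume "E \<in> hyperplanes U W"
      then show "E \<in> {U}"
        using 2 less.prems vec.subspace_dim_equal[of U E] by (simp add: hyperplanes_def)
    qed (use 2 less.prems in \<open>simp add: hyperplanes_def\<close>)
    then show ?thesis using 2 by simp
  next
    case 3
    define d where "d = vec.dim W - vec.dim U"
    have d: "vec.dim W = vec.dim U + d" "2 \<le> d" using 3 by (auto simp: d_def)
    have card_diff: "card (V - U) = ?q ^ vec.dim V - ?q ^ vec.dim U"
      if "vec.subspace V" "U \<subseteq> V" for V
      using that less.prems(1) by (simp add: card_Diff_subset card_subspace)
    have sub: "(\<Sum>E\<in>hyperplanes U W. card (E - U)) =
        (\<Sum>x\<in>W - U. card {E \<in> hyperplanes U W. x \<in> E})"
    proof -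
      have "(\<Sum>E\<in>hyperplanes U W. card (E - U)) =
          (\<Sum>E\<in>hyperplanes U W. \<Sum>x\<in>W - U. if x \<in> E then 1 else 0)"
      proof (rule sum.cong)
        fix E assume "E \<in> hyperplanes U W"
        then have "E - U = {x \<in> W - U. x \<in> E}" by (auto simp: hyperplanes_def)
        then show "card (E - U) = (\<Sum>x\<in>W - U. if x \<in> E then 1 else 0)"
          by (simp add: sum.If_cases Int_def)
      qed simp
      also have "\<dots> = (\<Sum>x\<in>W - U. \<Sum>E\<in>hyperplanes U W. if x \<in> E then 1 else 0)"
        by (rule sum.swap)
      finally show ?thesis by (simp add: sum.If_cases Int_def)
    qed
    have ih: "card {E \<in> hyperplanes U W. x \<in> E} * (?q - 1) = ?q ^ (d - 1) - 1" if x: "x \<in> W - U" for x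
    proof -
      let ?U = "vec.span (insert x U)"
      have "x \<notin> vec.span U"
        using x less.prems(1) by (simp add: vec.span_eq_iff[THEN iffD2])
      then have dim: "vec.dim ?U = vec.dim U + 1"
        by (simp add: vec.dim_insert)
      have "?U \<subseteq> W"
        using x less.prems by (intro vec.span_minimal) auto
      then have "card (hyperplanes ?U W) * (?q - 1) = ?q ^ (vec.dim W - vec.dim ?U) - 1"
        using dim d less.prems(2) by (intro less.hyps) auto
      moreover have "hyperplanes ?U W = {E \<in> hyperplanes U W. x \<in> E}"
        unfolding hyperplanes_span by (auto simp: hyperplanes_def)
      moreover have "vec.dim W - vec.dim ?U = d - 1"
        using dim d by simp
      ultimately show ?thesis by metis
    qed
    have E: "card (E - U) = ?q ^ vec.dim U * (?q ^ (d - 1) - 1)" if "E \<in> hyperplanes U W" for E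
    proof -
      have "vec.dim E = vec.dim U + (d - 1)" using that d by (auto simp: hyperplanes_def)
      then show ?thesis
        using that card_diff[of E] by (simp add: hyperplanes_def power_add diff_mult_distrib2)
    qed
    have "card (hyperplanes U W) * (?q - 1) * (?q ^ vec.dim U * (?q ^ (d - 1) - 1)) =
        (\<Sum>E\<in>hyperplanes U W. card (E - U)) * (?q - 1)"
      by (simp add: E)
    also have "\<dots> = (\<Sum>x\<in>W - U. card {E \<in> hyperplanes U W. x \<in> E} * (?q - 1))"
      unfolding sub by (simp add: sum_distrib_right)
    also have "\<dots> = card (W - U) * (?q ^ (d - 1) - 1)"
      by (simp only: ih sum_constant of_nat_id cong: sum.cong)
    also have "\<dots> = (?q ^ d - 1) * (?q ^ vec.dim U * (?q ^ (d - 1) - 1))"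
    proof -
      have "card (W - U) = ?q ^ vec.dim U * (?q ^ d - 1)"
        using less.prems d by (simp add: card_diff power_add diff_mult_distrib2)
      then show ?thesis by simp
    qed
    finally have eq: "card (hyperplanes U W) * (?q - 1) * (?q ^ vec.dim U * (?q ^ (d - 1) - 1)) =
        (?q ^ d - 1) * (?q ^ vec.dim U * (?q ^ (d - 1) - 1))" .
    have "1 < ?q ^ (d - 1)"
      using one_less_card_field d by (intro one_less_power) auto
    then have "?q ^ vec.dim U * (?q ^ (d - 1) - 1) \<noteq> 0" by simp
    with eq have "card (hyperplanes U W) * (?q - 1) = ?q ^ d - 1"
      by (metis mult_right_cancel)
    then show ?thesis by (simp add: d_def)
  qed
qed

lemma card_hyperplanes:
  fixes U W :: "('a::{field,finite} ^ 'N::finite) set"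
  assumes "vec.subspace W" "U \<subseteq> W"
  shows "real (card (hyperplanes U W)) =
    (real CARD('a) ^ (vec.dim W - vec.dim U) - 1) / (real CARD('a) - 1)"
proof -
  have "card (hyperplanes U W) * (CARD('a) - 1) = CARD('a) ^ (vec.dim W - vec.dim U) - 1"
    using card_hyperplanes_subspace[OF vec.subspace_span assms(1), of U] assms
    by (simp add: hyperplanes_span vec.span_minimal)
  moreover have "1 \<le> CARD('a) ^ (vec.dim W - vec.dim U)" by simp
  ultimately have "card (hyperplanes U W) * (CARD('a) - 1) + 1 = CARD('a) ^ (vec.dim W - vec.dim U)"
    by linarith
  then have "real (card (hyperplanes U W) * (CARD('a) - 1) + 1) = real (CARD('a) ^ (vec.dim W - vec.dim U))"
    by (rule arg_cong)
  then show ?thesis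
    using one_less_card_field[where 'a='a] by (simp add: of_nat_diff field_simps)
qed

section \<open>Frobenius and trace in a finite field\<close>

lemma char_finite_field_prime: "prime CHAR('a::{field,finite})"
  using finite_imp_CHAR_pos[where 'a='a] prime_CHAR_semidom[where 'a='a] by simp

lemma power_card_eq_self: "x ^ CARD('a) = (x :: 'a::{field,finite})"
proof (cases "x = 0")
  case False
  have "x ^ (CARD('a) - 1) * \<Prod>(UNIV - {0}) = (\<Prod>y\<in>UNIV - {0}. x * y)"
    by (simp add: prod.distrib)
  also have "\<dots> = (\<Prod>y\<in>UNIV - {0}. y)"
    by (rule prod.reindex_bij_witness[of _ "\<lambda>y. y / x" "\<lambda>y. x * y"]) (use False in auto)
  finally have "x ^ (CARD('a) - 1) = 1" by simp
  then have "x ^ Suc (CARD('a) - 1) = x" by (simp only: power_Suc mult_1_right)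
  moreover have "Suc (CARD('a) - 1) = CARD('a)" by simp
  ultimately show ?thesis by metis
qed simp

text \<open>Take a maximal additive subgroup H of p-power order. If x lies outside H, the multiples
  of x together with H form a subgroup of order p |H|, contradicting maximality; so H is the whole
  field.\<close>

lemma card_eq_power_CHAR: "\<exists>k. CARD('a::{field,finite}) = CHAR('a) ^ k"
proof -
  let ?p = "CHAR('a)"
  have p: "prime ?p" by (rule char_finite_field_prime)
  define S where "S = {H :: 'a set. 0 \<in> H \<and> (\<forall>x\<in>H. \<forall>y\<in>H. x - y \<in> H) \<and> (\<exists>k. card H = ?p ^ k)}"
  have "{0} \<in> S" by (auto simp: S_def intro!: exI[of _ 0])
  then obtain H where H: "H \<in> S" and max: "\<And>H'. H' \<in> S \<Longrightarrow> \<not> H \<subset> H'"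
    using finite_has_maximal[of S] by (metis empty_iff finite psubset_eq)
  have sub: "x - y \<in> H" if "x \<in> H" "y \<in> H" for x y using H that by (auto simp: S_def)
  have zero: "0 \<in> H" using H by (simp add: S_def)
  have neg: "- x \<in> H" if "x \<in> H" for x using sub[OF zero that] by simp
  have add: "x + y \<in> H" if "x \<in> H" "y \<in> H" for x y using sub[OF that(1) neg[OF that(2)]] by simp
  have mult: "of_nat i * x \<in> H" if "x \<in> H" for x i
    by (induction i) (auto simp: zero algebra_simps intro: add that)
  have "H = UNIV"
  proof (rule ccontr)
    assume "H \<noteq> UNIV"
    then obtain x where x: "x \<notin> H" by auto
    let ?h = "\<lambda>(i, y). of_nat i * x + y"
    define H' where "H' = ?h ` ({..<?p} \<times> H)"
    have mem: "of_nat i * x + y \<in> H'" if "y \<in> H" for i y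
      unfolding H'_def
    proof (intro image_eqI[of _ _ "(i mod ?p, y)"])
      show "(i mod ?p, y) \<in> {..<?p} \<times> H" using that p by (simp add: prime_gt_0_nat)
      have "(of_nat (i mod ?p) :: 'a) = of_nat i"
        using arg_cong[OF div_mult_mod_eq[of i ?p], of "of_nat :: nat \<Rightarrow> 'a"] by (simp only: of_nat_add of_nat_mult of_nat_CHAR) simp
      then show "of_nat i * x + y = ?h (i mod ?p, y)" by simp
    qed
    have inj: "inj_on ?h ({..<?p} \<times> H)"
    proof -
      have aux: "i = j" if "i < ?p" "j < ?p" "i \<le> j" "y \<in> H" "z \<in> H" "of_nat i * x + y = of_nat j * x + z"
        for i j y z
      proof (rule ccontr)
        assume "i \<noteq> j"
        then have ij: "0 < j - i" "j - i < ?p" using that by auto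
        have "of_nat (j - i) * x = y - z"
          using that by (simp add: of_nat_diff algebra_simps)
        then have *: "of_nat (j - i) * x \<in> H" using sub that by simp
        \<comment> \<open>As j - i is invertible modulo p, having (j - i) x in H would put x itself
          into H.\<close>
        have "gcd (j - i) ?p = 1"
          using p ij by (metis coprime_commute coprime_imp_gcd_eq_1 dvd_imp_le leD prime_imp_coprime)
        then obtain a b where "(j - i) * a = ?p * b + 1"
          using bezout_nat[of "j - i" ?p] ij by auto
        then have "of_nat ((j - i) * a) = (of_nat (?p * b + 1) :: 'a)" by simp
        then have "of_nat a * of_nat (j - i) = (1 :: 'a)"
          by (simp only: of_nat_add of_nat_mult of_nat_CHAR) (simp add: mult.commute)
        then have "of_nat a * (of_nat (j - i) * x) = x"
          by (metis mult.assoc mult_1)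
        then show False using mult[OF *, of a] x by metis
      qed
      show ?thesis
      proof (rule inj_onI, clarify)
        fix i j y z assume a: "i < ?p" "y \<in> H" "j < ?p" "z \<in> H" "of_nat i * x + y = of_nat j * x + z"
        have "i = j" using aux[of i j y z] aux[of j i z y] a by (metis nle_le)
        then show "i = j \<and> y = z" using a by simp
      qed
    qed
    have "card H' = ?p * card H"
      unfolding H'_def by (simp add: card_image[OF inj] card_cartesian_product)
    then have "\<exists>k. card H' = ?p ^ k" using H by (auto simp: S_def intro: exI[of _ "Suc _"])
    moreover have "a - b \<in> H'" if H': "a \<in> H'" "b \<in> H'" for a b
    proof -
      obtain i y where a: "a = of_nat i * x + y" "y \<in> H"
        using H'(1) by (auto simp: H'_def)
      obtain j z where b: "b = of_nat j * x + z" "j < ?p" "z \<in> H"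
        using H'(2) by (auto simp: H'_def)
      note ab = a(1) b(1) b(2) a(2) b(3)
      have "of_nat (?p - j) = - (of_nat j :: 'a)"
        using ab(3) by (simp add: of_nat_diff)
      then have eq: "a - b = of_nat (i + (?p - j)) * x + (y - z)"
        unfolding ab(1,2) by (simp only: of_nat_add) (simp add: algebra_simps)
      show ?thesis unfolding eq by (rule mem[OF sub[OF ab(4,5)]])
    qed
    moreover have "0 \<in> H'" using mem[OF zero, of 0] by simp
    ultimately have "H' \<in> S" by (simp add: S_def)
    moreover have "H \<subset> H'"
      using mem[of _ 0] mem[OF zero, of 1] x by auto
    ultimately show False using max by blast
  qed
  then show ?thesis using H by (auto simp: S_def)
qed

context
  fixes r :: nat
  assumes card: "CARD('a::{field,finite}) = r ^ 2"
begin

text \<open>Since r^2 is a power of the characteristic, so is r.\<close>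

lemma frobenius_add: "(x + y :: 'a) ^ r = x ^ r + y ^ r"
proof -
  obtain k where "r ^ 2 = CHAR('a) ^ k" using card_eq_power_CHAR[where 'a='a] card by metis
  then obtain i where "r = CHAR('a) ^ i"
    using prime_power_exp_nat[OF char_finite_field_prime, of 2 r] by auto
  then show ?thesis by (rule freshmans_dream'[OF char_finite_field_prime])
qed

lemma frobenius_involution: "((x :: 'a) ^ r) ^ r = x"
  using power_card_eq_self[of x] card by (simp add: power_mult[symmetric] power2_eq_square)

text \<open>The map t + t^r takes its values among the fixed points of the r-th power map. Both the
  set of fixed points and each fibre consist of the roots of a polynomial of degree r, so each has
  at most r elements. The fibres partition a field of r^2 elements, hence none can be smaller than
  r.\<close>

lemma card_trace_fibre:
  assumes "s ^ r = (s :: 'a)"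
  shows "card {t :: 'a. t + t ^ r = s} = r"
proof -
  have r: "1 < r"
  proof (rule ccontr)
    assume "\<not> 1 < r"
    then have "r ^ 2 \<le> 1 ^ 2" by (intro power_mono) auto
    then show False using one_less_card_field[where 'a='a] card by simp
  qed
  have fib: "card {t :: 'a. t + t ^ r = z} \<le> r" for z
  proof -
    let ?p = "monom 1 r + [:- z, 1:] :: 'a poly"
    have deg: "degree ?p = r"
      using r by (subst degree_add_eq_left) (auto simp: degree_monom_eq)
    then have "?p \<noteq> 0" using r by auto
    moreover have "{t. poly ?p t = 0} = {t :: 'a. t + t ^ r = z}"
      by (auto simp: poly_monom algebra_simps eq_neg_iff_add_eq_0)
    ultimately show ?thesis using card_poly_roots_bound[of ?p] deg by simp
  qed
  have fixed: "card {z :: 'a. z ^ r = z} \<le> r"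
  proof -
    let ?p = "monom 1 r + [:0, - 1:] :: 'a poly"
    have deg: "degree ?p = r"
      using r by (subst degree_add_eq_left) (auto simp: degree_monom_eq)
    then have "?p \<noteq> 0" using r by auto
    moreover have "{t. poly ?p t = 0} = {z :: 'a. z ^ r = z}"
      by (auto simp: poly_monom)
    ultimately show ?thesis using card_poly_roots_bound[of ?p] deg by simp
  qed
  let ?F = "{z :: 'a. z ^ r = z}"
  have "CARD('a) = card (\<Union>z\<in>?F. {t :: 'a. t + t ^ r = z})"
  proof -
    have "UNIV = (\<Union>z\<in>?F. {t :: 'a. t + t ^ r = z})"
      by (auto simp: frobenius_add frobenius_involution add.commute)
    then show ?thesis by simp
  qed
  also have "\<dots> = (\<Sum>z\<in>?F. card {t :: 'a. t + t ^ r = z})"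
    by (rule card_UN_disjoint) auto
  also have "\<dots> = card {t :: 'a. t + t ^ r = s} + (\<Sum>z\<in>?F - {s}. card {t :: 'a. t + t ^ r = z})"
    using assms by (intro sum.remove) auto
  also have "\<dots> \<le> card {t :: 'a. t + t ^ r = s} + (\<Sum>z\<in>?F - {s}. r)"
    using fib by (intro add_left_mono sum_mono) auto
  also have "\<dots> = card {t :: 'a. t + t ^ r = s} + (card ?F - 1) * r"
    using assms by simp
  also have "\<dots> \<le> card {t :: 'a. t + t ^ r = s} + (r - 1) * r"
    using fixed by (intro add_left_mono mult_right_mono) auto
  finally have "r * r \<le> card {t :: 'a. t + t ^ r = s} + (r - 1) * r"
    by (simp add: card power2_eq_square)
  then have "r \<le> card {t :: 'a. t + t ^ r = s}"
    using r by (cases r) simp_all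
  then show ?thesis using fib[of s] by simp
qed

end

section \<open>Neighbours of a code\<close>

text \<open>The Euclidean form arises from the identity, the Hermitian form from the r-th power map,
  where q = r^2.\<close>

definition sesq :: "('a \<Rightarrow> 'a) \<Rightarrow> 'a::field ^ 'N::finite \<Rightarrow> 'a ^ 'N \<Rightarrow> 'a" where
  "sesq \<sigma> x y = (\<Sum>i\<in>UNIV. x $ i * \<sigma> (y $ i))"

text \<open>
  A common setting for the six types. The vector \<open>u\<close> is \<open>0\<close> or the all-one vector. The quadratic form
  \<open>Q\<close> is \<open>0\<close>, or for doubly-even codes the sum of all \<open>x\<^sub>i x\<^sub>j\<close> with \<open>i\<close> before \<open>j\<close>; on \<open>u\<^sup>\<bottom>\<close> its polar
  form is \<open>\<delta>\<close> times the bilinear form. For \<open>y\<close> in \<open>u\<^sup>\<bottom>\<close> and \<open>c\<close> in a code with \<open>b(c, y) = t\<close>, whether \<open>y + c\<close>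
  lies in some code depends on \<open>t\<close> only, and \<open>\<kappa>\<close> is the number of admissible \<open>t\<close>. It becomes the
  number of neighbours of a code along a hyperplane containing \<open>u\<close>.
\<close>

locale code_setting =
  fixes \<sigma> :: "'a::{field,finite} \<Rightarrow> 'a" and Q :: "'a ^ 'N::finite \<Rightarrow> 'a" and \<delta> :: 'a
    and u :: "'a ^ 'N" and \<kappa> n :: nat and \<F> :: "('a ^ 'N) set set"
  assumes card_N: "CARD('N) = 2 * n"
    and \<sigma>_add: "\<sigma> (a + b) = \<sigma> a + \<sigma> b"
    and \<sigma>_mult: "\<sigma> (a * b) = \<sigma> a * \<sigma> b"
    and \<sigma>_invol: "\<sigma> (\<sigma> a) = a"
    and Q_scale: "Q (a *s x) = a ^ 2 * Q x"
    and Q_add: "sesq \<sigma> x u = 0 \<Longrightarrow> sesq \<sigma> y u = 0 \<Longrightarrow> Q (x + y) = Q x + Q y + \<delta> * sesq \<sigma> x y"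
    and card_isotropic_lifts: "sesq \<sigma> y u = 0 \<Longrightarrow>
      card {t. sesq \<sigma> y y + t + \<sigma> t = 0 \<and> Q y + \<delta> * t = 0} = \<kappa>"
    and perm_u: "bij \<pi> \<Longrightarrow> perm \<pi> u = u"
    and \<F>_eq: "\<F> = {C. self_dual (sesq \<sigma>) C \<and> u \<in> C \<and> (\<forall>c\<in>C. Q c = 0)}"
    and \<F>_perm: "bij \<pi> \<Longrightarrow> C \<in> \<F> \<Longrightarrow> perm \<pi> ` C \<in> \<F>"
begin

abbreviation b :: "'a ^ 'N \<Rightarrow> 'a ^ 'N \<Rightarrow> 'a" where "b \<equiv> sesq \<sigma>"

text \<open>The conditions that every vector of a code in \<F> satisfies (\<open>\<F>D\<close>).
  Conversely, a good vector outside a code C of \<F> lies in a neighbour of C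
  (\<open>neighbour_in_\<F>\<close>).\<close>

definition good :: "'a ^ 'N \<Rightarrow> bool" where
  "good x \<longleftrightarrow> b x x = 0 \<and> b x u = 0 \<and> Q x = 0"

lemma n_pos: "0 < n"
  using card_N zero_less_card_finite[where 'a='N] by simp

lemma \<sigma>_0 [simp]: "\<sigma> 0 = 0"
  using \<sigma>_add[of 0 0] by (metis add_0 add_cancel_right_right)

lemma \<sigma>_eq_0_iff [simp]: "\<sigma> a = 0 \<longleftrightarrow> a = 0"
  using \<sigma>_invol[of a] by auto

lemma \<sigma>_1 [simp]: "\<sigma> 1 = 1"
  using \<sigma>_mult[of 1 "\<sigma> 1"] by (simp add: \<sigma>_invol)

lemma b_add_left: "b (x + y) z = b x z + b y z"
  by (simp add: sesq_def algebra_simps sum.distrib)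

lemma b_add_right: "b x (y + z) = b x y + b x z"
  by (simp add: sesq_def algebra_simps sum.distrib \<sigma>_add)

lemma b_scale_left: "b (a *s x) y = a * b x y"
  by (simp add: sesq_def sum_distrib_left mult.assoc)

lemma b_scale_right: "b x (a *s y) = \<sigma> a * b x y"
  by (simp add: sesq_def sum_distrib_left \<sigma>_mult mult_ac)

lemma \<sigma>_sum: "\<sigma> (sum f A) = (\<Sum>i\<in>A. \<sigma> (f i))"
  by (induction A rule: infinite_finite_induct) (simp_all add: \<sigma>_add)

lemma \<sigma>_b: "\<sigma> (b x y) = b y x"
  by (simp add: sesq_def \<sigma>_sum \<sigma>_mult \<sigma>_invol mult.commute)

lemma b_eq_0_commute: "b x y = 0 \<longleftrightarrow> b y x = 0"
  using \<sigma>_b[of x y] \<sigma>_eq_0_iff by metis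

lemma b_nondegenerate:
  assumes "\<And>y. b x y = 0" shows "x = 0"
proof -
  have "x $ i = 0" for i
  proof -
    have "b x (axis i 1) = (\<Sum>j\<in>UNIV. if j = i then x $ j else 0)"
      unfolding sesq_def by (rule sum.cong) (auto simp: axis_def)
    then show ?thesis using assms[of "axis i 1"] by simp
  qed
  then show ?thesis by (simp add: vec_eq_iff)
qed

lemma subspace_dual: "vec.subspace (dual b B)"
  unfolding vec.subspace_def dual_def
  using b_scale_left[of 0 0] by (simp add: b_add_left b_scale_left)

lemma dual_span: "dual b (vec.span B) = dual b B"
proof -
  have "vec.span B \<subseteq> {y. b x y = 0}" if "\<forall>y\<in>B. b x y = 0" for x
    using that b_scale_right[of x 0 0]
    by (intro vec.span_minimal) (auto simp: vec.subspace_def b_add_right b_scale_right)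
  then show ?thesis
    unfolding dual_def using vec.span_base by blast
qed

lemma dim_dual_Un_ge:
  assumes "finite A" shows "vec.dim (dual b B) \<le> vec.dim (dual b (A \<union> B)) + card A"
  using assms
proof (induction A rule: finite_induct)
  case (insert x A)
  have "dual b (insert x A \<union> B) = {y \<in> dual b (A \<union> B). b y x = 0}"
    by (auto simp: dual_def)
  then have "vec.dim (dual b (A \<union> B)) \<le> vec.dim (dual b (insert x A \<union> B)) + 1"
    using dim_kernel_ge(2)[OF subspace_dual, of "\<lambda>y. b y x" "A \<union> B"] by (simp add: b_add_left b_scale_left)
  then show ?case using insert by simp
qed simp

text \<open>Each vector added to a set lowers the dimension of its dual by at most 1. Starting from
  the empty set with dual of dimension 2n, a basis of C gives the lower bound; continuing to a basis
  of the whole space, whose dual is 0 by nondegeneracy, gives the upper bound.\<close>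

lemma dim_dual:
  assumes "vec.subspace C" shows "vec.dim (dual b C) + vec.dim C = 2 * n"
proof -
  obtain B where B: "finite B" "B \<subseteq> C" "vec.independent B" "vec.span B = C" "card B = vec.dim C"
    by (rule vec.basis_subspace_exists[OF assms])
  obtain B' where B': "B \<subseteq> B'" "vec.independent B'" "UNIV \<subseteq> vec.span B'"
    by (rule vec.maximal_independent_subset_extend[OF subset_UNIV B(3)])
  have "vec.dim (UNIV :: ('a, 'N) vec set) = 2 * n"
    using vec_dim_card card_N by metis
  moreover have "vec.dim (UNIV :: ('a, 'N) vec set) = card B'"
    using B' by (metis vec.dim_span_eq_card_independent top.extremum_uniqueI)
  ultimately have dim: "vec.dim (UNIV :: ('a, 'N) vec set) = 2 * n" "card B' = 2 * n"
    by auto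
  have C: "dual b C = dual b B"
    using dual_span[of B] B by simp
  have "dual b B' = dual b UNIV"
    using dual_span[of B'] B' by (metis top.extremum_uniqueI)
  also have "\<dots> \<subseteq> {0}"
    using b_nondegenerate by (auto simp: dual_def)
  finally have 0: "vec.dim (dual b B') = 0"
    by simp
  have "finite B'"
    by simp
  then have "vec.dim (dual b C) \<le> card (B' - B)"
    using dim_dual_Un_ge[of "B' - B" B] B'(1) 0 C by (simp add: Un_absorb2)
  also have "\<dots> = 2 * n - vec.dim C"
    using B B' dim by (simp add: card_Diff_subset)
  finally have "vec.dim (dual b C) \<le> 2 * n - vec.dim C" .
  moreover have "dual b {} = UNIV"
    by (auto simp: dual_def)
  then have "2 * n \<le> vec.dim (dual b C) + vec.dim C"
    using dim_dual_Un_ge[of B "{}"] B C dim by simp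
  moreover have "vec.dim C \<le> 2 * n"
    using vec.dim_subset[of C UNIV] dim by simp
  ultimately show ?thesis by linarith
qed

lemma \<F>D:
  assumes "C \<in> \<F>"
  shows "vec.subspace C" "C = dual b C" "u \<in> C" "vec.dim C = n"
    "x \<in> C \<Longrightarrow> y \<in> C \<Longrightarrow> b x y = 0" "x \<in> C \<Longrightarrow> good x"
proof -
  show C: "vec.subspace C" "C = dual b C" "u \<in> C"
    using assms by (simp_all add: \<F>_eq self_dual_def)
  show "vec.dim C = n"
    using dim_dual[OF C(1)] C(2) by simp
  show *: "x \<in> C \<Longrightarrow> y \<in> C \<Longrightarrow> b x y = 0" for x y
    using C(2) unfolding dual_def by blast
  show "x \<in> C \<Longrightarrow> good x"
    using * C assms by (simp add: good_def \<F>_eq)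
qed

text \<open>A totally isotropic space of dimension n lies in its dual, which has dimension 2n - n,
  and so equals it.\<close>

lemma \<F>I:
  assumes "vec.subspace D" "vec.dim D = n" "\<And>x y. x \<in> D \<Longrightarrow> y \<in> D \<Longrightarrow> b x y = 0"
    "u \<in> D" "\<And>x. x \<in> D \<Longrightarrow> Q x = 0"
  shows "D \<in> \<F>"
proof -
  have "D = dual b D"
    using assms dim_dual[OF assms(1)]
    by (intro vec.subspace_dim_equal subspace_dual) (auto simp: dual_def)
  then show ?thesis using assms by (simp add: \<F>_eq self_dual_def)
qed

definition perp_in :: "('a ^ 'N) set \<Rightarrow> 'a ^ 'N \<Rightarrow> ('a ^ 'N) set" where
  "perp_in C x = {c \<in> C. b c x = 0}"

text \<open>One linear condition costs at most one dimension. It does cost one: a vector orthogonal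
  to all of C would lie in the dual of C, which is C.\<close>

lemma perp_in:
  assumes "C \<in> \<F>" "x \<notin> C"
  shows "vec.subspace (perp_in C x)" "vec.dim (perp_in C x) + 1 = n"
proof -
  note C = \<F>D[OF assms(1)]
  show sub: "vec.subspace (perp_in C x)"
    unfolding perp_in_def using C(1) by (rule dim_kernel_ge) (simp_all add: b_add_left b_scale_left)
  have "n \<le> vec.dim (perp_in C x) + 1"
    unfolding perp_in_def C(4)[symmetric]
    using C(1) by (rule dim_kernel_ge) (simp_all add: b_add_left b_scale_left)
  moreover have "vec.dim (perp_in C x) < n"
  proof (rule ccontr)
    assume "\<not> vec.dim (perp_in C x) < n"
    then have "perp_in C x = C"
      using sub C by (intro vec.subspace_dim_equal) (auto simp: perp_in_def)
    then have "x \<in> dual b C"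
      using b_eq_0_commute by (auto simp: perp_in_def dual_def)
    then show False using C(2) assms(2) by simp
  qed
  ultimately show "vec.dim (perp_in C x) + 1 = n" by simp
qed

definition neighbour :: "('a ^ 'N) set \<Rightarrow> 'a ^ 'N \<Rightarrow> ('a ^ 'N) set" where
  "neighbour C x = vec.span (insert x (perp_in C x))"

lemma mem_neighbour_iff:
  assumes "C \<in> \<F>" "x \<notin> C"
  shows "z \<in> neighbour C x \<longleftrightarrow> (\<exists>k. \<exists>c\<in>perp_in C x. z = k *s x + c)"
proof -
  have "vec.span (perp_in C x) = perp_in C x"
    using perp_in(1)[OF assms] by (rule vec.span_eq_iff[THEN iffD2])
  then have "z \<in> neighbour C x \<longleftrightarrow> (\<exists>k. z - k *s x \<in> perp_in C x)"
    unfolding neighbour_def vec.span_insert by (simp only: mem_Collect_eq)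
  also have "\<dots> \<longleftrightarrow> (\<exists>k. \<exists>c\<in>perp_in C x. z = k *s x + c)"
  proof
    assume "\<exists>k. z - k *s x \<in> perp_in C x"
    then obtain k where "z - k *s x \<in> perp_in C x" by blast
    then show "\<exists>k. \<exists>c\<in>perp_in C x. z = k *s x + c"
      by (intro exI[of _ k] bexI[of _ "z - k *s x"]) auto
  next
    assume "\<exists>k. \<exists>c\<in>perp_in C x. z = k *s x + c"
    then obtain k c where "c \<in> perp_in C x" "z = k *s x + c" by blast
    then show "\<exists>k. z - k *s x \<in> perp_in C x"
      by (intro exI[of _ k]) simp
  qed
  finally show ?thesis .
qed

text \<open>x is isotropic and orthogonal to \<open>perp_in C x\<close>, so the span is totally
  isotropic, and u lies in it because x is orthogonal to u. \<open>Q\<close> vanishes on the span by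
  \<open>Q_add\<close>, whose hypotheses hold as x and all codewords are orthogonal to u.\<close>

lemma neighbour_in_\<F>:
  assumes "C \<in> \<F>" "x \<notin> C" "good x"
  shows "neighbour C x \<in> \<F>" "x \<in> neighbour C x" "C \<inter> neighbour C x = perp_in C x"
proof -
  note C = \<F>D[OF assms(1)] and p = perp_in[OF assms(1,2)] and mem = mem_neighbour_iff[OF assms(1,2)]
  have perp: "c \<in> C" "b c x = 0" "b x c = 0" "good c" if "c \<in> perp_in C x" for c
  proof -
    show c: "c \<in> C" "b c x = 0" using that by (simp_all add: perp_in_def)
    show "b x c = 0" using c(2) b_eq_0_commute by blast
    show "good c" using c(1) by (rule C(6))
  qed
  show "x \<in> neighbour C x"
    by (simp add: neighbour_def vec.span_base)
  show "neighbour C x \<in> \<F>"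
  proof (rule \<F>I)
    show "vec.subspace (neighbour C x)" by (simp add: neighbour_def)
    have "x \<notin> vec.span (perp_in C x)"
      using p(1) assms(2) by (auto simp: vec.span_eq_iff[THEN iffD2] perp_in_def)
    then show "vec.dim (neighbour C x) = n"
      using p(2) by (simp add: neighbour_def vec.dim_insert)
    show "b y z = 0" if yz: "y \<in> neighbour C x" "z \<in> neighbour C x" for y z
    proof -
      obtain k c where y: "y = k *s x + c" "c \<in> perp_in C x"
        using yz(1) mem by blast
      obtain l d where z: "z = l *s x + d" "d \<in> perp_in C x"
        using yz(2) mem by blast
      from y z show ?thesis
        using perp[of c] perp[of d] C(5)[of c d] assms(3)
        by (simp add: b_add_left b_add_right b_scale_left b_scale_right good_def)
    qed
    have "u \<in> perp_in C x"
      using C(3) assms(3) b_eq_0_commute by (simp add: perp_in_def good_def)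
    then show "u \<in> neighbour C x"
      by (simp add: neighbour_def vec.span_base)
    show "Q y = 0" if y: "y \<in> neighbour C x" for y
    proof -
      obtain k c where "y = k *s x + c" "c \<in> perp_in C x"
        using y mem by blast
      then show ?thesis
        using perp[of c] assms(3) Q_add[of "k *s x" c]
        by (simp add: b_scale_left good_def Q_scale)
    qed
  qed
  show "C \<inter> neighbour C x = perp_in C x"
  proof
    show "perp_in C x \<subseteq> C \<inter> neighbour C x"
      by (auto simp: perp_in_def neighbour_def vec.span_base)
    \<comment> \<open>Every vector of the span is orthogonal to x, since x is isotropic.\<close>
    show "C \<inter> neighbour C x \<subseteq> perp_in C x"
    proof
      fix y assume y: "y \<in> C \<inter> neighbour C x"
      then obtain k c where kc: "y = k *s x + c" "c \<in> perp_in C x"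
        using mem by blast
      then have "b y x = 0"
        using perp[of c] assms(3) by (simp add: b_add_left b_scale_left good_def)
      then show "y \<in> perp_in C x" using y by (simp add: perp_in_def)
    qed
  qed
qed

text \<open>D is totally isotropic and contains x, so the intersection is contained in
  \<open>perp_in C x\<close>; equal dimensions force equality, and then x generates the rest of
  D.\<close>

lemma neighbour_unique:
  assumes "C \<in> \<F>" "D \<in> \<F>" "vec.dim (C \<inter> D) + 1 = n" "x \<in> D" "x \<notin> C"
  shows "D = neighbour C x" "C \<inter> D = perp_in C x"
proof -
  note C = \<F>D[OF assms(1)] and D = \<F>D[OF assms(2)]
  note p = perp_in[OF assms(1,5)]
  have "C \<inter> D \<subseteq> perp_in C x"
    using D(5) assms(4) by (auto simp: perp_in_def)
  then show *: "C \<inter> D = perp_in C x"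
    using p assms(3) C(1) D(1) by (intro vec.subspace_dim_equal vec.subspace_inter) auto
  have "vec.span (insert x (perp_in C x)) = D"
    using p D assms(4,5) * by (intro span_insert_hyperplane) (auto simp: perp_in_def)
  then show "D = neighbour C x" by (simp add: neighbour_def)
qed

text \<open>If u is not in E there is no neighbour, as C and D both contain u. Otherwise the good
  vectors in the dual of E outside C are counted twice. Each neighbour along E contributes q^n -
  q^(n-1) of them, and no vector is shared by two neighbours. On the other hand they are the
  multiples k (y + c) for a fixed y and suitable c in C, which gives (q - 1) \<open>\<kappa>\<close>
  q^(n-1).\<close>

lemma num_neighbours_eq:
  assumes C: "C \<in> \<F>" and E: "E \<in> hyperplanes {} C"
  shows "num_neighbours \<F> E C = (if u \<in> E then \<kappa> else 0)"
proof (cases "u \<in> E")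
  case False
  then have "{D \<in> \<F>. D \<inter> C = E} = {}"
    using \<F>D(3) C by auto
  then show ?thesis
    using False unfolding num_neighbours_def by simp
next
  case True
  let ?q = "CARD('a)"
  note CD = \<F>D[OF C]
  have E': "vec.subspace E" "E \<subseteq> C" "vec.dim E + 1 = n"
    using E CD(4) by (auto simp: hyperplanes_def)
  define \<D> where "\<D> = {D \<in> \<F>. D \<inter> C = E}"
  define G where "G = {x \<in> dual b E - C. good x}"
  have CE: "C \<subseteq> dual b E"
    using CD(2) E'(2) by (auto simp: dual_def)
  have dimE: "vec.dim (dual b E) = n + 1"
    using dim_dual[OF E'(1)] E'(3) by simp
  have \<D>: "D \<in> \<F>" "C \<inter> D = E" "vec.dim (C \<inter> D) + 1 = n" if "D \<in> \<D>" for D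
    using that E' by (auto simp: \<D>_def Int_commute)
  have "G = (\<Union>D\<in>\<D>. D - E)"
  proof (intro equalityI subsetI)
    fix x assume x: "x \<in> G"
    then have x': "x \<in> dual b E" "x \<notin> C" "good x" by (auto simp: G_def)
    note nb = neighbour_in_\<F>[OF C x'(2,3)]
    have "E \<subseteq> perp_in C x"
      using x' E' b_eq_0_commute by (auto simp: perp_in_def dual_def)
    then have "E = perp_in C x"
      using E' perp_in[OF C x'(2)] by (intro vec.subspace_dim_equal) auto
    then have "neighbour C x \<in> \<D>"
      using nb by (auto simp: \<D>_def)
    then show "x \<in> (\<Union>D\<in>\<D>. D - E)"
      using nb x' E' by auto
  next
    fix x assume "x \<in> (\<Union>D\<in>\<D>. D - E)"
    then obtain D where D: "D \<in> \<D>" "x \<in> D" "x \<notin> E" by auto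
    have "x \<in> dual b E"
      using \<D>[OF D(1)] D(2) \<F>D(5)[of D] by (auto simp: dual_def)
    then show "x \<in> G"
      using \<D>[OF D(1)] D \<F>D(6)[of D x] by (auto simp: G_def)
  qed
  moreover have "card (\<Union>D\<in>\<D>. D - E) = (\<Sum>D\<in>\<D>. card (D - E))"
  proof (rule card_UN_disjoint)
    show "\<forall>D\<in>\<D>. \<forall>D'\<in>\<D>. D \<noteq> D' \<longrightarrow> (D - E) \<inter> (D' - E) = {}"
    proof (intro ballI impI)
      fix D D' assume D: "D \<in> \<D>" "D' \<in> \<D>" "D \<noteq> D'"
      show "(D - E) \<inter> (D' - E) = {}"
      proof (rule ccontr)
        assume "(D - E) \<inter> (D' - E) \<noteq> {}"
        then obtain x where x: "x \<in> D" "x \<in> D'" "x \<notin> E" by auto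
        then have "x \<notin> C" using \<D>[OF D(1)] by auto
        then have "D = neighbour C x" "D' = neighbour C x"
          using \<D>[OF D(1)] \<D>[OF D(2)] x neighbour_unique(1)[OF C] by metis+
        then show False using D(3) by simp
      qed
    qed
  qed auto
  moreover have "card (D - E) = (?q - 1) * ?q ^ (n - 1)" if "D \<in> \<D>" for D
  proof -
    have "E \<subseteq> D" using \<D>(2)[OF that] by auto
    moreover have "?q ^ n = ?q * ?q ^ (n - 1)"
      using n_pos by (cases n) auto
    moreover have "vec.dim E = n - 1" using E' by simp
    ultimately show ?thesis
      using E' \<F>D[OF \<D>(1)[OF that]]
      by (simp add: card_Diff_subset card_subspace diff_mult_distrib)
  qed
  ultimately have card1: "card G = card \<D> * ((?q - 1) * ?q ^ (n - 1))"
    by simp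
  have "\<not> dual b E \<subseteq> C"
    using vec.dim_subset[of "dual b E" C] dimE CD(4) by auto
  then obtain y where y: "y \<in> dual b E" "y \<notin> C" by auto
  have yu: "b y u = 0" using y True by (simp add: dual_def)
  have span: "dual b E = vec.span (insert y C)"
    using y CE CD dimE by (intro span_insert_hyperplane[symmetric] subspace_dual) auto
  \<comment> \<open>The dual of E is spanned by C and y, so its vectors outside C are uniquely k (y
    + c) with k nonzero and c in C. Goodness does not depend on k, which accounts for the factor q -
    1.\<close>
  define R where "R = {c \<in> C. good (y + c)}"
  have good_scale: "good (k *s x) \<longleftrightarrow> good x" if "k \<noteq> 0" for k x
    using that by (simp add: good_def b_scale_left b_scale_right Q_scale)
  have "card G = card ((UNIV - {0 :: 'a}) \<times> R)"
  proof (rule bij_betw_same_card[symmetric])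
    let ?h = "\<lambda>(k, c). k *s (y + c)"
    have inj: "inj_on ?h ((UNIV - {0}) \<times> R)"
    proof -
      have aux: "k = l \<and> c = d" if a: "k \<noteq> 0" "c \<in> R" "d \<in> R" "k *s (y + c) = l *s (y + d)" for k l c d
      proof -
        have "(k - l) *s y = l *s d - k *s c"
          using a(4) by (simp add: vec.scale_right_distrib vec.scale_left_diff_distrib algebra_simps)
        moreover have "l *s d - k *s c \<in> C"
          using a CD(1) by (intro vec.subspace_diff vec.subspace_scale) (auto simp: R_def)
        ultimately have *: "(k - l) *s y \<in> C" by simp
        have "k = l"
        proof (rule ccontr)
          assume "k \<noteq> l"
          then have "(1 / (k - l)) *s ((k - l) *s y) = y"
            by (simp only: vec.scale_scale) simp
          then show False using vec.subspace_scale[OF CD(1) *, of "1 / (k - l)"] y(2) by simp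
        qed
        then show "k = l \<and> c = d" using a by simp
      qed
      show ?thesis
      proof (rule inj_onI)
        fix z w assume "z \<in> (UNIV - {0}) \<times> R" "w \<in> (UNIV - {0}) \<times> R" "?h z = ?h w"
        then show "z = w"
          using aux[of "fst z" "snd z" "snd w" "fst w"] by (cases z; cases w) simp
      qed
    qed
    have "?h ` ((UNIV - {0}) \<times> R) = G"
    proof (intro equalityI subsetI)
      fix x assume "x \<in> ?h ` ((UNIV - {0}) \<times> R)"
      then obtain k c where x: "x = k *s (y + c)" "k \<noteq> 0" "c \<in> C" "good (y + c)"
        by (auto simp: R_def)
      have "y + c \<notin> C"
        using vec.subspace_diff[OF CD(1) _ x(3), of "y + c"] y(2) by (metis add_diff_cancel_right')
      moreover have "y + c = (1 / k) *s x"
        using x(1,2) by (simp only: vec.scale_scale) simp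
      ultimately have "x \<notin> C"
        using vec.subspace_scale[OF CD(1), of x "1 / k"] by auto
      moreover have "x \<in> dual b E"
        using x y CE subspace_dual by (auto intro!: vec.subspace_scale vec.subspace_add)
      moreover have "good x"
        unfolding x(1) using good_scale[OF x(2)] x(4) by blast
      ultimately show "x \<in> G"
        by (simp add: G_def)
    next
      fix x assume x: "x \<in> G"
      then have "x \<in> vec.span (insert y C)" using span by (auto simp: G_def)
      then obtain k where k: "x - k *s y \<in> C"
        using CD(1) by (auto simp: vec.span_insert vec.span_eq_iff[THEN iffD2])
      have k0: "k \<noteq> 0" using k x by (auto simp: G_def)
      define c where "c = (1 / k) *s (x - k *s y)"
      have c: "c \<in> C" unfolding c_def using CD(1) k by (rule vec.subspace_scale)
      have "k *s c = x - k *s y"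
        unfolding c_def using k0 by (simp only: vec.scale_scale) simp
      then have xeq: "x = k *s (y + c)"
        by (simp add: vec.scale_right_distrib)
      have "good x" using x by (simp add: G_def)
      then have "good (y + c)"
        unfolding xeq using good_scale[OF k0] by blast
      then show "x \<in> ?h ` ((UNIV - {0}) \<times> R)"
        using xeq k0 c by (intro image_eqI[of _ _ "(k, c)"]) (auto simp: R_def)
    qed
    with inj show "bij_betw ?h ((UNIV - {0}) \<times> R) G"
      by (simp add: bij_betw_def)
  qed
  then have card2: "card G = (?q - 1) * card R"
    by (simp add: card_cartesian_product card_Diff_subset)
  have Ey: "E = perp_in C y"
    using y E' perp_in[OF C y(2)] b_eq_0_commute
    by (intro vec.subspace_dim_equal) (auto simp: perp_in_def dual_def)
  \<comment> \<open>Normalised so that the codewords c with \<open>b c y = t\<close> form the coset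
    of t c1 modulo E.\<close>
  obtain c1 where c1: "c1 \<in> C" "b c1 y = 1"
  proof -
    have "y \<notin> dual b C" using y CD(2) by simp
    then obtain c where c: "c \<in> C" "b c y \<noteq> 0" by (auto simp: dual_def b_eq_0_commute)
    then show thesis
      using vec.subspace_scale[OF CD(1) c(1), of "1 / b c y"]
      by (intro that[of "(1 / b c y) *s c"]) (simp_all add: b_scale_left)
  qed
  define P where "P = {t. b y y + t + \<sigma> t = 0 \<and> Q y + \<delta> * t = 0}"
  \<comment> \<open>With t the value of \<open>b c y\<close>, the form at y + c is
    \<open>b y y\<close> + t + \<open>\<sigma> t\<close> by Hermitian symmetry, and \<open>Q\<close>
    at y + c is \<open>Q y\<close> + \<open>\<delta> * t\<close>, because c itself is good.\<close>
  have good_iff: "good (y + c) \<longleftrightarrow> b c y \<in> P" if "c \<in> C" for c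
    using that CD(5)[of c c] CD(6)[of c] yu Q_add[of c y] \<sigma>_b[of c y]
    by (simp add: good_def P_def b_add_left b_add_right add.commute add.left_commute)
  have "card R = card (P \<times> E)"
  proof (rule bij_betw_same_card[symmetric])
    let ?h = "\<lambda>(t, e). t *s c1 + e"
    have be: "b e y = 0" "e \<in> C" if "e \<in> E" for e using that Ey by (auto simp: perp_in_def)
    have hb: "b (t *s c1 + e) y = t" if "e \<in> E" for t e
      using c1 be[OF that] by (simp add: b_add_left b_scale_left)
    show "bij_betw ?h (P \<times> E) R"
      unfolding bij_betw_def
    proof (intro conjI equalityI subsetI)
      show "inj_on ?h (P \<times> E)"
      proof (rule inj_onI, clarify)
        fix s t e f assume a: "s \<in> P" "t \<in> P" "e \<in> E" "f \<in> E" "s *s c1 + e = t *s c1 + f"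
        then have "s = t" using hb by metis
        then show "s = t \<and> e = f" using a by simp
      qed
    next
      fix x assume "x \<in> ?h ` (P \<times> E)"
      then obtain t e where x: "x = t *s c1 + e" "t \<in> P" "e \<in> E" by auto
      then have "x \<in> C"
        using c1 CD(1) be(2)[OF x(3)] by (auto intro!: vec.subspace_scale vec.subspace_add)
      then show "x \<in> R"
        using x hb good_iff by (simp add: R_def)
    next
      fix x assume "x \<in> R"
      then have x: "x \<in> C" "b x y \<in> P" using good_iff by (auto simp: R_def)
      have "x - b x y *s c1 \<in> E"
        using x c1 vec.subspace_diff[OF CD(1) x(1) vec.subspace_scale[OF CD(1) c1(1)]]
          b_add_left[of "x - b x y *s c1" "b x y *s c1" y]
        by (simp add: Ey perp_in_def b_scale_left)
      then show "x \<in> ?h ` (P \<times> E)"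
        using x by (intro image_eqI[of _ _ "(b x y, x - b x y *s c1)"]) auto
    qed
  qed
  also have "\<dots> = \<kappa> * ?q ^ (n - 1)"
    using card_isotropic_lifts[OF yu] E' card_subspace[OF E'(1)]
    by (simp add: card_cartesian_product P_def flip: E'(3))
  finally have cardR: "card R = \<kappa> * ?q ^ (n - 1)" .
  have "card \<D> * ((?q - 1) * ?q ^ (n - 1)) = \<kappa> * ((?q - 1) * ?q ^ (n - 1))"
    unfolding card1[symmetric] card2 cardR by (simp only: mult_ac)
  moreover have "(?q - 1) * ?q ^ (n - 1) \<noteq> 0"
    using one_less_card_field[where 'a='a] by simp
  ultimately have "card \<D> = \<kappa>" by (metis mult_right_cancel)
  then show ?thesis using True by (simp add: num_neighbours_def \<D>_def)
qed

end

section \<open>Monomials of tuples\<close>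

lemma finite_field_power: "finite (field_power m :: (nat \<Rightarrow>\<^sub>0 'a::{zero,finite}) set)"
proof (rule finite_imageD)
  let ?r = "\<lambda>v :: nat \<Rightarrow>\<^sub>0 'a. restrict (Poly_Mapping.lookup v) {..<m}"
  have "?r ` field_power m \<subseteq> {..<m} \<rightarrow>\<^sub>E UNIV"
    by (intro image_subsetI) (simp add: PiE_iff)
  then show "finite (?r ` field_power m)"
    by (rule finite_subset) (simp add: finite_PiE)
  show "inj_on ?r (field_power m)"
  proof (rule inj_onI, rule poly_mapping_eqI)
    fix v w :: "nat \<Rightarrow>\<^sub>0 'a" and k
    assume vw: "v \<in> field_power m" "w \<in> field_power m" "?r v = ?r w"
    show "Poly_Mapping.lookup v k = Poly_Mapping.lookup w k"
    proof (cases "k < m")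
      case True
      then show ?thesis using fun_cong[OF vw(3), of k] by simp
    next
      case False
      then have "k \<notin> Poly_Mapping.keys v" "k \<notin> Poly_Mapping.keys w"
        using vw by (auto simp: field_power_def)
      then show ?thesis by (simp add: in_keys_iff)
    qed
  qed
qed

lemma lookup_sum_poly_mapping:
  "Poly_Mapping.lookup (sum f A) k = (\<Sum>i\<in>A. Poly_Mapping.lookup (f i) k)"
  by (induction A rule: infinite_finite_induct) (simp_all add: lookup_add)

lemma lookup_column: "Poly_Mapping.lookup (column m c i) k = (if k < m then c k $ i else 0)"
proof -
  have "Poly_Mapping.lookup (column m c i) k = (\<Sum>j<m. if j = k then c k $ i else 0)"
    unfolding column_def lookup_sum_poly_mapping
    by (rule sum.cong) (auto simp: lookup_single when_def)
  then show ?thesis by simp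
qed

lemma column_in_field_power: "column m c i \<in> field_power m"
  by (auto simp: field_power_def in_keys_iff lookup_column split: if_splits)

lemma lookup_mon: "Poly_Mapping.lookup (mon m c) v = card {i. column m c i = v}"
proof (cases "v \<in> field_power m")
  case True
  have "Poly_Mapping.lookup (mon m c) v =
      (\<Sum>w\<in>field_power m. if w = v then card {i. column m c i = v} else 0)"
    unfolding mon_def lookup_sum_poly_mapping
    by (rule sum.cong) (auto simp: lookup_single when_def)
  then show ?thesis using True by (simp add: finite_field_power)
next
  case False
  then have "{i. column m c i = v} = {}" using column_in_field_power by blast
  moreover have "Poly_Mapping.lookup (mon m c) v = 0"
    unfolding mon_def lookup_sum_poly_mapping
    using False by (intro sum.neutral) (auto simp: lookup_single when_def)
  ultimately show ?thesis by simp
qed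

lemma keys_mon: "Poly_Mapping.keys (mon m c) = range (column m c)"
  by (auto simp: in_keys_iff lookup_mon)

lemma mon_cong: "(\<And>k. k < m \<Longrightarrow> c k = d k) \<Longrightarrow> mon m c = mon m d"
  by (simp add: mon_def column_def)

text \<open>The monomial records the multiset of columns and nothing else, and two families with the
  same multiset differ by a permutation of the index set.\<close>

lemma mon_eq_iff:
  fixes c d :: "nat \<Rightarrow> 'a::{field,finite} ^ 'N::finite"
  shows "mon m c = mon m d \<longleftrightarrow> (\<exists>\<pi>. bij \<pi> \<and> (\<forall>k<m. d k = perm \<pi> (c k)))"
proof
  assume eq: "mon m c = mon m d"
  have count: "count (image_mset (column m e) (mset_set UNIV)) v = Poly_Mapping.lookup (mon m e) v"
    for e :: "nat \<Rightarrow> 'a ^ 'N" and v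
    by (simp add: count_image_mset lookup_mon vimage_def)
  have "image_mset (column m c) (mset_set UNIV) = image_mset (column m d) (mset_set UNIV)"
    by (rule multiset_eqI) (simp only: count eq)
  then obtain p where p: "p permutes UNIV" "\<forall>i\<in>UNIV. column m c i = column m d (p i)"
    using image_mset_eq_implies_permutes[OF finite, of "column m c" UNIV "column m d"] by blast
  have bij: "bij p" using p(1) by (rule permutes_bij)
  have "d k = perm p (c k)" if "k < m" for k
  proof -
    have "d k $ j = c k $ inv p j" for j
    proof -
      have "p (inv p j) = j" using bij by (simp add: bij_is_surj surj_f_inv_f)
      then have "column m c (inv p j) = column m d j" using p(2) by simp
      then have "Poly_Mapping.lookup (column m c (inv p j)) k = Poly_Mapping.lookup (column m d j) k"
        by simp
      then show ?thesis using \<open>k < m\<close> by (simp add: lookup_column)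
    qed
    then show ?thesis by (simp add: perm_def vec_eq_iff)
  qed
  then show "\<exists>\<pi>. bij \<pi> \<and> (\<forall>k<m. d k = perm \<pi> (c k))" using bij by blast
next
  assume "\<exists>\<pi>. bij \<pi> \<and> (\<forall>k<m. d k = perm \<pi> (c k))"
  then obtain \<pi> where \<pi>: "bij \<pi>" "\<forall>k<m. d k = perm \<pi> (c k)" by blast
  have "mon m d = mon m (\<lambda>k\<in>{..<m}. perm \<pi> (c k))"
    using \<pi>(2) by (intro mon_cong) simp
  then show "mon m c = mon m d"
    using mon_perm[OF \<pi>(1)] by metis
qed

lemma perm_add: "perm \<pi> (x + y) = perm \<pi> x + perm \<pi> (y :: 'a::field ^ 'N::finite)"
  by (simp add: perm_def vec_eq_iff)

lemma perm_scale: "perm \<pi> (a *s x) = a *s perm \<pi> (x :: 'a::field ^ 'N::finite)"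
  by (simp add: perm_def vec_eq_iff)

lemma perm_minus: "perm \<pi> (- x) = - perm \<pi> (x :: 'a::field ^ 'N::finite)"
  by (simp add: perm_def vec_eq_iff)

lemma perm_0: "perm \<pi> 0 = (0 :: 'a::field ^ 'N::finite)"
  by (simp add: perm_def vec_eq_iff)

lemma perm_sum: "perm \<pi> (sum f A) = (\<Sum>i\<in>A. perm \<pi> (f i :: 'a::field ^ 'N::finite))"
  by (induction A rule: infinite_finite_induct) (simp_all add: perm_add perm_0)

lemma perm_inject: "bij \<pi> \<Longrightarrow> perm \<pi> x = perm \<pi> y \<longleftrightarrow> x = y"
  by (metis perm_inv(1))

section \<open>Independence modulo a vector and the two sets of monomials\<close>

text \<open>Linear independence of the family \<open>c\<close> for u = 0, and of u together with
  \<open>c\<close> for nonzero u. Both sets of monomials in the table thereby become one condition.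
  Repeated entries count as dependent.\<close>

definition indep_mod :: "'a::field ^ 'N::finite \<Rightarrow> nat \<Rightarrow> (nat \<Rightarrow> 'a ^ 'N) \<Rightarrow> bool" where
  "indep_mod u m c \<longleftrightarrow> (\<forall>a \<mu>. (\<Sum>k<m. a k *s c k) = \<mu> *s u \<longrightarrow> (\<forall>k<m. a k = 0))"

lemma span_insert_family:
  fixes c :: "nat \<Rightarrow> 'a::field ^ 'N::finite"
  shows "x \<in> vec.span (insert u (c ` {..<m})) \<longleftrightarrow> (\<exists>a \<mu>. x = (\<Sum>k<m. a k *s c k) + \<mu> *s u)"
proof (induction m arbitrary: x)
  case 0
  then show ?case by (auto simp: vec.span_singleton)
next
  case (Suc m)
  have "x \<in> vec.span (insert u (c ` {..<Suc m})) \<longleftrightarrow>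
      (\<exists>t. x - t *s c m \<in> vec.span (insert u (c ` {..<m})))"
    by (simp add: lessThan_Suc insert_commute[of u] vec.span_insert[of "c m"])
  also have "\<dots> \<longleftrightarrow> (\<exists>t a \<mu>. x - t *s c m = (\<Sum>k<m. a k *s c k) + \<mu> *s u)"
    by (simp only: Suc)
  also have "\<dots> \<longleftrightarrow> (\<exists>a \<mu>. x = (\<Sum>k<Suc m. a k *s c k) + \<mu> *s u)"
  proof
    assume "\<exists>t a \<mu>. x - t *s c m = (\<Sum>k<m. a k *s c k) + \<mu> *s u"
    then obtain t a \<mu> where "x - t *s c m = (\<Sum>k<m. a k *s c k) + \<mu> *s u" by blast
    then show "\<exists>a \<mu>. x = (\<Sum>k<Suc m. a k *s c k) + \<mu> *s u"
      by (intro exI[of _ "a(m := t)"] exI[of _ \<mu>]) (simp add: algebra_simps)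
  next
    assume "\<exists>a \<mu>. x = (\<Sum>k<Suc m. a k *s c k) + \<mu> *s u"
    then obtain a \<mu> where "x = (\<Sum>k<Suc m. a k *s c k) + \<mu> *s u" by blast
    then show "\<exists>t a \<mu>. x - t *s c m = (\<Sum>k<m. a k *s c k) + \<mu> *s u"
      by (intro exI[of _ "a m"] exI[of _ a] exI[of _ \<mu>]) (simp add: algebra_simps)
  qed
  finally show ?case .
qed

lemma indep_mod_Suc:
  "indep_mod u (Suc m) c \<longleftrightarrow> indep_mod u m c \<and> c m \<notin> vec.span (insert u (c ` {..<m}))"
proof (intro iffI conjI)
  assume ind: "indep_mod u (Suc m) c"
  show "indep_mod u m c"
    unfolding indep_mod_def
  proof (intro allI impI)
    fix a \<mu> k assume "(\<Sum>k<m. a k *s c k) = \<mu> *s u" "k < m"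
    moreover from this have "(\<Sum>k<Suc m. (a(m := 0)) k *s c k) = \<mu> *s u" by simp
    ultimately show "a k = 0"
      using ind unfolding indep_mod_def by (metis fun_upd_other less_Suc_eq less_irrefl)
  qed
  show "c m \<notin> vec.span (insert u (c ` {..<m}))"
  proof
    assume "c m \<in> vec.span (insert u (c ` {..<m}))"
    then obtain a \<mu> where "c m = (\<Sum>k<m. a k *s c k) + \<mu> *s u"
      unfolding span_insert_family by blast
    then have "(\<Sum>k<Suc m. (a(m := - 1)) k *s c k) = (- \<mu>) *s u"
      by (simp add: vec.scale_minus_left)
    then have "(a(m := - 1)) m = 0"
      using ind unfolding indep_mod_def by blast
    then show False by simp
  qed
next
  assume *: "indep_mod u m c \<and> c m \<notin> vec.span (insert u (c ` {..<m}))"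
  show "indep_mod u (Suc m) c"
    unfolding indep_mod_def
  proof (intro allI impI)
    fix a \<mu> k assume eq: "(\<Sum>k<Suc m. a k *s c k) = \<mu> *s u" and k: "k < Suc m"
    have "a m = 0"
    proof (rule ccontr)
      assume am: "a m \<noteq> 0"
      have "a m *s c m = \<mu> *s u - (\<Sum>k<m. a k *s c k)"
        using eq by (simp add: algebra_simps)
      moreover have "\<mu> *s u - (\<Sum>k<m. a k *s c k) \<in> vec.span (insert u (c ` {..<m}))"
        by (intro vec.span_diff vec.span_scale vec.span_sum vec.span_base) auto
      ultimately have "(1 / a m) *s (a m *s c m) \<in> vec.span (insert u (c ` {..<m}))"
        by (metis vec.span_scale)
      moreover have "(1 / a m) *s (a m *s c m) = c m"
        using am by (simp only: vec.scale_scale) simp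
      ultimately show False using * by simp
    qed
    then have "(\<Sum>k<m. a k *s c k) = \<mu> *s u" using eq by simp
    then show "a k = 0"
      using * k \<open>a m = 0\<close> unfolding indep_mod_def by (metis less_Suc_eq)
  qed
qed

lemma indep_mod_iff_dim:
  fixes u :: "'a::field ^ 'N::finite"
  shows "vec.dim (insert u (c ` {..<m})) \<le> m + (if u = 0 then 0 else 1)"
    and "indep_mod u m c \<longleftrightarrow> vec.dim (insert u (c ` {..<m})) = m + (if u = 0 then 0 else 1)"
proof (induction m)
  case 0
  {
    case 1 show ?case by (simp add: vec.dim_insert)
  next
    case 2 show ?case by (auto simp: indep_mod_def vec.dim_insert)
  }
next
  case (Suc m)
  have *: "vec.dim (insert u (c ` {..<Suc m})) =
      vec.dim (insert u (c ` {..<m})) + (if c m \<in> vec.span (insert u (c ` {..<m})) then 0 else 1)"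
    by (simp add: lessThan_Suc insert_commute[of u] vec.dim_insert[of "c m"])
  {
    case 1 show ?case using Suc(1) unfolding * by simp
  next
    case 2
    show ?case
    proof (cases "c m \<in> vec.span (insert u (c ` {..<m}))")
      case True
      \<comment> \<open>The bound for m is needed here: if the new vector adds no dimension, the
        maximal dimension for \<open>Suc m\<close> is out of reach.\<close>
      then have "vec.dim (insert u (c ` {..<Suc m})) \<noteq> Suc m + (if u = 0 then 0 else 1)"
        using Suc(1) unfolding * by (simp only: if_True)
      then show ?thesis using True unfolding indep_mod_Suc by blast
    next
      case False
      then show ?thesis unfolding * indep_mod_Suc Suc(2) by simp
    qed
  }
qed

lemma indep_mod_perm:
  assumes "bij \<pi>" "perm \<pi> u = u" "\<And>k. k < m \<Longrightarrow> d k = perm \<pi> (c k)"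
  shows "indep_mod u m d \<longleftrightarrow> indep_mod u m c"
proof -
  have "(\<Sum>k<m. a k *s d k) = \<mu> *s u \<longleftrightarrow> (\<Sum>k<m. a k *s c k) = \<mu> *s u" for a \<mu>
  proof -
    have d: "(\<Sum>k<m. a k *s d k) = perm \<pi> (\<Sum>k<m. a k *s c k)"
      using assms(3) by (simp add: perm_sum perm_scale)
    have u: "perm \<pi> (\<mu> *s u) = \<mu> *s u"
      by (simp add: perm_scale assms(2))
    show ?thesis unfolding d using perm_inject[OF assms(1), of _ "\<mu> *s u"] unfolding u by blast
  qed
  then show ?thesis unfolding indep_mod_def by presburger
qed

lemma perm_all_one: "perm \<pi> all_one = all_one"
  by (simp add: perm_def all_one_def)

lemma all_one_nonzero: "(all_one :: 'a::field ^ 'N::finite) \<noteq> 0"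
  by (simp add: all_one_def vec_eq_iff)

text \<open>Membership provides only some tuple with this monomial. It differs from \<open>c\<close>
  by a permutation, which fixes the all-one vector and therefore preserves independence modulo
  it.\<close>

lemma mon_in_monomials_one_iff:
  fixes c :: "nat \<Rightarrow> 'a::{field,finite} ^ 'N::finite"
  shows "mon m c \<in> monomials_one TYPE('N) m \<longleftrightarrow> indep_mod all_one m c"
proof
  assume "mon m c \<in> monomials_one TYPE('N) m"
  then obtain d :: "nat \<Rightarrow> 'a ^ 'N" where d: "mon m d = mon m c"
    "vec.dim (vec.span (insert all_one (d ` {..<m}))) = m + 1"
    by (auto simp: monomials_one_def)
  obtain \<pi> where \<pi>: "bij \<pi>" "\<forall>k<m. c k = perm \<pi> (d k)"
    using d(1) by (auto simp: mon_eq_iff)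
  have "indep_mod all_one m d"
    using d(2) by (simp add: indep_mod_iff_dim all_one_nonzero)
  then show "indep_mod all_one m c"
    using indep_mod_perm[OF \<pi>(1) perm_all_one, of m c d] \<pi>(2) by simp
next
  assume ind: "indep_mod all_one m c"
  let ?d = "restrict c {..<m}"
  have "mon m c = mon m ?d" by (rule mon_cong) simp
  moreover have "vec.dim (vec.span (insert all_one (?d ` {..<m}))) = m + 1"
    using ind by (simp add: indep_mod_iff_dim all_one_nonzero)
  ultimately show "mon m c \<in> monomials_one TYPE('N) m"
    unfolding monomials_one_def by (intro CollectI exI[of _ ?d]) auto
qed

lemma sum_lookup_mon:
  fixes c :: "nat \<Rightarrow> 'a::{field,finite} ^ 'N::finite"
  shows "(\<Sum>v\<in>Poly_Mapping.keys (mon m c). Poly_Mapping.lookup (mon m c) v) = CARD('N)"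
proof -
  have "(\<Sum>v\<in>range (column m c). \<Sum>i | i \<in> UNIV \<and> column m c i = v. 1) = (\<Sum>i\<in>(UNIV :: 'N set). 1 :: nat)"
    by (intro sum.group) auto
  then show ?thesis by (simp add: keys_mon lookup_mon)
qed

lemma field_power_eq_span:
  "field_power m = pm.span ((\<lambda>k. Poly_Mapping.single k (1 :: 'a::field)) ` {..<m})"
    (is "_ = pm.span ?E")
proof (intro equalityI subsetI)
  fix v :: "nat \<Rightarrow>\<^sub>0 'a" assume v: "v \<in> field_power m"
  have "v = (\<Sum>k<m. scale (Poly_Mapping.lookup v k) (Poly_Mapping.single k 1))"
  proof (rule poly_mapping_eqI)
    fix j
    have "Poly_Mapping.lookup (\<Sum>k<m. scale (Poly_Mapping.lookup v k) (Poly_Mapping.single k 1)) j =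
        (\<Sum>k<m. if k = j then Poly_Mapping.lookup v j else 0)"
      unfolding lookup_sum_poly_mapping by (rule sum.cong) (auto simp: lookup_single when_def)
    also have "\<dots> = Poly_Mapping.lookup v j"
      using v by (auto simp: field_power_def in_keys_iff)
    finally show "Poly_Mapping.lookup v j =
        Poly_Mapping.lookup (\<Sum>k<m. scale (Poly_Mapping.lookup v k) (Poly_Mapping.single k 1)) j" by simp
  qed
  also have "\<dots> \<in> pm.span ?E"
    by (intro pm.span_sum pm.span_scale pm.span_base) auto
  finally show "v \<in> pm.span ?E" .
next
  fix v :: "nat \<Rightarrow>\<^sub>0 'a" assume "v \<in> pm.span ?E"
  moreover have "pm.span ?E \<subseteq> field_power m"
  proof (rule pm.span_minimal)
    show "?E \<subseteq> field_power m" by (auto simp: field_power_def)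
    show "pm.subspace (field_power m :: (nat \<Rightarrow>\<^sub>0 'a) set)"
    proof (rule pm.subspaceI)
      fix x y :: "nat \<Rightarrow>\<^sub>0 'a" and a :: 'a assume x: "x \<in> field_power m"
      show "scale a x \<in> field_power m"
        using x by (auto simp: field_power_def in_keys_iff)
      assume "y \<in> field_power m"
      then show "x + y \<in> field_power m"
        using x keys_add[of x y] by (auto simp: field_power_def)
    qed (simp add: field_power_def)
  qed
  ultimately show "v \<in> field_power m" by blast
qed

text \<open>Evaluating the linear form \<open>a\<close> at the columns of \<open>c\<close> gives the coordinates of \<open>\<Sum>\<^sub>k a\<^sub>k c\<^sub>k\<close>.\<close>

lemma mon_in_monomials_star_iff:
  fixes c :: "nat \<Rightarrow> 'a::{field,finite} ^ 'N::finite"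
  shows "mon m c \<in> monomials_star TYPE('N) m \<longleftrightarrow> indep_mod 0 m c"
proof -
  let ?e = "\<lambda>k. Poly_Mapping.single k (1 :: 'a)"
  let ?E = "?e ` {..<m}" and ?S = "range (column m c)"
  define ev where "ev = (\<lambda>a v. \<Sum>k<m. a k * Poly_Mapping.lookup v k :: 'a)"
  have inj: "inj_on ?e {..<m}"
    by (rule inj_onI) (metis lookup_single_eq lookup_single_not_eq one_neq_zero)
  have cardE: "card ?E = m" by (simp add: card_image[OF inj])
  have ev_e: "ev a (?e j) = a j" if "j < m" for a j
  proof -
    have "ev a (?e j) = (\<Sum>k<m. if k = j then a j else 0)"
      unfolding ev_def by (rule sum.cong) (auto simp: lookup_single when_def)
    then show ?thesis using that by simp
  qed
  have ev_col: "ev a (column m c i) = (\<Sum>k<m. a k *s c k) $ i" for a i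
    by (simp add: ev_def lookup_column)
  have ev_span: "ev a v = 0" if a: "\<And>w. w \<in> B \<Longrightarrow> ev a w = 0" and v: "v \<in> pm.span B" for a v B
  proof -
    have "pm.subspace {w. ev a w = 0}"
    proof (rule pm.subspaceI)
      fix x y assume xy: "x \<in> {w. ev a w = 0}" "y \<in> {w. ev a w = 0}"
      then show "x + y \<in> {w. ev a w = 0}"
        by (simp add: ev_def lookup_add algebra_simps sum.distrib)
    next
      fix x t assume x: "x \<in> {w. ev a w = 0}"
      have "ev a (scale t x) = t * ev a x"
        by (simp add: ev_def sum_distrib_left mult_ac)
      then show "scale t x \<in> {w. ev a w = 0}" using x by simp
    qed (simp add: ev_def)
    then have "pm.span B \<subseteq> {w. ev a w = 0}"
      using a by (intro pm.span_minimal) auto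
    then show ?thesis using v by auto
  qed
  have S: "?S \<subseteq> pm.span ?E"
    using column_in_field_power field_power_eq_span by blast
  \<comment> \<open>The columns lie in the span of the m unit vectors, so rank m means that they
    span all of it.\<close>
  have "mon_rank (mon m c) = m \<longleftrightarrow> ?E \<subseteq> pm.span ?S"
  proof
    assume rank: "mon_rank (mon m c) = m"
    obtain B where B: "B \<subseteq> ?S" "pm.independent B" "?S \<subseteq> pm.span B" "card B = pm.dim ?S"
      by (rule pm.basis_exists)
    have cardB: "card B = m" using B(4) rank by (simp add: mon_rank_def keys_mon)
    show "?E \<subseteq> pm.span ?S"
    proof (rule ccontr)
      assume "\<not> ?E \<subseteq> pm.span ?S"
      then obtain e where e: "e \<in> ?E" "e \<notin> pm.span ?S" by blast
      then have e': "e \<notin> pm.span B" using pm.span_mono[OF B(1)] by blast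
      then have "pm.independent (insert e B)"
        using B(2) by (rule pm.independent_insertI)
      moreover have "insert e B \<subseteq> pm.span ?E"
        using subset_trans[OF B(1) S] pm.span_base[OF e(1)] by (rule insert_subsetI[rotated])
      ultimately have "finite (insert e B) \<and> card (insert e B) \<le> card ?E"
        by (intro pm.independent_span_bound) auto
      moreover have "e \<notin> B" using e' pm.span_base by blast
      ultimately show False using cardB cardE by auto
    qed
  next
    assume E: "?E \<subseteq> pm.span ?S"
    have "pm.independent ?E"
    proof
      assume "pm.dependent ?E"
      then have "\<exists>f. (\<exists>v\<in>?E. f v \<noteq> 0) \<and> (\<Sum>v\<in>?E. scale (f v) v) = 0"
        by (rule pm.dependent_finite[OF finite_imageI[OF finite_lessThan], THEN iffD1])
      then obtain f j where f: "(\<Sum>v\<in>?E. scale (f v) v) = 0" and j: "j \<in> {..<m}" and nz: "f (?e j) \<noteq> 0"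
        by blast
      have "0 = Poly_Mapping.lookup (\<Sum>v\<in>?E. scale (f v) v) j" using f by simp
      also have "\<dots> = (\<Sum>k<m. if k = j then f (?e j) else 0)"
        unfolding sum.reindex[OF inj] lookup_sum_poly_mapping
        by (rule sum.cong) (auto simp: lookup_single when_def)
      also have "\<dots> = f (?e j)" using j by simp
      finally show False using nz by simp
    qed
    moreover have "pm.span ?E = pm.span ?S"
      using E S by (metis pm.span_mono pm.span_span subset_antisym)
    ultimately have "pm.dim (pm.span ?S) = card ?E"
      by (intro pm.dim_eq_card) (simp_all add: pm.span_span)
    then show "mon_rank (mon m c) = m" by (simp add: mon_rank_def keys_mon cardE)
  qed
  moreover have "?E \<subseteq> pm.span ?S \<longleftrightarrow> indep_mod 0 m c"
  proof
    assume E: "?E \<subseteq> pm.span ?S"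
    show "indep_mod 0 m c"
      unfolding indep_mod_def
    proof (intro allI impI)
      fix a \<mu> k assume rel: "(\<Sum>k<m. a k *s c k) = \<mu> *s (0 :: 'a ^ 'N)" and k: "k < m"
      have "ev a (?e k) = 0"
      proof (rule ev_span)
        show "?e k \<in> pm.span ?S" using k by (intro subsetD[OF E]) simp
        fix w assume "w \<in> ?S"
        then obtain i where w: "w = column m c i" by blast
        show "ev a w = 0" unfolding w ev_col rel by simp
      qed
      then show "a k = 0" using ev_e k by simp
    qed
  next
    assume ind: "indep_mod 0 m c"
    show "?E \<subseteq> pm.span ?S"
    proof (rule ccontr)
      assume "\<not> ?E \<subseteq> pm.span ?S"
      then obtain j where j: "j < m" "?e j \<notin> pm.span ?S"
        unfolding image_subset_iff by blast
      obtain B where B: "B \<subseteq> ?S" "pm.independent B" "?S \<subseteq> pm.span B" "card B = pm.dim ?S"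
        by (rule pm.basis_exists)
      have "pm.independent (insert (?e j) B)"
        using j(2) B(2) subsetD[OF pm.span_mono[OF B(1)]] by (intro pm.independent_insertI) blast+
      then obtain B' where B': "insert (?e j) B \<subseteq> B'" "pm.independent B'" "UNIV \<subseteq> pm.span B'"
        by (rule pm.maximal_independent_subset_extend[OF subset_UNIV])
      \<comment> \<open>The coordinate along \<open>?e j\<close> in a basis that extends
        \<open>?e j\<close> and a basis of the columns. This linear form vanishes on the columns and
        is 1 at \<open>?e j\<close>, so its values at the unit vectors are the coefficients of a
        nontrivial relation among the entries of \<open>c\<close>.\<close>
      define f where "f = (\<lambda>v. pm.representation B' v (?e j))"
      have f_add: "f (v + w) = f v + f w" for v w
        unfolding f_def using pm.representation_add[OF B'(2) subsetD[OF B'(3) UNIV_I] subsetD[OF B'(3) UNIV_I]]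
        by metis
      have f_scale: "f (scale t v) = t * f v" for t v
        unfolding f_def using pm.representation_scale[OF B'(2) subsetD[OF B'(3) UNIV_I]] by metis
      have f_B: "f v = (if ?e j = v then 1 else 0)" if "v \<in> B'" for v
        unfolding f_def using pm.representation_basis[OF B'(2) that] by simp
      have f0: "f 0 = 0" using f_scale[of 0 0] by simp
      have f_sum: "f (sum g A) = (\<Sum>i\<in>A. f (g i))" for g and A :: "nat set"
        by (induction A rule: infinite_finite_induct) (simp_all add: f_add f0)
      have "pm.subspace {v. f v = 0}"
        by (rule pm.subspaceI) (auto simp: f_add f_scale f0)
      moreover have "B \<subseteq> {v. f v = 0}"
      proof (intro subsetI CollectI)
        fix v assume v: "v \<in> B"
        then have "v \<in> pm.span ?S" using B(1) by (intro pm.span_base) blast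
        then have "?e j \<noteq> v" using j(2) by blast
        then show "f v = 0" using f_B[of v] v B'(1) by auto
      qed
      ultimately have "pm.span B \<subseteq> {v. f v = 0}" by (intro pm.span_minimal)
      then have fS: "f v = 0" if "v \<in> ?S" for v using that B(3) by auto
      define a where "a k = f (?e k)" for k
      have "(\<Sum>k<m. a k *s c k) $ i = 0" for i
      proof -
        have "column m c i = (\<Sum>k<m. scale (c k $ i) (?e k))"
          unfolding column_def
          by (intro sum.cong refl poly_mapping_eqI) (simp add: lookup_single when_def)
        then have "0 = f (\<Sum>k<m. scale (c k $ i) (?e k))" using fS by (metis rangeI)
        also have "\<dots> = (\<Sum>k<m. a k *s c k) $ i"
          by (simp add: f_sum f_scale a_def mult.commute)
        finally show ?thesis by simp
      qed
      then have "(\<Sum>k<m. a k *s c k) = 0 *s 0" by (simp add: vec_eq_iff)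
      then have "a j = 0" using ind j(1) unfolding indep_mod_def by blast
      moreover have "a j = 1" using f_B[of "?e j"] B'(1) by (simp add: a_def)
      ultimately show False by simp
    qed
  qed
  moreover have "mon m c \<in> monomials TYPE('N) m"
    using column_in_field_power sum_lookup_mon[of m c] by (auto simp: monomials_def keys_mon)
  ultimately show ?thesis by (simp add: monomials_star_def)
qed

text \<open>A relation modulo u expresses some entry through the others and u, and every tuple with
  the same monomial satisfies the same relation since permutations are linear and fix u. Deleting
  that entry is therefore a bijection onto the tuples of length m with one fixed monomial; it stays
  within \<open>C\<close> because \<open>C\<close> is a subspace containing u.\<close>

lemma card_tuples_dependent:
  fixes c :: "nat \<Rightarrow> 'a::{field,finite} ^ 'N::finite"
  assumes dep: "\<not> indep_mod u (Suc m) c" and u: "\<And>\<pi>. bij \<pi> \<Longrightarrow> perm \<pi> u = u"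
  obtains Y where "\<And>C. vec.subspace C \<Longrightarrow> u \<in> C \<Longrightarrow>
    card {d \<in> {..<Suc m} \<rightarrow>\<^sub>E C. mon (Suc m) d = mon (Suc m) c} = card {d \<in> {..<m} \<rightarrow>\<^sub>E C. mon m d = Y}"
proof -
  obtain a \<mu> j where rel: "(\<Sum>k<Suc m. a k *s c k) = \<mu> *s u" and j: "j < Suc m" "a j \<noteq> 0"
    using dep unfolding indep_mod_def by blast
  \<comment> \<open>Enumerates the indices other than j by letting the last index m take the place
    of j, so that the remaining entries need no shift.\<close>
  define s where "s l = (if l = j then m else l)" for l
  have s: "bij_betw s {..<m} ({..<Suc m} - {j})"
    unfolding bij_betw_def using j(1) by (auto simp: s_def inj_on_def image_iff split: if_splits)
  \<comment> \<open>\<open>B\<close> deletes entry j; \<open>A\<close> solves the relation for it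
    and moves the last entry back.\<close>
  define B where "B d = (\<lambda>l\<in>{..<m}. d (s l))" for d :: "nat \<Rightarrow> 'a ^ 'N"
  define A where "A d = (\<lambda>k\<in>{..<Suc m}. if k = j
      then (\<Sum>l<m. (- a (s l) / a j) *s d l) + (\<mu> / a j) *s u
      else if k = m then d j else d k)" for d :: "nat \<Rightarrow> 'a ^ 'N"
  have s_lt: "s l < Suc m" "s l \<noteq> j" if "l < m" for l
    using bij_betwE[OF s] that by auto
  have AB_c: "A (B c) k = c k" if k: "k < Suc m" for k
  proof (cases "k = j")
    case True
    have "(\<Sum>k\<in>{..<Suc m}. a k *s c k) = a j *s c j + (\<Sum>k\<in>{..<Suc m} - {j}. a k *s c k)"
      using j(1) by (intro sum.remove) auto
    also have "(\<Sum>k\<in>{..<Suc m} - {j}. a k *s c k) = (\<Sum>l<m. a (s l) *s c (s l))"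
      using sum.reindex_bij_betw[OF s, of "\<lambda>k. a k *s c k"] by simp
    finally have "a j *s c j = \<mu> *s u - (\<Sum>l<m. a (s l) *s c (s l))"
      using rel by (simp add: algebra_simps)
    then have "(1 / a j) *s (a j *s c j) = (1 / a j) *s (\<mu> *s u - (\<Sum>l<m. a (s l) *s c (s l)))"
      by simp
    moreover have "(1 / a j) *s (a j *s c j) = c j"
      using j(2) by (simp only: vec.scale_scale) simp
    ultimately show ?thesis
      using True k by (simp add: A_def B_def vec.scale_right_diff_distrib vec.scale_sum_right
          vec.scale_minus_left sum_negf algebra_simps)
  next
    case False
    then show ?thesis
      using k j(1) by (auto simp: A_def B_def s_def)
  qed
  have BA: "B (A d) = d" if "d \<in> {..<m} \<rightarrow>\<^sub>E UNIV" for d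
    using that s_lt j(1) by (intro extensionalityI[where A = "{..<m}"]) (auto simp: A_def B_def s_def PiE_iff)
  have A_perm: "A d k = perm \<pi> (A e k)" if "bij \<pi>" "\<And>l. l < m \<Longrightarrow> d l = perm \<pi> (e l)" "k < Suc m" for \<pi> d e k
    using that j(1) u[OF that(1)] by (auto simp: A_def perm_add perm_scale perm_sum perm_minus)
  have B_perm: "B d l = perm \<pi> (B e l)" if "\<And>k. k < Suc m \<Longrightarrow> d k = perm \<pi> (e k)" "l < m" for \<pi> d e l
    using that s_lt by (auto simp: B_def)
  show thesis
  proof (rule that)
    fix C :: "('a ^ 'N) set" assume C: "vec.subspace C" "u \<in> C"
    let ?X = "{d \<in> {..<Suc m} \<rightarrow>\<^sub>E C. mon (Suc m) d = mon (Suc m) c}"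
    let ?Y = "{d \<in> {..<m} \<rightarrow>\<^sub>E C. mon m d = mon m (B c)}"
    have "bij_betw B ?X ?Y"
    proof (rule bij_betw_byWitness[where f' = A])
      show "\<forall>d\<in>?X. A (B d) = d"
      proof
        fix d assume d: "d \<in> ?X"
        then have "mon (Suc m) c = mon (Suc m) d" by simp
        then obtain \<pi> where \<pi>: "bij \<pi>" "\<forall>k<Suc m. d k = perm \<pi> (c k)"
          unfolding mon_eq_iff by blast
        show "A (B d) = d"
        proof (rule extensionalityI[where A = "{..<Suc m}"])
          show "A (B d) \<in> extensional {..<Suc m}" by (simp add: A_def)
          show "d \<in> extensional {..<Suc m}" using d by (simp add: PiE_iff)
          fix k assume "k \<in> {..<Suc m}"
          then show "A (B d) k = d k"
            using A_perm[OF \<pi>(1), of "B d" "B c" k] B_perm[of d \<pi> c] \<pi>(2) AB_c[of k] by simp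
        qed
      qed
      show "\<forall>d\<in>?Y. B (A d) = d"
        using BA by (auto simp: PiE_iff)
      show "B ` ?X \<subseteq> ?Y"
      proof (rule image_subsetI)
        fix d assume d: "d \<in> ?X"
        then have "mon (Suc m) c = mon (Suc m) d" by simp
        then obtain \<pi> where \<pi>: "bij \<pi>" "\<forall>k<Suc m. d k = perm \<pi> (c k)"
          unfolding mon_eq_iff by blast
        have "mon m (B c) = mon m (B d)"
          unfolding mon_eq_iff using \<pi> B_perm[of d \<pi> c] by blast
        moreover have "B d \<in> {..<m} \<rightarrow>\<^sub>E C"
          using d s_lt by (auto simp: B_def PiE_iff)
        ultimately show "B d \<in> ?Y" by simp
      qed
      show "A ` ?Y \<subseteq> ?X"
      proof (rule image_subsetI)
        fix d assume d: "d \<in> ?Y"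
        then have "mon m (B c) = mon m d" by simp
        then obtain \<pi> where \<pi>: "bij \<pi>" "\<forall>k<m. d k = perm \<pi> (B c k)"
          unfolding mon_eq_iff by blast
        have "\<forall>k<Suc m. A d k = perm \<pi> (c k)"
          using A_perm[OF \<pi>(1), of d "B c"] \<pi>(2) AB_c by simp
        then have "mon (Suc m) c = mon (Suc m) (A d)"
          unfolding mon_eq_iff using \<pi>(1) by blast
        moreover have "A d k \<in> C" if k: "k < Suc m" for k
        proof -
          have dC: "d l \<in> C" if "l < m" for l using d that by (auto simp: PiE_iff)
          have "(\<Sum>l<m. (- a (s l) / a j) *s d l) + (\<mu> / a j) *s u \<in> C"
            using C dC by (intro vec.subspace_add vec.subspace_sum vec.subspace_scale) auto
          moreover have "d j \<in> C" if "k \<noteq> j" "k = m" using dC[of j] j(1) that by simp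
          moreover have "d k \<in> C" if "k \<noteq> m" using dC[of k] k that by simp
          ultimately show ?thesis unfolding A_def using k by (simp split del: if_split) (simp split: if_split)
        qed
        then have "A d \<in> {..<Suc m} \<rightarrow>\<^sub>E C"
          unfolding PiE_iff by (simp add: A_def[THEN arg_cong, of "\<lambda>f. f \<in> extensional {..<Suc m}"])
        ultimately show "A d \<in> ?X" by simp
      qed
    qed
    then show "card ?X = card ?Y" by (rule bij_betw_same_card)
  qed
qed

section \<open>The spaces \<open>\<V>\<^sub>m\<close>\<close>

lemma finite_tuples: "finite ({..<m::nat} \<rightarrow>\<^sub>E (C :: ('a::finite ^ 'N::finite) set))"
  by (simp add: finite_PiE)

lemma rep_in_family: "K \<in> code_class ` \<F> \<Longrightarrow> rep \<F> K \<in> \<F>"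
  unfolding rep_def by (rule inv_into_into)

lemma code_class_rep: "K \<in> code_class ` \<F> \<Longrightarrow> code_class (rep \<F> K) = K"
  unfolding rep_def by (rule f_inv_into_f)

text \<open>For positive m the coefficients of the enumerator are the values of the
  \<open>mon_coeff\<close>. For m = 0 the enumerator is the constant 1 while the empty tuple has a
  monomial of degree N, but either condition says that the coefficients of \<open>v\<close> sum to
  zero.\<close>

lemma V_space_iff:
  fixes \<F> :: "('a::{field,finite} ^ 'N::finite) set set"
  shows "v \<in> V_space \<F> (int m) \<longleftrightarrow> v \<in> class_space \<F> \<and> (\<forall>X. mon_coeff \<F> m X v = 0)"
proof -
  have "cwe \<F> m v = 0 \<longleftrightarrow> (\<forall>X. mon_coeff \<F> m X v = 0)"
  proof (cases "m = 0")
    case True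
    have *: "{..<0::nat} \<rightarrow>\<^sub>E C = {\<lambda>_. undefined}" for C :: "('a, 'N) vec set" by simp
    let ?e = "\<lambda>_. undefined :: ('a, 'N) vec"
    let ?s = "\<Sum>K\<in>code_class ` \<F>. Poly_Mapping.lookup v K"
    have card: "card {c \<in> {..<0::nat} \<rightarrow>\<^sub>E C. mon 0 c = X} = (if mon 0 ?e = X then 1 else 0)"
      for C :: "('a, 'N) vec set" and X
    proof -
      have "{c \<in> {..<0::nat} \<rightarrow>\<^sub>E C. mon 0 c = X} = (if mon 0 ?e = X then {?e} else {})"
        unfolding * by auto
      then show ?thesis by simp
    qed
    have "mon_coeff \<F> m X v = (if mon 0 ?e = X then ?s else 0)" for X
      unfolding mon_coeff_def True card by simp
    moreover have "Poly_Mapping.lookup (cwe \<F> m v) X = (if X = 0 then ?s else 0)" for X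
      by (simp add: cwe_def True cwe_code_def lookup_sum_poly_mapping lookup_one when_def)
    then have "cwe \<F> m v = 0 \<longleftrightarrow> ?s = 0"
      by (metis lookup_zero poly_mapping_eqI)
    ultimately show ?thesis by auto
  next
    case False
    have "Poly_Mapping.lookup (cwe \<F> m v) X = mon_coeff \<F> m X v" for X
    proof -
      have "Poly_Mapping.lookup (cwe_code m C) X = of_nat (card {c \<in> {..<m} \<rightarrow>\<^sub>E C. mon m c = X})"
        for C :: "('a, 'N) vec set"
        using False
        by (simp add: cwe_code_def lookup_sum_poly_mapping lookup_single when_def sum.If_cases
            finite_tuples Int_def)
      then show ?thesis
        by (simp add: cwe_def mon_coeff_def lookup_sum_poly_mapping)
    qed
    then show ?thesis by (auto simp: poly_mapping_eq_iff fun_eq_iff)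
  qed
  then show ?thesis by (auto simp: V_space_def)
qed

text \<open>A function of tuples that depends only on the monomial is a combination of the \<open>a\<^sub>X\<close>.\<close>

lemma V_space_sum_eq_0:
  fixes \<F> :: "('a::{field,finite} ^ 'N::finite) set set" and \<phi> :: "_ \<Rightarrow> complex"
  assumes v: "v \<in> V_space \<F> (int m)"
    and inv: "\<And>c d. c \<in> {..<m} \<rightarrow>\<^sub>E UNIV \<Longrightarrow> d \<in> {..<m} \<rightarrow>\<^sub>E UNIV \<Longrightarrow> mon m c = mon m d \<Longrightarrow> \<phi> c = \<phi> d"
  shows "(\<Sum>K\<in>code_class ` \<F>. Poly_Mapping.lookup v K * (\<Sum>c\<in>{..<m} \<rightarrow>\<^sub>E rep \<F> K. \<phi> c)) = 0"
proof -
  let ?U = "{..<m} \<rightarrow>\<^sub>E (UNIV :: ('a, 'N) vec set)"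
  define \<psi> where "\<psi> X = \<phi> (inv_into ?U (mon m) X)" for X
  have \<psi>: "\<phi> c = \<psi> (mon m c)" if "c \<in> ?U" for c
    unfolding \<psi>_def
    by (rule inv[OF that inv_into_into[OF imageI[OF that]] f_inv_into_f[OF imageI[OF that], symmetric]])
  have "(\<Sum>c\<in>{..<m} \<rightarrow>\<^sub>E C. \<phi> c) =
      (\<Sum>X\<in>mon m ` ?U. \<psi> X * of_nat (card {c \<in> {..<m} \<rightarrow>\<^sub>E C. mon m c = X}))" for C
  proof -
    have sub: "{..<m} \<rightarrow>\<^sub>E C \<subseteq> ?U" by (rule PiE_mono) simp
    have "(\<Sum>c\<in>{..<m} \<rightarrow>\<^sub>E C. \<phi> c) =
        (\<Sum>X\<in>mon m ` ?U. \<Sum>c\<in>{c \<in> {..<m} \<rightarrow>\<^sub>E C. mon m c = X}. \<phi> c)"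
      using sub by (intro sum.group[symmetric] finite_imageI finite_tuples) auto
    also have "\<dots> = (\<Sum>X\<in>mon m ` ?U. \<Sum>c\<in>{c \<in> {..<m} \<rightarrow>\<^sub>E C. mon m c = X}. \<psi> X)"
      using sub by (intro sum.cong refl) (auto simp: \<psi> subset_eq)
    finally show ?thesis by (simp add: mult.commute)
  qed
  then have "(\<Sum>K\<in>code_class ` \<F>. Poly_Mapping.lookup v K * (\<Sum>c\<in>{..<m} \<rightarrow>\<^sub>E rep \<F> K. \<phi> c)) =
      (\<Sum>K\<in>code_class ` \<F>. \<Sum>X\<in>mon m ` ?U. \<psi> X * (Poly_Mapping.lookup v K *
        of_nat (card {c \<in> {..<m} \<rightarrow>\<^sub>E rep \<F> K. mon m c = X})))"
    by (simp add: sum_distrib_left mult_ac)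
  also have "\<dots> = (\<Sum>X\<in>mon m ` ?U. \<psi> X * mon_coeff \<F> m X v)"
    unfolding mon_coeff_def by (subst sum.swap) (simp add: sum_distrib_left)
  also have "\<dots> = 0"
    using v by (simp add: V_space_iff)
  finally show ?thesis .
qed

lemma mon_coeff_cong:
  assumes "\<And>C. C \<in> \<F> \<Longrightarrow>
    card {c \<in> {..<m} \<rightarrow>\<^sub>E C. mon m c = X} = card {c \<in> {..<m'} \<rightarrow>\<^sub>E C. mon m' c = X'}"
  shows "mon_coeff \<F> m X v = mon_coeff \<F> m' X' v"
  unfolding mon_coeff_def using assms[OF rep_in_family] by (intro sum.cong refl) simp

lemma mon_coeff_add: "mon_coeff \<F> m X (v + w) = mon_coeff \<F> m X v + mon_coeff \<F> m X w"
  by (simp add: mon_coeff_def lookup_add algebra_simps sum.distrib)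

lemma mon_coeff_scale: "mon_coeff \<F> m X (scale a v) = a * mon_coeff \<F> m X v"
  by (simp add: mon_coeff_def sum_distrib_left mult.assoc)

lemma mon_coeff_sum: "mon_coeff \<F> m X (sum f A) = (\<Sum>i\<in>A. mon_coeff \<F> m X (f i))"
  by (induction A rule: infinite_finite_induct) (simp_all add: mon_coeff_add, simp_all add: mon_coeff_def)

lemma mon_coeff_kneser_hecke:
  fixes \<F> :: "('a::{field,finite} ^ 'N::finite) set set"
  shows "mon_coeff \<F> m X (kneser_hecke n \<F> v) = (\<Sum>K\<in>code_class ` \<F>. Poly_Mapping.lookup v K *
    (\<Sum>D\<in>{D \<in> \<F>. vec.dim (rep \<F> K \<inter> D) = n - 1}. of_nat (card {c \<in> {..<m} \<rightarrow>\<^sub>E D. mon m c = X})))"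
  by (simp add: kneser_hecke_def mon_coeff_sum mon_coeff_scale mon_coeff_basis_vec)

lemma lookup_kneser_hecke:
  fixes \<F> :: "('a::{field,finite} ^ 'N::finite) set set"
  shows "Poly_Mapping.lookup (kneser_hecke n \<F> v) K = (\<Sum>L\<in>code_class ` \<F>. Poly_Mapping.lookup v L *
    of_nat (card {D \<in> \<F>. vec.dim (rep \<F> L \<inter> D) = n - 1 \<and> code_class D = K}))"
proof -
  have "(\<Sum>D\<in>{D \<in> \<F>. vec.dim (R \<inter> D) = n - 1}. Poly_Mapping.lookup (basis_vec D) K) =
      of_nat (card {D \<in> \<F>. vec.dim (R \<inter> D) = n - 1 \<and> code_class D = K})" for R
    by (simp add: basis_vec_def lookup_single when_def sum.If_cases Int_def conj_ac)
  then show ?thesis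
    by (simp add: kneser_hecke_def lookup_sum_poly_mapping)
qed

lemma class_space_iff: "v \<in> class_space \<F> \<longleftrightarrow> (\<forall>K. K \<notin> code_class ` \<F> \<longrightarrow> Poly_Mapping.lookup v K = 0)"
  by (auto simp: class_space_def in_keys_iff)

lemma kneser_hecke_in_class_space:
  fixes \<F> :: "('a::{field,finite} ^ 'N::finite) set set"
  shows "kneser_hecke n \<F> v \<in> class_space \<F>"
  unfolding class_space_iff lookup_kneser_hecke
proof (intro allI impI sum.neutral ballI)
  fix K L assume "K \<notin> code_class ` \<F>"
  then have "{D \<in> \<F>. vec.dim (rep \<F> L \<inter> D) = n - 1 \<and> code_class D = K} = {}" by blast
  then show "Poly_Mapping.lookup v L *
      of_nat (card {D \<in> \<F>. vec.dim (rep \<F> L \<inter> D) = n - 1 \<and> code_class D = K}) = 0"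
    by (simp only: card.empty of_nat_0 mult_zero_right)
qed

lemma dim_perm:
  fixes S :: "('a::field ^ 'N::finite) set"
  assumes "bij \<pi>" shows "vec.dim (perm \<pi> ` S) = vec.dim S"
  using vec.dim_image_eq[OF linear_perm, of \<pi> S] inj_on_subset[OF bij_is_inj[OF bij_perm[OF assms]] subset_UNIV]
  by blast

lemma span_perm:
  fixes S :: "('a::field ^ 'N::finite) set"
  shows "vec.span (perm \<pi> ` S) = perm \<pi> ` vec.span S"
  by (rule vec.linear_span_image[OF linear_perm])

context code_setting
begin

text \<open>Padding by a zero codeword identifies m-tuples with the longer tuples whose last entry
  is 0. Whether the last entry is 0 and the others have monomial \<open>X\<close> depends only on
  the monomial of the long tuple, because permutations fix 0.\<close>

lemma V_space_Suc_subset: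
  assumes v: "v \<in> V_space \<F> (int (Suc m))"
  shows "v \<in> V_space \<F> (int m)"
  unfolding V_space_iff
proof (intro conjI allI)
  show "v \<in> class_space \<F>" using v V_space_iff by blast
  fix X
  define \<phi> :: "(nat \<Rightarrow> 'a ^ 'N) \<Rightarrow> complex" where "\<phi> c = (if c m = 0 \<and> mon m c = X then 1 else 0)" for c
  have inv: "\<phi> c = \<phi> d" if eq: "mon (Suc m) c = mon (Suc m) d" for c d
  proof -
    obtain \<pi> where \<pi>: "bij \<pi>" "\<forall>k<Suc m. d k = perm \<pi> (c k)"
      using eq unfolding mon_eq_iff by blast
    have "mon m c = mon m d" unfolding mon_eq_iff using \<pi> by auto
    moreover have "d m = 0 \<longleftrightarrow> c m = 0"
      using \<pi> perm_inject[OF \<pi>(1), of "c m" 0] by (simp add: perm_0)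
    ultimately show ?thesis by (simp add: \<phi>_def)
  qed
  have "(\<Sum>c\<in>{..<Suc m} \<rightarrow>\<^sub>E C. \<phi> c) = of_nat (card {c \<in> {..<m} \<rightarrow>\<^sub>E C. mon m c = X})"
    if "C \<in> \<F>" for C
  proof -
    have C0: "0 \<in> C" using \<F>D(1)[OF that] by (rule vec.subspace_0)
    have "bij_betw (\<lambda>d. d(m := 0)) {d \<in> {..<m} \<rightarrow>\<^sub>E C. mon m d = X}
        {c \<in> {..<Suc m} \<rightarrow>\<^sub>E C. c m = 0 \<and> mon m c = X}"
    proof (rule bij_betw_byWitness[where f' = "\<lambda>c. restrict c {..<m}"])
      have "mon m (d(m := 0)) = mon m d" for d :: "nat \<Rightarrow> ('a, 'N) vec"
        by (rule mon_cong) simp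
      then show "(\<lambda>d. d(m := 0)) ` {d \<in> {..<m} \<rightarrow>\<^sub>E C. mon m d = X} \<subseteq>
          {c \<in> {..<Suc m} \<rightarrow>\<^sub>E C. c m = 0 \<and> mon m c = X}"
        using C0 by (auto simp: PiE_iff extensional_def less_Suc_eq)
      have "mon m (restrict c {..<m}) = mon m c" for c :: "nat \<Rightarrow> ('a, 'N) vec"
        by (rule mon_cong) simp
      then show "(\<lambda>c. restrict c {..<m}) ` {c \<in> {..<Suc m} \<rightarrow>\<^sub>E C. c m = 0 \<and> mon m c = X} \<subseteq>
          {d \<in> {..<m} \<rightarrow>\<^sub>E C. mon m d = X}"
        by (auto simp: PiE_iff)
    qed (auto simp: PiE_iff extensional_def fun_eq_iff less_Suc_eq)
    then have "card {c \<in> {..<m} \<rightarrow>\<^sub>E C. mon m c = X} = card {c \<in> {..<Suc m} \<rightarrow>\<^sub>E C. c m = 0 \<and> mon m c = X}"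
      by (rule bij_betw_same_card)
    then show ?thesis
      by (simp add: \<phi>_def sum.If_cases finite_tuples Int_def)
  qed
  then have "mon_coeff \<F> m X v =
      (\<Sum>K\<in>code_class ` \<F>. Poly_Mapping.lookup v K * (\<Sum>c\<in>{..<Suc m} \<rightarrow>\<^sub>E rep \<F> K. \<phi> c))"
    unfolding mon_coeff_def by (intro sum.cong refl) (simp add: rep_in_family)
  also have "\<dots> = 0"
    using v inv by (rule V_space_sum_eq_0)
  finally show "mon_coeff \<F> m X v = 0" .
qed

lemma V_space_subset_pred:
  assumes "v \<in> V_space \<F> (int m)" shows "v \<in> V_space \<F> (int m - 1)"
proof (cases m)
  case 0
  then show ?thesis using assms by (simp add: V_space_def)
next
  case (Suc m')
  then show ?thesis using assms V_space_Suc_subset by simp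
qed

text \<open>A monomial that comes from no tuple has coefficient 0. One that comes from a dependent
  tuple has the same coefficient as a monomial of genus m - 1, by
  \<open>card_tuples_dependent\<close>, and that vanishes by assumption. Only the independent ones
  remain to be tested.\<close>

lemma V_spaceI:
  assumes v: "v \<in> V_space \<F> (int m - 1)"
    and 0: "\<And>c. indep_mod u m c \<Longrightarrow> mon_coeff \<F> m (mon m c) v = 0"
  shows "v \<in> V_space \<F> (int m)"
  unfolding V_space_iff
proof (intro conjI allI)
  show "v \<in> class_space \<F>" using v by (auto simp: V_space_def split: if_splits)
  fix X
  show "mon_coeff \<F> m X v = 0"
  proof (cases "\<exists>c :: nat \<Rightarrow> ('a, 'N) vec. mon m c = X")
    case False
    then show ?thesis by (simp add: mon_coeff_def)
  next
    case True
    then obtain c :: "nat \<Rightarrow> ('a, 'N) vec" where c: "mon m c = X" by blast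
    show ?thesis
    proof (cases "indep_mod u m c")
      case True
      then show ?thesis using 0 c by blast
    next
      case False
      then obtain m' where m: "m = Suc m'"
        by (cases m) (auto simp: indep_mod_def)
      obtain Y where "\<And>C. vec.subspace C \<Longrightarrow> u \<in> C \<Longrightarrow>
          card {d \<in> {..<Suc m'} \<rightarrow>\<^sub>E C. mon (Suc m') d = mon (Suc m') c} = card {d \<in> {..<m'} \<rightarrow>\<^sub>E C. mon m' d = Y}"
        using card_tuples_dependent[OF False[unfolded m] perm_u] by blast
      then have "mon_coeff \<F> (Suc m') (mon (Suc m') c) v = mon_coeff \<F> m' Y v"
        using \<F>D(1,3) by (intro mon_coeff_cong) blast
      also have "\<dots> = 0"
        using v m V_space_iff[of v \<F> m'] by simp
      finally show ?thesis using c m by simp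
    qed
  qed
qed

end

section \<open>The Kneser-Hecke operator\<close>

lemma eq_if_singletonI:
  "(\<And>x. x \<in> A \<Longrightarrow> x = a \<and> P) \<Longrightarrow> (P \<Longrightarrow> a \<in> A) \<Longrightarrow> A = (if P then {a} else {})"
  by (cases P; simp only: if_True if_False; blast)

lemma dim_span_indep_mod:
  fixes u :: "'a::field ^ 'N::finite"
  assumes "indep_mod u m c" shows "vec.dim (vec.span (c ` {..<m})) = m"
proof -
  have "indep_mod 0 m c"
    unfolding indep_mod_def
  proof (intro allI impI)
    fix a \<mu> k assume "(\<Sum>k<m. a k *s c k) = \<mu> *s (0 :: 'a ^ 'N)" "k < m"
    then have "(\<Sum>k<m. a k *s c k) = 0 *s u" "k < m" by simp_all
    then show "a k = 0" using assms unfolding indep_mod_def by blast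
  qed
  then have "vec.dim (insert 0 (c ` {..<m})) = m"
    by (simp add: indep_mod_iff_dim(2))
  then show ?thesis by (metis vec.dim_span vec.span_insert_0)
qed

lemma bij_betw_tuples_UNIV:
  fixes P Q :: "(nat \<Rightarrow> 'a ^ 'N) \<Rightarrow> bool" and m :: nat
  assumes "bij \<pi>" and iff: "\<And>d. Q (\<lambda>k\<in>{..<m}. perm \<pi> (d k)) \<longleftrightarrow> P d"
  shows "bij_betw (\<lambda>d. \<lambda>k\<in>{..<m}. perm \<pi> (d k)) {d \<in> {..<m} \<rightarrow>\<^sub>E UNIV. P d} {d \<in> {..<m} \<rightarrow>\<^sub>E UNIV. Q d}"
proof -
  let ?h = "\<lambda>d. \<lambda>k\<in>{..<m}. perm \<pi> (d k) :: 'a ^ 'N"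
  let ?U = "{..<m} \<rightarrow>\<^sub>E (UNIV :: ('a ^ 'N) set)"
  have "bij_betw ?h ?U ({..<m} \<rightarrow>\<^sub>E range (perm \<pi>))"
    by (rule bij_betw_tuples[OF assms(1)])
  moreover have "range (perm \<pi> :: 'a ^ 'N \<Rightarrow> _) = UNIV"
    by (rule bij_is_surj[OF bij_perm[OF assms(1)]])
  ultimately have bij: "bij_betw ?h ?U ?U" by (simp only:)
  then have inj: "inj_on ?h ?U" and im: "?h ` ?U = ?U" by (rule bij_betw_imp_inj_on, rule bij_betw_imp_surj_on)
  show ?thesis
  proof (rule bij_betw_imageI)
    show "inj_on ?h {d \<in> ?U. P d}"
      using inj by (rule inj_on_subset) (rule Collect_subset)
    show "?h ` {d \<in> ?U. P d} = {d \<in> ?U. Q d}"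
    proof (intro equalityI subsetI)
      fix e assume "e \<in> ?h ` {d \<in> ?U. P d}"
      then obtain d where d: "d \<in> ?U" "P d" "e = ?h d" by blast
      have "e \<in> ?U" unfolding d(3) using imageI[OF d(1), of ?h] by (simp only: im)
      moreover have "Q e" unfolding d(3) using iff[of d] d(2) by (rule iffD2)
      ultimately show "e \<in> {d \<in> ?U. Q d}" by (simp only: mem_Collect_eq simp_thms)
    next
      fix e assume e: "e \<in> {d \<in> ?U. Q d}"
      then have "e \<in> ?h ` ?U" by (simp only: im mem_Collect_eq)
      then obtain d where d: "e = ?h d" "d \<in> ?U" by (rule imageE)
      have "Q (?h d)" using e d(1) by (simp only: mem_Collect_eq)
      then have "P d" using iff[of d] by (rule iffD1[rotated])
      then show "e \<in> ?h ` {d \<in> ?U. P d}"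
        using d by (intro image_eqI[of _ _ d]) (simp_all only: mem_Collect_eq simp_thms)
    qed
  qed
qed

context code_setting
begin

lemma indep_mod_mon_cong:
  assumes "mon m c = mon m d" shows "indep_mod u m d \<longleftrightarrow> indep_mod u m c"
proof -
  obtain \<pi> where \<pi>: "bij \<pi>" "\<forall>k<m. d k = perm \<pi> (c k)"
    using assms unfolding mon_eq_iff by blast
  then show ?thesis
    using indep_mod_perm[OF \<pi>(1) perm_u[OF \<pi>(1)], of m d c] by simp
qed

abbreviation neighbours :: "('a ^ 'N) set \<Rightarrow> ('a ^ 'N) set set" where
  "neighbours C \<equiv> {D \<in> \<F>. vec.dim (C \<inter> D) = n - 1}"

text \<open>\<open>\<kappa>\<close> times the number of hyperplanes of an n-dimensional space
  through a subspace of dimension m, or m + 1 for nonzero u. The subtraction is truncated, so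
  agreement with the table is claimed only while that dimension is at most n.\<close>

definition alpha :: "nat \<Rightarrow> real" where
  "alpha m = real \<kappa> * ((real CARD('a) ^ (n - (m + (if u = 0 then 0 else 1))) - 1) / (real CARD('a) - 1))"

lemma dim_eq_pred_iff: "k = n - 1 \<longleftrightarrow> k + 1 = n"
  using n_pos by auto

text \<open>Only the hyperplanes through u contribute, each with \<open>\<kappa>\<close>; they are
  the hyperplanes of C over u and the entries of c. The second claim holds since these vectors lie
  in C, of dimension n.\<close>

lemma sum_num_neighbours:
  assumes C: "C \<in> \<F>" and c: "c \<in> {..<m} \<rightarrow>\<^sub>E C" and ind: "indep_mod u m c"
  shows "real (\<Sum>E\<in>hyperplanes_through n m C c. num_neighbours \<F> E C) = alpha m"
    and "m + (if u = 0 then 0 else 1) \<le> n"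
proof -
  note CD = \<F>D[OF C]
  let ?U = "insert u (c ` {..<m})"
  have U: "?U \<subseteq> C" using c CD(3) by (auto simp: PiE_iff)
  have dimU: "vec.dim ?U = m + (if u = 0 then 0 else 1)"
    using ind indep_mod_iff_dim(2) by blast
  then show "m + (if u = 0 then 0 else 1) \<le> n"
    using vec.dim_subset[OF U] CD(4) by simp
  have ht: "hyperplanes_through n m C c \<subseteq> hyperplanes {} C"
    using dim_eq_pred_iff CD(4) by (auto simp: hyperplanes_through_def hyperplanes_def)
  have "{E \<in> hyperplanes_through n m C c. u \<in> E} = hyperplanes ?U C"
    using c dim_eq_pred_iff CD(4)
    by (auto simp: hyperplanes_through_def hyperplanes_def PiE_iff image_subset_iff)
  moreover have "(\<Sum>E\<in>hyperplanes_through n m C c. num_neighbours \<F> E C) =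
      (\<Sum>E\<in>hyperplanes_through n m C c. if u \<in> E then \<kappa> else 0)"
    using ht by (intro sum.cong refl num_neighbours_eq[OF C]) auto
  ultimately have "(\<Sum>E\<in>hyperplanes_through n m C c. num_neighbours \<F> E C) = card (hyperplanes ?U C) * \<kappa>"
    by (simp add: sum.If_cases Int_def)
  then show "real (\<Sum>E\<in>hyperplanes_through n m C c. num_neighbours \<F> E C) = alpha m"
    using card_hyperplanes[OF CD(1) U] by (simp add: alpha_def dimU CD(4) mult.commute)
qed

lemma card_neighbours_containing:
  assumes C: "C \<in> \<F>" and c: "c \<in> {..<m} \<rightarrow>\<^sub>E C" and ind: "indep_mod u m c"
  shows "real (card {D \<in> neighbours C. c \<in> {..<m} \<rightarrow>\<^sub>E D}) = alpha m"
proof -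
  let ?H = "hyperplanes_through n m C c"
  note CD = \<F>D[OF C]
  have "{D \<in> neighbours C. c \<in> {..<m} \<rightarrow>\<^sub>E D} = (\<Union>E\<in>?H. {D \<in> \<F>. D \<inter> C = E})"
  proof (intro equalityI subsetI)
    fix D assume D: "D \<in> {D \<in> neighbours C. c \<in> {..<m} \<rightarrow>\<^sub>E D}"
    then have "C \<inter> D \<in> ?H"
      using c CD(1) \<F>D(1)[of D] vec.subspace_inter[of C D]
      by (auto simp: hyperplanes_through_def PiE_iff)
    then show "D \<in> (\<Union>E\<in>?H. {D \<in> \<F>. D \<inter> C = E})"
      using D by (auto simp: Int_commute)
  next
    fix D assume "D \<in> (\<Union>E\<in>?H. {D \<in> \<F>. D \<inter> C = E})"
    then have D: "D \<in> \<F>" "C \<inter> D \<in> ?H" by (auto simp: Int_commute)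
    then show "D \<in> {D \<in> neighbours C. c \<in> {..<m} \<rightarrow>\<^sub>E D}"
      by (auto simp: hyperplanes_through_def PiE_iff)
  qed
  moreover have "card (\<Union>E\<in>?H. {D \<in> \<F>. D \<inter> C = E}) = (\<Sum>E\<in>?H. num_neighbours \<F> E C)"
    unfolding num_neighbours_def by (rule card_UN_disjoint) auto
  ultimately show ?thesis using sum_num_neighbours(1)[OF C c ind] by simp
qed

text \<open>The form is chosen so that the hyperplane term is present whether or not the tuple lies
  in C; for a tuple in C its value (q^m - 1)/(q - 1) is subtracted again. \<open>C1\<close> makes
  the span of the tuple totally isotropic and its entries good. Without a code containing it, a
  tuple could have a hyperplane of its span in C and still lie in no neighbour.\<close>

lemma card_neighbours_containing':
  assumes C: "C \<in> \<F>" and ind: "indep_mod u m c" and C1: "C1 \<in> \<F>" "c \<in> {..<m} \<rightarrow>\<^sub>E C1"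
  shows "real (card {D \<in> neighbours C. c \<in> {..<m} \<rightarrow>\<^sub>E D}) =
    (if c \<in> {..<m} \<rightarrow>\<^sub>E C then alpha m - (real CARD('a) ^ m - 1) / (real CARD('a) - 1) else 0) +
    real (card {H \<in> hyperplanes {} (vec.span (c ` {..<m})). H \<subseteq> C})"
proof -
  let ?S = "vec.span (c ` {..<m})"
  note CD = \<F>D[OF C] and C1D = \<F>D[OF C1(1)]
  have dimS: "vec.dim ?S = m" by (rule dim_span_indep_mod[OF ind])
  show ?thesis
  proof (cases "c \<in> {..<m} \<rightarrow>\<^sub>E C")
    case True
    then have "?S \<subseteq> C"
      using CD(1) by (intro vec.span_minimal) (auto simp: PiE_iff)
    then have "{H \<in> hyperplanes {} ?S. H \<subseteq> C} = hyperplanes {} ?S"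
      by (auto simp: hyperplanes_def)
    moreover have "real (card (hyperplanes {} ?S)) = (real CARD('a) ^ m - 1) / (real CARD('a) - 1)"
      using card_hyperplanes[of ?S "{}"] dimS by simp
    ultimately show ?thesis
      using True card_neighbours_containing[OF C True ind] by simp
  next
    case False
    then obtain k where k: "k < m" "c k \<notin> C"
      using C1(2) by (auto simp: PiE_iff)
    define x where "x = c k"
    have x: "x \<notin> C" "x \<in> ?S" "x \<in> C1" "good x"
      using k C1(2) C1D(6) vec.span_base[of x "c ` {..<m}"] by (auto simp: x_def PiE_iff)
    have SC1: "?S \<subseteq> C1"
      using C1(2) C1D(1) by (intro vec.span_minimal) (auto simp: PiE_iff)
    let ?I = "?S \<inter> C"
    have I: "vec.subspace ?I" using CD(1) by (simp add: vec.subspace_inter)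
    have I_lt: "vec.dim ?I < m"
    proof (rule ccontr)
      assume "\<not> vec.dim ?I < m"
      then have "?I = ?S" using I dimS by (intro vec.subspace_dim_equal) auto
      then show False using x by blast
    qed
    \<comment> \<open>A hyperplane of \<open>?S\<close> inside C lies in \<open>?I\<close>, which is
      proper in \<open>?S\<close>, so the two coincide.\<close>
    have right: "{H \<in> hyperplanes {} ?S. H \<subseteq> C} = (if vec.dim ?I + 1 = m then {?I} else {})"
    proof (rule eq_if_singletonI)
      fix H assume "H \<in> {H \<in> hyperplanes {} ?S. H \<subseteq> C}"
      then have H: "H \<in> hyperplanes {} ?S" "H \<subseteq> C" by simp_all
      have "H = ?I"
        using H I I_lt dimS by (intro vec.subspace_dim_equal) (auto simp: hyperplanes_def)
      then show "H = ?I \<and> vec.dim ?I + 1 = m" using H dimS by (simp add: hyperplanes_def)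
    qed (use I dimS in \<open>simp add: hyperplanes_def\<close>)
    have left: "{D \<in> neighbours C. c \<in> {..<m} \<rightarrow>\<^sub>E D} = (if vec.dim ?I + 1 = m then {neighbour C x} else {})"
    proof (rule eq_if_singletonI, rule conjI)
      fix D assume "D \<in> {D \<in> neighbours C. c \<in> {..<m} \<rightarrow>\<^sub>E D}"
      then have D: "D \<in> \<F>" "vec.dim (C \<inter> D) = n - 1" "c \<in> {..<m} \<rightarrow>\<^sub>E D" by simp_all
      note DD = \<F>D[OF D(1)]
      have dim: "vec.dim (C \<inter> D) + 1 = n" using D(2) dim_eq_pred_iff by blast
      have "x \<in> D" using D(3) k by (auto simp: x_def PiE_iff)
      then show "D = neighbour C x"
        using neighbour_unique(1)[OF C D(1) dim _ x(1)] by blast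
      have SD: "?S \<subseteq> D"
        using D(3) DD(1) by (intro vec.span_minimal) (auto simp: PiE_iff)
      let ?T = "{s + t |s t. s \<in> ?S \<and> t \<in> C \<inter> D}"
      \<comment> \<open>The sum \<open>?T\<close> stays inside D, of dimension n, while the
        intersection of C and D has dimension n - 1. Hence \<open>?I\<close> has dimension at least
        m - 1.\<close>
      have "vec.dim ?T + vec.dim (?S \<inter> (C \<inter> D)) = m + vec.dim (C \<inter> D)"
        using vec.dim_sums_Int[of ?S "C \<inter> D"] CD(1) DD(1) dimS by (simp add: vec.subspace_inter)
      moreover have "?T \<subseteq> D" using SD vec.subspace_add[OF DD(1)] by auto
      then have "vec.dim ?T \<le> n" using vec.dim_subset[of ?T D] DD(4) by simp
      moreover have "?S \<inter> (C \<inter> D) = ?I" using SD by auto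
      ultimately show "vec.dim ?I + 1 = m" using dim I_lt by simp
    next
      assume dimI: "vec.dim ?I + 1 = m"
      note nb = neighbour_in_\<F>[OF C x(1,4)] and p = perp_in[OF C x(1)]
      have nb': "neighbour C x \<in> neighbours C"
        using nb p dim_eq_pred_iff[of "vec.dim (perp_in C x)"] by simp
      \<comment> \<open>Both \<open>?I\<close> and x lie in \<open>C1\<close>, where all vectors are
        mutually orthogonal. So the neighbour contains \<open>?I\<close> and x, which together span
        \<open>?S\<close>.\<close>
      have "?I \<subseteq> perp_in C x"
        using SC1 x(3) C1D(5) by (auto simp: perp_in_def)
      then have "vec.span (insert x ?I) \<subseteq> neighbour C x"
        unfolding neighbour_def by (intro vec.span_mono) blast
      moreover have "vec.span (insert x ?I) = ?S"
        using I dimI dimS x by (intro span_insert_hyperplane) auto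
      ultimately have "?S \<subseteq> neighbour C x" by simp
      then have "c ` {..<m} \<subseteq> neighbour C x"
        using vec.span_superset by (rule subset_trans[rotated])
      then have "c \<in> {..<m} \<rightarrow>\<^sub>E neighbour C x"
        using C1(2) by (auto simp: PiE_iff)
      with nb' show "neighbour C x \<in> {D \<in> neighbours C. c \<in> {..<m} \<rightarrow>\<^sub>E D}" by simp
    qed
    show ?thesis unfolding left right using False by simp
  qed
qed

text \<open>
  The hyperplanes of \<open>\<langle>c\<rangle>\<close> contained in \<open>C\<close> are counted by their spanning tuples in \<open>C\<^sup>m\<close>, each
  weighted by the reciprocal of the number of spanning tuples of its span. This exhibits the
  correction term in \<open>T\<close> as a function of codewords of genus \<open>m\<close>, whose total over \<open>\<V>\<^sub>m\<close> vanishes.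
\<close>

definition spanning_tuples :: "nat \<Rightarrow> ('a ^ 'N) set \<Rightarrow> (nat \<Rightarrow> 'a ^ 'N) set" where
  "spanning_tuples m H = {d \<in> {..<m} \<rightarrow>\<^sub>E UNIV. vec.span (d ` {..<m}) = H}"

definition hyperplane_weight :: "nat \<Rightarrow> (nat \<Rightarrow> 'a ^ 'N) set \<Rightarrow> (nat \<Rightarrow> 'a ^ 'N) \<Rightarrow> complex" where
  "hyperplane_weight m S d = (\<Sum>c\<in>S. if vec.span (d ` {..<m}) \<in> hyperplanes {} (vec.span (c ` {..<Suc m}))
     then 1 / of_nat (card (spanning_tuples m (vec.span (d ` {..<m})))) else 0)"

lemma card_spanning_tuples_pos:
  assumes "vec.subspace H" "vec.dim H = m"
  shows "0 < card (spanning_tuples m H)"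
proof -
  obtain B where B: "finite B" "B \<subseteq> H" "vec.independent B" "vec.span B = H" "card B = vec.dim H"
    by (rule vec.basis_subspace_exists[OF assms(1)])
  obtain f where f: "bij_betw f {..<m} B"
    using ex_bij_betw_nat_finite[OF B(1)] B(5) assms(2) by (auto simp: lessThan_atLeast0)
  then have "restrict f {..<m} ` {..<m} = B" by (simp add: bij_betw_def)
  then have "restrict f {..<m} \<in> spanning_tuples m H"
    using B(4) by (simp add: spanning_tuples_def)
  moreover have "finite (spanning_tuples m H)"
    unfolding spanning_tuples_def by (rule finite_subset[OF Collect_restrict finite_tuples])
  ultimately show ?thesis by (auto simp: card_gt_0_iff)
qed

text \<open>Group the tuples in C by their span H. For H inside C all spanning tuples of H occur, so
  their reciprocal weights add up to 1; for other H none occurs.\<close>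

lemma sum_hyperplane_weight:
  assumes C: "vec.subspace C" and S: "finite S"
    and dim: "\<And>c. c \<in> S \<Longrightarrow> vec.dim (vec.span (c ` {..<Suc m})) = Suc m"
  shows "(\<Sum>d\<in>{..<m} \<rightarrow>\<^sub>E C. hyperplane_weight m S d) =
    (\<Sum>c\<in>S. of_nat (card {H \<in> hyperplanes {} (vec.span (c ` {..<Suc m})). H \<subseteq> C}))"
proof -
  let ?sp = "\<lambda>d :: nat \<Rightarrow> 'a ^ 'N. vec.span (d ` {..<m})"
  let ?w = "\<lambda>H. 1 / of_nat (card (spanning_tuples m H)) :: complex"
  have "(\<Sum>d\<in>{..<m} \<rightarrow>\<^sub>E C. if ?sp d \<in> \<H> then ?w (?sp d) else 0) = of_nat (card {H \<in> \<H>. H \<subseteq> C})"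
    if \<H>: "\<H> = hyperplanes {} (vec.span (c ` {..<Suc m}))" and c: "c \<in> S" for \<H> c
  proof -
    let ?T = "{d \<in> {..<m} \<rightarrow>\<^sub>E C. ?sp d \<in> \<H>}"
    have H: "vec.subspace H" "vec.dim H = m" if "H \<in> \<H>" for H
      using that dim[OF c] unfolding \<H> hyperplanes_def by auto
    have sub: "?sp d \<subseteq> C" if "d \<in> {..<m} \<rightarrow>\<^sub>E C" for d
      using that C by (intro vec.span_minimal) (auto simp: PiE_iff)
    have fib: "{d \<in> ?T. ?sp d = H} = spanning_tuples m H" if "H \<in> \<H>" "H \<subseteq> C" for H
    proof -
      have "d \<in> {..<m} \<rightarrow>\<^sub>E C" if "d \<in> spanning_tuples m H" for d
        using that \<open>H \<subseteq> C\<close> vec.span_superset[of "d ` {..<m}"]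
        by (auto simp: spanning_tuples_def PiE_iff)
      then show ?thesis using that(1) by (auto simp: spanning_tuples_def PiE_iff)
    qed
    have "(\<Sum>d\<in>{..<m} \<rightarrow>\<^sub>E C. if ?sp d \<in> \<H> then ?w (?sp d) else 0) = (\<Sum>d\<in>?T. ?w (?sp d))"
      by (simp add: sum.inter_filter finite_tuples)
    also have "\<dots> = (\<Sum>H\<in>{H \<in> \<H>. H \<subseteq> C}. \<Sum>d\<in>{d \<in> ?T. ?sp d = H}. ?w (?sp d))"
    proof (rule sum.group[symmetric])
      show "finite ?T" by (rule finite_subset[OF Collect_restrict finite_tuples])
      show "?sp ` ?T \<subseteq> {H \<in> \<H>. H \<subseteq> C}" using sub by auto
    qed simp
    also have "\<dots> = (\<Sum>H\<in>{H \<in> \<H>. H \<subseteq> C}. \<Sum>d\<in>spanning_tuples m H. ?w H)"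
    proof (rule sum.cong[OF refl])
      fix H assume "H \<in> {H \<in> \<H>. H \<subseteq> C}"
      then show "(\<Sum>d\<in>{d \<in> ?T. ?sp d = H}. ?w (?sp d)) = (\<Sum>d\<in>spanning_tuples m H. ?w H)"
        using fib by (intro sum.cong) (auto simp: spanning_tuples_def)
    qed
    also have "\<dots> = (\<Sum>H\<in>{H \<in> \<H>. H \<subseteq> C}. 1)"
      using card_spanning_tuples_pos H by (intro sum.cong refl) (auto simp: less_imp_neq[symmetric] dest!: H)
    finally show ?thesis by simp
  qed
  then show ?thesis
    unfolding hyperplane_weight_def by (subst sum.swap) simp
qed

lemma card_spanning_tuples_perm:
  assumes "bij \<pi>" shows "card (spanning_tuples m (perm \<pi> ` H)) = card (spanning_tuples m H)"
proof -
  have inj: "inj (perm \<pi> :: 'a ^ 'N \<Rightarrow> _)" using bij_perm[OF assms] by (rule bij_is_inj)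
  have img: "(\<lambda>k\<in>{..<m}. perm \<pi> (d k)) ` {..<m} = perm \<pi> ` d ` {..<m}" for d :: "nat \<Rightarrow> 'a ^ 'N"
    by auto
  have "vec.span ((\<lambda>k\<in>{..<m}. perm \<pi> (d k)) ` {..<m}) = perm \<pi> ` H \<longleftrightarrow> vec.span (d ` {..<m}) = H" for d
    unfolding img span_perm using inj by (simp add: inj_image_eq_iff)
  then show ?thesis
    unfolding spanning_tuples_def
    by (intro bij_betw_same_card[symmetric, OF bij_betw_tuples_UNIV[OF assms]])
qed

lemma hyperplanes_perm:
  fixes H W :: "('a ^ 'N) set"
  assumes "bij \<pi>" shows "perm \<pi> ` H \<in> hyperplanes {} (perm \<pi> ` W) \<longleftrightarrow> H \<in> hyperplanes {} W"
proof -
  have inj: "inj (perm \<pi> :: 'a ^ 'N \<Rightarrow> _)" using bij_perm[OF assms] by (rule bij_is_inj)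
  have "vec.subspace (perm \<pi> ` H) \<longleftrightarrow> vec.subspace H"
    unfolding vec.span_eq_iff[symmetric] span_perm using inj by (simp add: inj_image_eq_iff)
  then show ?thesis
    using inj by (simp add: hyperplanes_def dim_perm[OF assms] inj_image_subset_iff)
qed

text \<open>A permutation carrying \<open>d\<close> to \<open>e\<close> maps the set
  \<open>S\<close> of all tuples with monomial \<open>X\<close> bijectively to itself, and
  hyperplanes and numbers of spanning tuples are preserved. This is the invariance that
  \<open>V_space_sum_eq_0\<close> asks for.\<close>

lemma hyperplane_weight_perm:
  fixes X :: "'a monomial" and m :: nat
  defines "S \<equiv> {c \<in> {..<Suc m} \<rightarrow>\<^sub>E UNIV. mon (Suc m) c = X}"
  assumes "mon m d = mon m e"
  shows "hyperplane_weight m S d = hyperplane_weight m S e"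
proof -
  obtain \<pi> where \<pi>: "bij \<pi>" "\<forall>k<m. e k = perm \<pi> (d k)"
    using assms(2) unfolding mon_eq_iff by blast
  let ?h = "\<lambda>c. \<lambda>k\<in>{..<Suc m}. perm \<pi> (c k) :: 'a ^ 'N"
  have bij: "bij_betw ?h S S"
    unfolding S_def by (rule bij_betw_tuples_UNIV[OF \<pi>(1)]) (simp only: mon_perm[OF \<pi>(1)])
  have img: "?h c ` {..<Suc m} = perm \<pi> ` c ` {..<Suc m}" for c by auto
  have "e ` {..<m} = perm \<pi> ` d ` {..<m}" using \<pi>(2) by (auto simp: image_iff)
  then have e: "vec.span (e ` {..<m}) = perm \<pi> ` vec.span (d ` {..<m})"
    by (simp only: span_perm)
  have "hyperplane_weight m S e = (\<Sum>c\<in>S. if vec.span (e ` {..<m}) \<in> hyperplanes {} (vec.span (?h c ` {..<Suc m}))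
     then 1 / of_nat (card (spanning_tuples m (vec.span (e ` {..<m})))) else 0)"
    unfolding hyperplane_weight_def by (rule sum.reindex_bij_betw[OF bij, symmetric])
  also have "\<dots> = hyperplane_weight m S d"
    unfolding hyperplane_weight_def img e span_perm hyperplanes_perm[OF \<pi>(1)]
      card_spanning_tuples_perm[OF \<pi>(1)] by simp
  finally show ?thesis by simp
qed

definition eigenvalue :: "nat \<Rightarrow> real" where
  "eigenvalue m = alpha m - (real CARD('a) ^ m - 1) / (real CARD('a) - 1)"

lemma sum_neighbours_count:
  fixes m :: nat and c0 :: "nat \<Rightarrow> 'a ^ 'N"
  assumes C: "C \<in> \<F>" and ind: "indep_mod u m c0" and C1: "C1 \<in> \<F>" "c0 \<in> {..<m} \<rightarrow>\<^sub>E C1"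
  defines "S \<equiv> {c \<in> {..<m} \<rightarrow>\<^sub>E UNIV. mon m c = mon m c0}"
  shows "(\<Sum>D\<in>neighbours C. real (card {c \<in> {..<m} \<rightarrow>\<^sub>E D. mon m c = mon m c0})) =
    eigenvalue m * real (card {c \<in> {..<m} \<rightarrow>\<^sub>E C. mon m c = mon m c0}) +
    (\<Sum>c\<in>S. real (card {H \<in> hyperplanes {} (vec.span (c ` {..<m})). H \<subseteq> C}))"
proof -
  have fin: "finite S"
    unfolding S_def by (rule finite_subset[OF Collect_restrict finite_tuples])
  have S: "{c \<in> {..<m} \<rightarrow>\<^sub>E D. mon m c = mon m c0} = {c \<in> S. c \<in> {..<m} \<rightarrow>\<^sub>E D}" for D
    unfolding S_def by (auto simp: PiE_iff)
  have count: "real (card {c \<in> S. c \<in> {..<m} \<rightarrow>\<^sub>E D}) = (\<Sum>c\<in>S. if c \<in> {..<m} \<rightarrow>\<^sub>E D then 1 else 0)" for D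
    using fin by (simp add: sum.If_cases Int_def)
  \<comment> \<open>A tuple with the monomial of \<open>c0\<close> is a permuted copy of
    \<open>c0\<close> and so lies in a permuted copy of \<open>C1\<close>, as
    \<open>card_neighbours_containing'\<close> requires.\<close>
  have good: "indep_mod u m c \<and> (\<exists>C2\<in>\<F>. c \<in> {..<m} \<rightarrow>\<^sub>E C2)" if c: "c \<in> S" for c
  proof
    have "mon m c0 = mon m c" using c by (simp add: S_def)
    then obtain \<pi> where \<pi>: "bij \<pi>" "\<forall>k<m. c k = perm \<pi> (c0 k)"
      unfolding mon_eq_iff by blast
    show "indep_mod u m c"
      using indep_mod_mon_cong[of m c0 c] c ind by (simp add: S_def)
    have "c \<in> {..<m} \<rightarrow>\<^sub>E perm \<pi> ` C1"
      using c C1(2) \<pi>(2) by (auto simp: S_def PiE_iff)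
    then show "\<exists>C2\<in>\<F>. c \<in> {..<m} \<rightarrow>\<^sub>E C2" using \<F>_perm[OF \<pi>(1) C1(1)] by blast
  qed
  have "(\<Sum>D\<in>neighbours C. real (card {c \<in> {..<m} \<rightarrow>\<^sub>E D. mon m c = mon m c0})) =
      (\<Sum>c\<in>S. \<Sum>D\<in>neighbours C. if c \<in> {..<m} \<rightarrow>\<^sub>E D then 1 else 0)"
    unfolding S count by (rule sum.swap)
  also have "\<dots> = (\<Sum>c\<in>S. real (card {D \<in> neighbours C. c \<in> {..<m} \<rightarrow>\<^sub>E D}))"
    by (simp add: sum.If_cases Int_def)
  also have "\<dots> = (\<Sum>c\<in>S. (if c \<in> {..<m} \<rightarrow>\<^sub>E C then eigenvalue m else 0) +
      real (card {H \<in> hyperplanes {} (vec.span (c ` {..<m})). H \<subseteq> C}))"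
  proof (rule sum.cong[OF refl])
    fix c assume "c \<in> S"
    then obtain C2 where "indep_mod u m c" "C2 \<in> \<F>" "c \<in> {..<m} \<rightarrow>\<^sub>E C2" using good by blast
    then show "real (card {D \<in> neighbours C. c \<in> {..<m} \<rightarrow>\<^sub>E D}) = (if c \<in> {..<m} \<rightarrow>\<^sub>E C then eigenvalue m else 0) +
        real (card {H \<in> hyperplanes {} (vec.span (c ` {..<m})). H \<subseteq> C})"
      unfolding eigenvalue_def by (rule card_neighbours_containing'[OF C])
  qed
  also have "\<dots> = eigenvalue m * (\<Sum>c\<in>S. if c \<in> {..<m} \<rightarrow>\<^sub>E C then 1 else 0) +
      (\<Sum>c\<in>S. real (card {H \<in> hyperplanes {} (vec.span (c ` {..<m})). H \<subseteq> C}))"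
    unfolding sum.distrib sum_distrib_left by (intro arg_cong2[where f = "(+)"] sum.cong refl) simp
  finally show ?thesis unfolding S count .
qed

text \<open>In \<open>sum_neighbours_count\<close>, summed over the classes with the coefficients of
  \<open>v\<close>, the hyperplane term is a sum over (m-1)-tuples that depends only on their
  monomials, and so vanishes.\<close>

lemma mon_coeff_kneser_hecke_eigen:
  assumes v: "v \<in> V_space \<F> (int m - 1)" and ind: "indep_mod u m c0"
  shows "mon_coeff \<F> m (mon m c0) (kneser_hecke n \<F> v) = of_real (eigenvalue m) * mon_coeff \<F> m (mon m c0) v"
proof (cases "\<exists>C\<in>\<F>. \<exists>c\<in>{..<m} \<rightarrow>\<^sub>E C. mon m c = mon m c0")
  \<comment> \<open>The count requires some code containing a tuple with this monomial. If there is
    none, the coefficient functional is identically zero.\<close>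
  case False
  then have "{c \<in> {..<m} \<rightarrow>\<^sub>E C. mon m c = mon m c0} = {}" if "C \<in> \<F>" for C
    using that by blast
  then have "mon_coeff \<F> m (mon m c0) w = 0" for w
    unfolding mon_coeff_def
    by (intro sum.neutral ballI) (simp only: rep_in_family card.empty of_nat_0 mult_zero_right)
  then show ?thesis by simp
next
  case True
  then obtain C1 c1 where C1: "C1 \<in> \<F>" "c1 \<in> {..<m} \<rightarrow>\<^sub>E C1" and c1: "mon m c1 = mon m c0" by blast
  have ind1: "indep_mod u m c1"
    using indep_mod_mon_cong[OF c1] ind by simp
  define S where "S = {c \<in> {..<m} \<rightarrow>\<^sub>E (UNIV :: ('a ^ 'N) set). mon m c = mon m c0}"
  let ?R = "\<lambda>C. \<Sum>c\<in>S. card {H \<in> hyperplanes {} (vec.span (c ` {..<m})). H \<subseteq> C}"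
  have eq: "(\<Sum>D\<in>neighbours C. of_nat (card {c \<in> {..<m} \<rightarrow>\<^sub>E D. mon m c = mon m c0})) =
      (of_real (eigenvalue m) * of_nat (card {c \<in> {..<m} \<rightarrow>\<^sub>E C. mon m c = mon m c0}) + of_nat (?R C) :: complex)"
    if "C \<in> \<F>" for C
    using arg_cong[OF sum_neighbours_count[OF that ind1 C1], of complex_of_real]
    by (simp add: c1 S_def)
  have "mon_coeff \<F> m (mon m c0) (kneser_hecke n \<F> v) =
      (\<Sum>K\<in>code_class ` \<F>. Poly_Mapping.lookup v K * (of_real (eigenvalue m) *
        of_nat (card {c \<in> {..<m} \<rightarrow>\<^sub>E rep \<F> K. mon m c = mon m c0}) + of_nat (?R (rep \<F> K))))"
    unfolding mon_coeff_kneser_hecke using eq[OF rep_in_family] by (intro sum.cong refl) (simp only:)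
  also have "\<dots> = of_real (eigenvalue m) * mon_coeff \<F> m (mon m c0) v +
      (\<Sum>K\<in>code_class ` \<F>. Poly_Mapping.lookup v K * of_nat (?R (rep \<F> K)))"
    by (simp add: mon_coeff_def distrib_left sum.distrib sum_distrib_left mult_ac)
  also have "(\<Sum>K\<in>code_class ` \<F>. Poly_Mapping.lookup v K * of_nat (?R (rep \<F> K))) = 0"
  proof (cases m)
    \<comment> \<open>There are no tuples of length -1 to sum over, but the zero space has no
      hyperplanes.\<close>
    case 0
    have "hyperplanes {} (vec.span ({} :: ('a ^ 'N) set)) = {}" by (simp add: hyperplanes_def)
    then have "?R C = 0" for C using 0 by simp
    then show ?thesis by simp
  next
    case (Suc m')
    have "finite S" unfolding S_def by (rule finite_subset[OF Collect_restrict finite_tuples])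
    moreover have "vec.dim (vec.span (c ` {..<Suc m'})) = Suc m'" if c: "c \<in> S" for c
      using dim_span_indep_mod[of u m c] indep_mod_mon_cong[of m c0 c] c ind by (simp add: S_def Suc)
    ultimately have "(\<Sum>d\<in>{..<m'} \<rightarrow>\<^sub>E C. hyperplane_weight m' S d) = of_nat (?R C)" if "C \<in> \<F>" for C
      using sum_hyperplane_weight[OF \<F>D(1)[OF that], of S m'] by (simp add: Suc)
    from this[OF rep_in_family]
    have "(\<Sum>K\<in>code_class ` \<F>. Poly_Mapping.lookup v K * of_nat (?R (rep \<F> K))) =
        (\<Sum>K\<in>code_class ` \<F>. Poly_Mapping.lookup v K * (\<Sum>d\<in>{..<m'} \<rightarrow>\<^sub>E rep \<F> K. hyperplane_weight m' S d))"
      by (intro sum.cong refl) (simp only:)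
    also have "\<dots> = 0"
    proof (rule V_space_sum_eq_0)
      show "v \<in> V_space \<F> (int m')" using v Suc by simp
      fix c d :: "nat \<Rightarrow> 'a ^ 'N" assume "mon m' c = mon m' d"
      then show "hyperplane_weight m' S c = hyperplane_weight m' S d"
        unfolding S_def Suc by (rule hyperplane_weight_perm)
    qed
    finally show ?thesis .
  qed
  finally show ?thesis by simp
qed

lemma V_space_neg: "j < 0 \<Longrightarrow> V_space \<F> j = class_space \<F>"
  by (simp add: V_space_def)

lemma V_space_subset_class_space: "V_space \<F> j \<subseteq> class_space \<F>"
  by (auto simp: V_space_def)

text \<open>By induction along the filtration: for v in the next smaller space, T v stays in the
  present one, and its independent coefficients are multiples of those of v, which are zero.
  \<open>V_spaceI\<close> needs no more.\<close>

lemma kneser_hecke_V_space: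
  assumes "v \<in> V_space \<F> (int m - 1)"
  shows "kneser_hecke n \<F> v \<in> V_space \<F> (int m - 1)"
  using assms
proof (induction m arbitrary: v)
  case 0
  then show ?case using kneser_hecke_in_class_space by (simp add: V_space_neg)
next
  case (Suc m)
  have v: "v \<in> V_space \<F> (int m)" using Suc.prems by simp
  have v': "v \<in> V_space \<F> (int m - 1)" using v by (rule V_space_subset_pred)
  have "kneser_hecke n \<F> v \<in> V_space \<F> (int m)"
  proof (rule V_spaceI)
    show "kneser_hecke n \<F> v \<in> V_space \<F> (int m - 1)" using v' by (rule Suc.IH)
    fix c assume "indep_mod u m c"
    then show "mon_coeff \<F> m (mon m c) (kneser_hecke n \<F> v) = 0"
      using mon_coeff_kneser_hecke_eigen[OF v'] v by (simp add: V_space_iff)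
  qed
  then show ?case by simp
qed

section \<open>Self-adjointness of T and the eigenvalue on \<Y>_m\<close>

text \<open>Orbit and stabiliser: the permutations taking C to a given code of its class form a
  coset of \<open>Aut C\<close>.\<close>

lemma card_Aut_mult:
  assumes C: "C \<in> \<F>"
  shows "card (Aut C) * card {D \<in> \<F>. vec.dim (R \<inter> D) = n - 1 \<and> code_class D = code_class C} =
    card {\<pi>. bij \<pi> \<and> vec.dim (R \<inter> perm \<pi> ` C) = n - 1}"
proof -
  let ?A = "{\<pi> :: 'N \<Rightarrow> 'N. bij \<pi> \<and> vec.dim (R \<inter> perm \<pi> ` C) = n - 1}"
  let ?B = "{D \<in> \<F>. vec.dim (R \<inter> D) = n - 1 \<and> code_class D = code_class C}"
  have "card {\<pi> \<in> ?A. perm \<pi> ` C = D} = card (Aut C)" if "D \<in> ?B" for D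
  proof -
    have "D \<in> code_class C" using that mem_code_class[of D] by simp
    then obtain \<rho> where \<rho>: "bij \<rho>" "D = perm \<rho> ` C" by (auto simp: code_class_def)
    have "bij_betw (\<lambda>\<sigma>. \<rho> \<circ> \<sigma>) (Aut C) {\<pi> \<in> ?A. perm \<pi> ` C = D}"
    proof (rule bij_betw_byWitness[where f' = "\<lambda>\<pi>. inv \<rho> \<circ> \<pi>"])
      have [simp]: "inv \<rho> (\<rho> i) = i" "\<rho> (inv \<rho> i) = i" for i
        using \<rho>(1) by (simp_all add: bij_is_inj bij_is_surj surj_f_inv_f)
      show "\<forall>\<sigma>\<in>Aut C. inv \<rho> \<circ> (\<rho> \<circ> \<sigma>) = \<sigma>" "\<forall>\<pi>\<in>{\<pi> \<in> ?A. perm \<pi> ` C = D}. \<rho> \<circ> (inv \<rho> \<circ> \<pi>) = \<pi>"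
        by (auto simp: fun_eq_iff)
      have comp: "perm (\<rho>' \<circ> \<sigma>) ` C = perm \<rho>' ` perm \<sigma> ` C" if "bij \<rho>'" "bij \<sigma>" for \<rho>' \<sigma>
        using that by (simp add: image_image perm_comp)
      show "(\<lambda>\<sigma>. \<rho> \<circ> \<sigma>) ` Aut C \<subseteq> {\<pi> \<in> ?A. perm \<pi> ` C = D}"
      proof (rule image_subsetI)
        fix \<sigma> assume "\<sigma> \<in> Aut C"
        then have \<sigma>: "bij \<sigma>" "perm \<sigma> ` C = C" by (auto simp: Aut_def)
        have "perm (\<rho> \<circ> \<sigma>) ` C = D" using comp[OF \<rho>(1) \<sigma>(1)] \<sigma>(2) \<rho>(2) by simp
        then show "\<rho> \<circ> \<sigma> \<in> {\<pi> \<in> ?A. perm \<pi> ` C = D}"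
          using that bij_comp[OF \<sigma>(1) \<rho>(1)] by simp
      qed
      show "(\<lambda>\<pi>. inv \<rho> \<circ> \<pi>) ` {\<pi> \<in> ?A. perm \<pi> ` C = D} \<subseteq> Aut C"
      proof (rule image_subsetI)
        fix \<pi> assume "\<pi> \<in> {\<pi> \<in> ?A. perm \<pi> ` C = D}"
        then have \<pi>: "bij \<pi>" "perm \<pi> ` C = D" by auto
        have "perm (inv \<rho> \<circ> \<pi>) ` C = perm (inv \<rho>) ` perm \<rho> ` C"
          using comp[OF bij_imp_bij_inv[OF \<rho>(1)] \<pi>(1)] \<pi>(2) \<rho>(2) by simp
        also have "\<dots> = C" using \<rho>(1) by (simp add: image_image)
        finally show "inv \<rho> \<circ> \<pi> \<in> Aut C"
          using bij_comp[OF \<pi>(1) bij_imp_bij_inv[OF \<rho>(1)]] by (simp add: Aut_def)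
      qed
    qed
    then show ?thesis by (rule bij_betw_same_card[symmetric])
  qed
  then have "(\<Sum>D\<in>?B. card {\<pi> \<in> ?A. perm \<pi> ` C = D}) = card ?B * card (Aut C)"
    by simp
  moreover have "(\<Sum>D\<in>?B. \<Sum>\<pi>\<in>{\<pi> \<in> ?A. perm \<pi> ` C = D}. 1) = (\<Sum>\<pi>\<in>?A. 1 :: nat)"
  proof (rule sum.group)
    show "(\<lambda>\<pi>. perm \<pi> ` C) ` ?A \<subseteq> ?B"
      by (rule image_subsetI) (simp add: \<F>_perm C code_class_perm)
  qed simp_all
  ultimately show ?thesis by (simp add: mult.commute)
qed

text \<open>Inverting the permutation exchanges the two codes.\<close>

lemma card_perm_neighbours_commute:
  "card {\<pi> :: 'N \<Rightarrow> 'N. bij \<pi> \<and> vec.dim (R \<inter> perm \<pi> ` C) = n - 1} =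
   card {\<pi> :: 'N \<Rightarrow> 'N. bij \<pi> \<and> vec.dim (C \<inter> perm \<pi> ` (R :: ('a ^ 'N) set)) = n - 1}"
proof (rule bij_betw_same_card, rule bij_betw_byWitness[where f = inv and f' = inv])
  have dim: "vec.dim (B \<inter> perm (inv \<pi>) ` A) = vec.dim (A \<inter> perm \<pi> ` B)"
    if "bij \<pi>" for \<pi> :: "'N \<Rightarrow> 'N" and A B :: "('a ^ 'N) set"
  proof -
    have "perm \<pi> ` (B \<inter> perm (inv \<pi>) ` A) = perm \<pi> ` B \<inter> perm \<pi> ` perm (inv \<pi>) ` A"
      using bij_is_inj[OF bij_perm[OF that]] by (rule image_Int)
    also have "perm \<pi> ` perm (inv \<pi>) ` A = A" using that by (simp add: image_image)
    finally show ?thesis using dim_perm[OF that, of "B \<inter> perm (inv \<pi>) ` A"] by (simp add: Int_commute)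
  qed
  show "inv ` {\<pi> :: 'N \<Rightarrow> 'N. bij \<pi> \<and> vec.dim (R \<inter> perm \<pi> ` C) = n - 1} \<subseteq>
      {\<pi>. bij \<pi> \<and> vec.dim (C \<inter> perm \<pi> ` R) = n - 1}"
    "inv ` {\<pi> :: 'N \<Rightarrow> 'N. bij \<pi> \<and> vec.dim (C \<inter> perm \<pi> ` R) = n - 1} \<subseteq>
      {\<pi>. bij \<pi> \<and> vec.dim (R \<inter> perm \<pi> ` C) = n - 1}"
    using dim by (auto simp: bij_imp_bij_inv)
qed (auto simp: inv_inv_eq)

text \<open>The matrix of T is not symmetric in the basis of classes, but each entry times the order
  of the automorphism group counts permutations bringing one code next to the other, and that count
  is symmetric. The scalar product carries exactly these orders as weights.\<close>

lemma kneser_hecke_self_adjoint: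
  "class_inner \<F> w (kneser_hecke n \<F> v) = class_inner \<F> (kneser_hecke n \<F> w) v"
proof -
  let ?I = "code_class ` \<F>"
  let ?A = "\<lambda>L K. card {D \<in> \<F>. vec.dim (rep \<F> L \<inter> D) = n - 1 \<and> code_class D = K}"
  let ?a = "\<lambda>K. card (Aut (rep \<F> K))"
  have count: "?a K * ?A L K = card {\<pi>. bij \<pi> \<and> vec.dim (rep \<F> L \<inter> perm \<pi> ` rep \<F> K) = n - 1}"
    if "K \<in> ?I" for K L
    using card_Aut_mult[OF rep_in_family[OF that], of "rep \<F> L"] unfolding code_class_rep[OF that] .
  have sym: "?a K * ?A L K = ?a L * ?A K L" if "K \<in> ?I" "L \<in> ?I" for K L
    unfolding count[OF that(1)] count[OF that(2)] by (rule card_perm_neighbours_commute)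
  have "class_inner \<F> w (kneser_hecke n \<F> v) =
      (\<Sum>K\<in>?I. \<Sum>L\<in>?I. Poly_Mapping.lookup w K * cnj (Poly_Mapping.lookup v L) * of_nat (?a K * ?A L K))"
    unfolding class_inner_def lookup_kneser_hecke cnj_sum sum_distrib_left
    by (intro sum.cong refl) simp
  also have "\<dots> = (\<Sum>K\<in>?I. \<Sum>L\<in>?I. Poly_Mapping.lookup w K * cnj (Poly_Mapping.lookup v L) * of_nat (?a L * ?A K L))"
    by (intro sum.cong refl) (simp only: sym)
  also have "\<dots> = (\<Sum>L\<in>?I. \<Sum>K\<in>?I. Poly_Mapping.lookup w K * cnj (Poly_Mapping.lookup v L) * of_nat (?a L * ?A K L))"
    by (rule sum.swap)
  also have "\<dots> = class_inner \<F> (kneser_hecke n \<F> w) v"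
    unfolding class_inner_def lookup_kneser_hecke sum_distrib_left sum_distrib_right
    by (intro sum.cong refl) simp
  finally show ?thesis .
qed

lemma class_inner_definite:
  assumes "v \<in> class_space \<F>" "class_inner \<F> v v = 0"
  shows "v = 0"
proof (rule poly_mapping_eqI)
  fix K
  let ?f = "\<lambda>K. real (card (Aut (rep \<F> K))) * (cmod (Poly_Mapping.lookup v K))\<^sup>2"
  have "class_inner \<F> v v = of_real (\<Sum>K\<in>code_class ` \<F>. ?f K)"
    unfolding class_inner_def of_real_sum
    by (intro sum.cong refl) (simp only: of_real_mult of_real_of_nat_eq complex_norm_square mult.assoc)
  then have "complex_of_real (\<Sum>K\<in>code_class ` \<F>. ?f K) = 0"
    unfolding assms(2) by (rule sym)
  then have "(\<Sum>K\<in>code_class ` \<F>. ?f K) = 0" by (simp only: of_real_eq_0_iff)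
  then have 0: "\<forall>K\<in>code_class ` \<F>. ?f K = 0"
    by (rule sum_nonneg_eq_0_iff[THEN iffD1, rotated 2]) simp_all
  have "id \<in> Aut (rep \<F> K)" by (simp add: Aut_def)
  then have "card (Aut (rep \<F> K)) \<noteq> 0" by (metis card_eq_0_iff empty_iff finite)
  then have Aut: "real (card (Aut (rep \<F> K))) \<noteq> 0" by simp
  show "Poly_Mapping.lookup v K = Poly_Mapping.lookup 0 K"
  proof (cases "K \<in> code_class ` \<F>")
    case True
    then have "?f K = 0" using 0 by blast
    then show ?thesis using Aut by (simp only: mult_eq_0_iff) simp
  next
    case False
    then show ?thesis using assms(1) class_space_iff by (metis lookup_zero)
  qed
qed

lemma class_inner_diff_left: "class_inner \<F> (x - y) z = class_inner \<F> x z - class_inner \<F> y z"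
  by (simp add: class_inner_def lookup_minus algebra_simps sum_subtractf)

lemma class_inner_scale_left: "class_inner \<F> (scale a x) z = a * class_inner \<F> x z"
  by (simp add: class_inner_def sum_distrib_left mult_ac)

text \<open>Let w be T v minus the claimed multiple of v. The coefficient formula puts w into
  \<V>_m, and then T w as well. As v is orthogonal to \<V>_m, (w, w) = (T v, w) = (v, T w) =
  0.\<close>

lemma kneser_hecke_Y_space:
  assumes v: "v \<in> Y_space \<F> (int m)"
  shows "kneser_hecke n \<F> v = scale (of_real (eigenvalue m)) v"
proof -
  let ?T = "kneser_hecke n \<F>"
  have W: "v \<in> W_space \<F> (int m)" and V: "v \<in> V_space \<F> (int m - 1)"
    using v by (simp_all add: Y_space_def)
  define w where "w = ?T v - scale (of_real (eigenvalue m)) v"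
  have cl: "x - scale a y \<in> class_space \<F>" if "x \<in> class_space \<F>" "y \<in> class_space \<F>" for x y a
    using that by (simp add: class_space_iff lookup_minus)
  have minus: "mon_coeff \<F> k X (x - scale a y) = mon_coeff \<F> k X x - a * mon_coeff \<F> k X y" for k X x a y
    by (simp add: mon_coeff_def lookup_minus algebra_simps sum_subtractf sum_distrib_left)
  have TV: "?T v \<in> V_space \<F> (int m - 1)" using V by (rule kneser_hecke_V_space)
  have cl_w: "w \<in> class_space \<F>"
    unfolding w_def using V V_space_subset_class_space kneser_hecke_in_class_space by (intro cl) auto
  have "w \<in> V_space \<F> (int m - 1)"
  proof (cases m)
    case 0
    then show ?thesis using cl_w by (simp add: V_space_neg)
  next
    case (Suc m')
    then show ?thesis
      using cl_w V TV V_space_iff[of _ \<F> m'] by (simp add: w_def minus)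
  qed
  then have wV: "w \<in> V_space \<F> (int m)"
    by (rule V_spaceI) (simp add: w_def minus mon_coeff_kneser_hecke_eigen[OF V])
  have "class_inner \<F> (?T v) w = class_inner \<F> v (?T w)"
    by (rule kneser_hecke_self_adjoint[symmetric])
  \<comment> \<open>The invariance lemma is indexed by m - 1, so it is applied at
    \<open>Suc m\<close> to reach \<V>_m.\<close>
  also have "\<dots> = 0"
    using W kneser_hecke_V_space[of w "Suc m"] wV by (simp add: W_space_def)
  finally have "class_inner \<F> w w = 0"
    using W wV by (simp add: w_def class_inner_diff_left class_inner_scale_left W_space_def)
  then have "w = 0" using cl_w by (rule class_inner_definite[rotated])
  then show ?thesis by (simp add: w_def)
qed

end

section \<open>The six types\<close>

context code_setting
begin

lemma V_space_eq:
  assumes "\<And>c. mon m c \<in> M \<longleftrightarrow> indep_mod u m c"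
  shows "V_space \<F> (int m) = {v \<in> V_space \<F> (int m - 1). \<forall>X\<in>M. mon_coeff \<F> m X v = 0}"
proof (intro equalityI subsetI CollectI conjI)
  fix v assume v: "v \<in> V_space \<F> (int m)"
  then show "v \<in> V_space \<F> (int m - 1)" by (rule V_space_subset_pred)
  show "\<forall>X\<in>M. mon_coeff \<F> m X v = 0" using v V_space_iff by blast
next
  fix v assume v: "v \<in> {v \<in> V_space \<F> (int m - 1). \<forall>X\<in>M. mon_coeff \<F> m X v = 0}"
  show "v \<in> V_space \<F> (int m)"
  proof (rule V_spaceI)
    show "v \<in> V_space \<F> (int m - 1)" using v by blast
    show "mon_coeff \<F> m (mon m c) v = 0" if "indep_mod u m c" for c
      using v assms[of c] that by blast
  qed
qed

text \<open>
  For \<open>u \<noteq> 0\<close> and \<open>m = n\<close> no tuple of codewords is independent modulo \<open>u\<close>. Then \<open>\<V>\<^sub>n = \<V>\<^sub>n\<^sub>-\<^sub>1\<close>,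
  so any number is an eigenvalue of \<open>T\<close> on \<open>\<Y>\<^sub>n = 0\<close>.
\<close>

lemma Y_space_trivial:
  assumes "n < m + (if u = 0 then 0 else 1)" "v \<in> Y_space \<F> (int m)"
  shows "v = 0"
proof (rule class_inner_definite)
  have W: "v \<in> W_space \<F> (int m)" and V: "v \<in> V_space \<F> (int m - 1)"
    using assms(2) by (simp_all add: Y_space_def)
  show "v \<in> class_space \<F>" using V V_space_subset_class_space by blast
  have "v \<in> V_space \<F> (int m)"
    using V
  proof (rule V_spaceI)
    fix c assume ind: "indep_mod u m c"
    show "mon_coeff \<F> m (mon m c) v = 0"
      unfolding mon_coeff_def
    proof (intro sum.neutral ballI)
      fix K assume "K \<in> code_class ` \<F>"
      then have R: "rep \<F> K \<in> \<F>" by (rule rep_in_family)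
      have "mon m d \<noteq> mon m c" if "d \<in> {..<m} \<rightarrow>\<^sub>E rep \<F> K" for d
        using sum_num_neighbours(2)[OF R that] assms(1) ind indep_mod_mon_cong[of m c d] by force
      then have "{d \<in> {..<m} \<rightarrow>\<^sub>E rep \<F> K. mon m d = mon m c} = {}" by blast
      then show "Poly_Mapping.lookup v K * of_nat (card {d \<in> {..<m} \<rightarrow>\<^sub>E rep \<F> K. mon m d = mon m c}) = 0"
        by (simp only: card.empty of_nat_0 mult_zero_right)
    qed
  qed
  then show "class_inner \<F> v v = 0" using W by (simp add: W_space_def)
qed

text \<open>\<open>A\<close> has to be the true count only in the range where independent tuples of
  codewords can exist. Beyond it the second claim is vacuous and the last one concerns the zero
  space.\<close>

lemma kneser_hecke_spectrum:
  assumes M: "\<And>c. mon m c \<in> M \<longleftrightarrow> indep_mod u m c"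
    and A: "m + (if u = 0 then 0 else 1) \<le> n \<Longrightarrow> alpha m = A"
    and B: "B = A - (real CARD('a) ^ m - 1) / (real CARD('a) - 1)"
  shows
    "V_space \<F> (int m) = {v \<in> V_space \<F> (int m - 1). \<forall>X \<in> M. mon_coeff \<F> m X v = 0}
     \<and> (\<forall>C\<in>\<F>. \<forall>c \<in> {..<m} \<rightarrow>\<^sub>E C. mon m c \<in> M \<longrightarrow>
          real (\<Sum>E\<in>hyperplanes_through n m C c. num_neighbours \<F> E C) = A)
     \<and> B = A - (real (CARD('a)) ^ m - 1) / (real (CARD('a)) - 1)
     \<and> (\<forall>v \<in> Y_space \<F> (int m). kneser_hecke n \<F> v = scale (of_real B) v)"
proof (intro conjI ballI impI V_space_eq M B)
  fix C c assume "C \<in> \<F>" "c \<in> {..<m} \<rightarrow>\<^sub>E C" "mon m c \<in> M"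
  then show "real (\<Sum>E\<in>hyperplanes_through n m C c. num_neighbours \<F> E C) = A"
    using sum_num_neighbours[of C c m] M A by simp
next
  fix v assume v: "v \<in> Y_space \<F> (int m)"
  show "kneser_hecke n \<F> v = scale (of_real B) v"
  proof (cases "m + (if u = 0 then 0 else 1) \<le> n")
    case True
    then have "B = eigenvalue m" using A B by (simp add: eigenvalue_def)
    then show ?thesis using kneser_hecke_Y_space[OF v] by simp
  next
    case False
    then have "v = 0" using Y_space_trivial[OF _ v] by (simp only: not_le)
    then show ?thesis by (simp add: kneser_hecke_def)
  qed
qed

end

lemma two_eq_0_iff: "(2 :: 'a::{field,finite}) = 0 \<longleftrightarrow> even CARD('a)"
proof -
  have p: "prime CHAR('a)" by (rule char_finite_field_prime)
  obtain k where k: "CARD('a) = CHAR('a) ^ k" using card_eq_power_CHAR by blast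
  have "k \<noteq> 0" using k one_less_card_field[where 'a='a] by (cases k) auto
  then have "even CARD('a) \<longleftrightarrow> even CHAR('a)" unfolding k by simp
  also have "\<dots> \<longleftrightarrow> CHAR('a) = 2" using p by (metis dvd_refl primes_dvd_imp_eq two_is_prime_nat)
  also have "\<dots> \<longleftrightarrow> CHAR('a) dvd 2"
    using p by (metis dvd_refl primes_dvd_imp_eq two_is_prime_nat)
  also have "\<dots> \<longleftrightarrow> (2 :: 'a) = 0"
    using of_nat_eq_0_iff_char_dvd[of 2, where 'a='a] by simp
  finally show ?thesis by simp
qed

lemma euclidean_form_eq: "euclidean_form = sesq (\<lambda>x. x)"
  by (simp add: fun_eq_iff euclidean_form_def sesq_def)

lemma sum_square_char_2:
  assumes "even CARD('a::{field,finite})"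
  shows "(\<Sum>i\<in>A. f i * f i) = (sum f A :: 'a) ^ 2"
proof (induction A rule: infinite_finite_induct)
  case (insert x A)
  have "(2 :: 'a) = 0" using assms two_eq_0_iff by blast
  then have "(f x + sum f A) ^ 2 = f x ^ 2 + sum f A ^ 2"
    by (simp add: power2_sum)
  then show ?case using insert by (simp add: power2_eq_square)
qed simp_all

text \<open>In characteristic 2 the form at (c, c) is the square of the sum of the coordinates of c.
  So each codeword is orthogonal to the all-one vector, which then lies in the dual of C, that is in
  C.\<close>

lemma all_one_in_self_dual:
  fixes C :: "('a::{field,finite} ^ 'N::finite) set"
  assumes "even CARD('a)" "self_dual euclidean_form C"
  shows "all_one \<in> C"
proof -
  have "euclidean_form all_one c = 0" if "c \<in> C" for c
  proof -
    have "c \<in> dual euclidean_form C" using assms(2) that by (simp add: self_dual_def)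
    then have "euclidean_form c c = 0" using that by (simp add: dual_def)
    then have "(\<Sum>i\<in>UNIV. c $ i) ^ 2 = 0"
      unfolding euclidean_form_def sum_square_char_2[OF assms(1)] .
    then show ?thesis by (simp add: euclidean_form_def all_one_def)
  qed
  then have "all_one \<in> dual euclidean_form C" by (simp add: dual_def)
  then show ?thesis using assms(2) by (simp add: self_dual_def)
qed

lemma card_unique: "(\<And>t. P t \<longleftrightarrow> t = s) \<Longrightarrow> card {t. P t} = 1"
  by simp

text \<open>Here \<open>\<kappa>\<close> is 1 because 2 is invertible and the isotropy condition on
  t is linear with coefficient 2.\<close>

lemma code_setting_qE:
  fixes u :: "'a::{field,finite} ^ 'N::{finite,linorder}"
  assumes "CARD('N) = 2 * n" "odd CARD('a)" "ty = qE \<and> u = 0 \<or> ty = qE_1 \<and> u = all_one"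
  shows "code_setting (\<lambda>x. x) (\<lambda>_. 0) 0 u 1 n (family ty)"
proof
  have two: "(2 :: 'a) \<noteq> 0" using assms(2) two_eq_0_iff by blast
  show "card {t. sesq (\<lambda>x. x) y y + t + t = 0 \<and> 0 + 0 * t = 0} = 1" for y :: "('a, 'N) vec"
  proof (rule card_unique)
    fix t
    have "sesq (\<lambda>x. x) y y + t + t = 0 \<longleftrightarrow> 2 * t = - sesq (\<lambda>x. x) y y"
      by (simp add: eq_neg_iff_add_eq_0 algebra_simps)
    also have "\<dots> \<longleftrightarrow> t = - sesq (\<lambda>x. x) y y / 2"
      using two by (simp add: field_simps)
    finally show "sesq (\<lambda>x. x) y y + t + t = 0 \<and> 0 + 0 * t = 0 \<longleftrightarrow> t = - sesq (\<lambda>x. x) y y / 2"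
      by simp
  qed
  show "perm \<pi> u = u" for \<pi> using assms(3) by (auto simp: perm_0 perm_all_one)
  have "0 \<in> C" if "self_dual (sesq (\<lambda>x. x)) C" for C :: "('a, 'N) vec set"
    using that by (simp add: self_dual_def vec.subspace_0)
  then show "family ty = {C. self_dual (sesq (\<lambda>x. x)) C \<and> u \<in> C \<and> (\<forall>c\<in>C. 0 = (0 :: 'a))}"
    using assms(3) by (auto simp: euclidean_form_eq)
  show "perm \<pi> ` C \<in> family ty" if "bij \<pi>" "C \<in> family ty" for \<pi> and C :: "('a, 'N) vec set"
    using that by (rule family_perm)
qed (use assms(1) in auto)

text \<open>Here \<open>\<kappa>\<close> is q: a vector orthogonal to the all-one vector is already
  isotropic, and t + t = 0 for each t.\<close>

lemma code_setting_qE_I: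
  assumes "CARD('N) = 2 * n" "even CARD('a)"
  shows "code_setting (\<lambda>x. x) (\<lambda>_. 0) 0 (all_one :: 'a::{field,finite} ^ 'N::{finite,linorder})
    CARD('a) n (family qE_I)"
proof
  have two: "(2 :: 'a) = 0" using assms(2) two_eq_0_iff by blast
  show "card {t. sesq (\<lambda>x. x) y y + t + t = 0 \<and> 0 + 0 * t = 0} = CARD('a)"
    if "sesq (\<lambda>x. x) y all_one = 0" for y :: "('a, 'N) vec"
  proof -
    have "sesq (\<lambda>x. x) y y = 0"
      using that unfolding sesq_def sum_square_char_2[OF assms(2)] by (simp add: all_one_def)
    moreover have "t + t = 0" for t :: 'a using two by (metis mult_2 mult_zero_left)
    ultimately show ?thesis by simp
  qed
  show "family qE_I = {C. self_dual (sesq (\<lambda>x. x)) C \<and> (all_one :: ('a, 'N) vec) \<in> C \<and> (\<forall>c\<in>C. 0 = (0 :: 'a))}"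
    using all_one_in_self_dual[OF assms(2)] by (auto simp: euclidean_form_eq)
  show "perm \<pi> ` C \<in> family qE_I" if "bij \<pi>" "C \<in> family qE_I" for \<pi> and C :: "('a, 'N) vec set"
    using that by (rule family_perm)
qed (use assms(1) in \<open>auto simp: perm_all_one\<close>)

text \<open>Splits the square of index pairs into the diagonal and two triangles. The triangular sum
  is the polar form of the quadratic form of the doubly-even condition.\<close>

lemma sum_product_pairs:
  fixes f g :: "'N::{finite,linorder} \<Rightarrow> 'a::comm_ring_1"
  shows "sum f UNIV * sum g UNIV =
    (\<Sum>i\<in>UNIV. f i * g i) + (\<Sum>(i, j)\<in>{(i, j). i < j}. f i * g j + f j * g i)"
proof -
  have "sum f UNIV * sum g UNIV = (\<Sum>(i, j)\<in>UNIV. f i * g j)"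
    by (simp add: sum_product sum.cartesian_product)
  also have "(UNIV :: ('N \<times> 'N) set) = {(i, j). i = j} \<union> ({(i, j). i < j} \<union> {(i, j). j < i})"
    by auto
  also have "(\<Sum>(i, j)\<in>{(i, j). i = j} \<union> ({(i, j). i < j} \<union> {(i, j). j < i}). f i * g j) =
      (\<Sum>(i, j)\<in>{(i, j). i = j}. f i * g j) +
      ((\<Sum>(i, j)\<in>{(i, j). i < j}. f i * g j) + (\<Sum>(i, j)\<in>{(i, j). j < i}. f i * g j))"
    by (subst sum.union_disjoint; (subst sum.union_disjoint)?) auto
  also have "(\<Sum>(i, j)\<in>{(i, j). i = j}. f i * g j) = (\<Sum>i\<in>UNIV. f i * g i)"
    by (rule sum.reindex_bij_witness[of _ "\<lambda>i. (i, i)" fst]) auto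
  also have "(\<Sum>(i, j)\<in>{(i, j). j < i}. f i * g j) = (\<Sum>(i, j)\<in>{(i, j). i < j}. f j * g i)"
    by (rule sum.reindex_bij_witness[of _ "\<lambda>(i, j). (j, i)" "\<lambda>(i, j). (j, i)"]) auto
  finally show ?thesis by (simp add: sum.distrib case_prod_unfold)
qed

text \<open>Isotropy again holds for every t, but the quadratic condition with
  \<open>\<delta>\<close> = 1 fixes t, so \<open>\<kappa>\<close> is 1.\<close>

lemma code_setting_qE_II:
  assumes "CARD('N) = 2 * n" "even CARD('a)"
  shows "code_setting (\<lambda>x. x) (\<lambda>x. \<Sum>(i, j)\<in>{(i, j). i < j}. x $ i * x $ j) 1
    (all_one :: 'a::{field,finite} ^ 'N::{finite,linorder}) 1 n (family qE_II)"
proof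
  let ?Q = "\<lambda>x :: ('a, 'N) vec. \<Sum>(i, j)\<in>{(i, j). i < j}. x $ i * x $ j"
  have two: "(2 :: 'a) = 0" using assms(2) two_eq_0_iff by blast
  have double: "t + t = 0" for t :: 'a using two by (metis mult_2 mult_zero_left)
  have sesq_one: "sesq (\<lambda>x. x) x all_one = (\<Sum>i\<in>UNIV. x $ i)" for x :: "('a, 'N) vec"
    by (simp add: sesq_def all_one_def)
  show "?Q (a *s x) = a ^ 2 * ?Q x" for a x
    by (simp add: sum_distrib_left case_prod_unfold power2_eq_square mult_ac)
  show "?Q (x + y) = ?Q x + ?Q y + 1 * sesq (\<lambda>x. x) x y"
    if "sesq (\<lambda>x. x) x all_one = 0" "sesq (\<lambda>x. x) y all_one = 0" for x y
  proof -
    let ?P = "\<Sum>(i, j)\<in>{(i, j). i < j}. x $ i * y $ j + x $ j * y $ i"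
    \<comment> \<open>The product of the two coordinate sums is zero, so \<open>?P\<close> is minus
      the bilinear form, which in characteristic 2 is the form itself.\<close>
    have "0 = sesq (\<lambda>x. x) x y + ?P"
      using sum_product_pairs[of "($) x" "($) y"] that(1) unfolding sesq_one by (simp add: sesq_def)
    then have "sesq (\<lambda>x. x) x y + ?P = sesq (\<lambda>x. x) x y + sesq (\<lambda>x. x) x y"
      unfolding double by (rule sym)
    then have "?P = sesq (\<lambda>x. x) x y" by (rule add_left_imp_eq)
    moreover have "?Q (x + y) = ?Q x + ?Q y + ?P"
      unfolding sum.distrib[symmetric] by (rule sum.cong) (auto simp: algebra_simps)
    ultimately show ?thesis by simp
  qed
  show "card {t. sesq (\<lambda>x. x) y y + t + t = 0 \<and> ?Q y + 1 * t = 0} = 1"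
    if "sesq (\<lambda>x. x) y all_one = 0" for y
  proof (rule card_unique)
    fix t
    have "sesq (\<lambda>x. x) y y = 0"
      using that unfolding sesq_def sum_square_char_2[OF assms(2)] by (simp add: all_one_def)
    then show "sesq (\<lambda>x. x) y y + t + t = 0 \<and> ?Q y + 1 * t = 0 \<longleftrightarrow> t = - ?Q y"
      using double by (auto simp: eq_neg_iff_add_eq_0 add.commute)
  qed
  have "(\<Sum>i\<in>UNIV. c $ i) = 0" if "self_dual euclidean_form C" "c \<in> C" for C and c :: "('a, 'N) vec"
  proof -
    have "c \<in> dual euclidean_form C" "all_one \<in> C"
      using that all_one_in_self_dual[OF assms(2)] by (auto simp: self_dual_def)
    then have "euclidean_form c all_one = 0" by (simp add: dual_def)
    then show ?thesis by (simp add: euclidean_form_def all_one_def)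
  qed
  then show "family qE_II = {C. self_dual (sesq (\<lambda>x. x)) C \<and> all_one \<in> C \<and> (\<forall>c\<in>C. ?Q c = 0)}"
    using all_one_in_self_dual[OF assms(2), where 'N='N]
    unfolding family.simps doubly_even_def euclidean_form_eq by blast
  show "perm \<pi> ` C \<in> family qE_II" if "bij \<pi>" "C \<in> family qE_II" for \<pi> and C :: "('a, 'N) vec set"
    using that by (rule family_perm)
qed (use assms(1) in \<open>auto simp: perm_all_one\<close>)

text \<open>The value of the form at (y, y) is fixed by the r-th power map, so the admissible t form
  a fibre of the trace and \<open>\<kappa>\<close> is r.\<close>

lemma code_setting_qH:
  fixes u :: "'a::{field,finite} ^ 'N::{finite,linorder}"
  assumes "CARD('N) = 2 * n" "CARD('a) = r ^ 2" "ty = qH \<and> u = 0 \<or> ty = qH_1 \<and> u = all_one"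
  shows "code_setting (\<lambda>x. x ^ r) (\<lambda>_. 0) 0 u r n (family ty)"
proof
  let ?\<sigma> = "\<lambda>x :: 'a. x ^ r"
  note frob = frobenius_add[OF assms(2)] frobenius_involution[OF assms(2)]
  show "(a + b) ^ r = a ^ r + b ^ r" "(a ^ r) ^ r = a" for a b :: 'a by (rule frob)+
  show "(a * b) ^ r = a ^ r * b ^ r" for a b :: 'a by (rule power_mult_distrib)
  have "r \<noteq> 0" using assms(2) zero_less_card_finite[where 'a='a] by (intro notI) simp
  then have zero: "(0 :: 'a) ^ r = 0" by (simp add: power_0_left)
  have sum: "sum f A ^ r = (\<Sum>i\<in>A. f i ^ r)" for f :: "'N \<Rightarrow> 'a" and A
    by (induction A rule: infinite_finite_induct) (simp_all add: frob zero)
  show "card {t. sesq ?\<sigma> y y + t + t ^ r = 0 \<and> 0 + 0 * t = 0} = r" for y :: "('a, 'N) vec"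
  proof -
    let ?s = "sesq ?\<sigma> y y"
    have s: "?s ^ r = ?s"
      by (simp add: sesq_def sum power_mult_distrib frob mult.commute)
    have "(- ?s) ^ r + ?s ^ r = 0" using frob(1)[of "- ?s" ?s] zero by simp
    then have "(- ?s) ^ r = - ?s" unfolding s by (simp add: eq_neg_iff_add_eq_0)
    then have "card {t. t + t ^ r = - ?s} = r" by (rule card_trace_fibre[OF assms(2)])
    moreover have "?s + t + t ^ r = 0 \<and> 0 + 0 * t = 0 \<longleftrightarrow> t + t ^ r = - ?s" for t
      by (simp add: eq_neg_iff_add_eq_0 algebra_simps)
    ultimately show ?thesis by simp
  qed
  show "perm \<pi> u = u" for \<pi> using assms(3) by (auto simp: perm_0 perm_all_one)
  have form: "hermitian_form = (sesq ?\<sigma> :: ('a, 'N) vec \<Rightarrow> _)"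
    by (simp add: fun_eq_iff hermitian_form_def sesq_def assms(2))
  have "0 \<in> C" if "self_dual (sesq ?\<sigma>) C" for C :: "('a, 'N) vec set"
    using that by (simp add: self_dual_def vec.subspace_0)
  then show "family ty = {C. self_dual (sesq ?\<sigma>) C \<and> u \<in> C \<and> (\<forall>c\<in>C. 0 = (0 :: 'a))}"
    using assms(3) by (auto simp: form)
  show "perm \<pi> ` C \<in> family ty" if "bij \<pi>" "C \<in> family ty" for \<pi> and C :: "('a, 'N) vec set"
    using that by (rule family_perm)
qed (use assms(1) in auto)

lemma nu_val_eq:
  assumes "1 < q"
  shows "nu_val ty q n m = alpha_val ty q n m - (real q ^ m - 1) / (real q - 1)"
proof -
  have q: "0 < real q" using assms by simp
  have half: "sqrt (real q) * real q powr x = real q powr (x + 1 / 2)" for x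
    unfolding powr_add powr_half_sqrt[OF less_imp_le[OF q]] by (rule mult.commute)
  have half_1: "sqrt (real q) * real q powr (real n - real m - 1) = real q powr (real n - real m - 1 / 2)"
    unfolding half by (simp add: algebra_simps)
  have "nu_num ty (real q) (real n) (real m) = alpha_num ty (real q) (real n) (real m) - (real q ^ m - 1)"
    by (cases ty; simp only: nu_num.simps alpha_num.simps powr_realpow[OF q] right_diff_distrib mult_1_right
        half[of "real n - real m"] half_1 powr_half_sqrt[OF less_imp_le[OF q]]; linarith)
  then show ?thesis
    by (simp add: nu_val_def alpha_val_def diff_divide_distrib)
qed

theorem theorem9:
  fixes ty :: code_type and n m :: nat
    and \<F> :: "('a::{field,finite} ^ 'N::{finite,linorder}) set set"
  assumes "CARD('N) = 2 * n"
    and "admissible ty (CARD('a))"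
    and "\<F> = family ty"
    and "m \<le> n"
  shows
    "V_space \<F> (int m) = {v \<in> V_space \<F> (int m - 1). \<forall>X \<in> mon0 ty TYPE('N) m. mon_coeff \<F> m X v = 0}
     \<and> (\<forall>C\<in>\<F>. \<forall>c \<in> {..<m} \<rightarrow>\<^sub>E C. mon m c \<in> mon0 ty TYPE('N) m \<longrightarrow>
          real (\<Sum>E\<in>hyperplanes_through n m C c. num_neighbours \<F> E C) = alpha_val ty (CARD('a)) n m)
     \<and> nu_val ty (CARD('a)) n m
         = alpha_val ty (CARD('a)) n m - (real (CARD('a)) ^ m - 1) / (real (CARD('a)) - 1)
     \<and> (\<forall>v \<in> Y_space \<F> (int m). kneser_hecke n \<F> v = scale (of_real (nu_val ty (CARD('a)) n m)) v)"
proof -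
  note N = assms(1) and nu = nu_val_eq[OF one_less_card_field[where 'a='a]]
  have powr: "real CARD('a) powr real k = real CARD('a) ^ k" for k
    by (simp add: powr_realpow)
  have powr_0: "real CARD('a) powr (real n - real m) = real CARD('a) ^ (n - m)"
    using powr[of "n - m"] assms(4) by (simp only: of_nat_diff)
  have powr_1: "real CARD('a) powr (real n - real m - 1) = real CARD('a) ^ (n - (m + 1))" if "m + 1 \<le> n"
    using powr[of "n - (m + 1)"] that by (simp only: of_nat_diff of_nat_add of_nat_1 diff_diff_eq)
  have nonzero: "(all_one :: ('a, 'N) vec) \<noteq> 0" by (rule all_one_nonzero)
  show ?thesis
  proof (cases ty)
    case qE_I
    then interpret code_setting "\<lambda>x. x" "\<lambda>_. 0" 0 all_one "CARD('a)" n \<F>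
      using code_setting_qE_I[OF N] assms(2,3) by simp
    show ?thesis
    proof (rule kneser_hecke_spectrum[OF _ _ nu])
      show "mon m c \<in> mon0 ty TYPE('N) m \<longleftrightarrow> indep_mod all_one m c" for c :: "nat \<Rightarrow> ('a, 'N) vec"
        using qE_I by (simp add: mon_in_monomials_one_iff)
      assume "m + (if all_one = (0 :: ('a, 'N) vec) then 0 else 1) \<le> n"
      then have le: "m + 1 \<le> n" by (simp only: nonzero if_False)
      \<comment> \<open>The factor \<open>\<kappa>\<close> = q turns q^(n-m-1) - 1 into the table
        entry q^(n-m) - q; \<open>le\<close> excludes truncation of the exponent.\<close>
      then have "n - m = Suc (n - (m + 1))" by arith
      then have "real CARD('a) ^ (n - m) = real CARD('a) * real CARD('a) ^ (n - (m + 1))"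
        by (simp only: power_Suc)
      then show "alpha m = alpha_val ty CARD('a) n m"
        unfolding alpha_def alpha_val_def qE_I alpha_num.simps powr_0
        by (simp only: nonzero if_False times_divide_eq_right right_diff_distrib mult_1_right)
    qed
  next
    case qE_II
    then interpret code_setting "\<lambda>x. x" "\<lambda>x. \<Sum>(i, j)\<in>{(i, j). i < j}. x $ i * x $ j" 1 all_one 1 n \<F>
      using code_setting_qE_II[OF N] assms(2,3) by simp
    show ?thesis
    proof (rule kneser_hecke_spectrum[OF _ _ nu])
      show "mon m c \<in> mon0 ty TYPE('N) m \<longleftrightarrow> indep_mod all_one m c" for c :: "nat \<Rightarrow> ('a, 'N) vec"
        using qE_II by (simp add: mon_in_monomials_one_iff)
      assume "m + (if all_one = (0 :: ('a, 'N) vec) then 0 else 1) \<le> n"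
      then have le: "m + 1 \<le> n" by (simp only: nonzero if_False)
      show "alpha m = alpha_val ty CARD('a) n m"
        unfolding alpha_def alpha_val_def qE_II alpha_num.simps powr_1[OF le]
        by (simp only: nonzero if_False times_divide_eq_right of_nat_1 mult_1_left)
    qed
  next
    case qE
    then interpret code_setting "\<lambda>x. x" "\<lambda>_. 0" 0 0 1 n \<F>
      using code_setting_qE[OF N, of ty 0] assms(2,3) by simp
    show ?thesis
    proof (rule kneser_hecke_spectrum[OF _ _ nu])
      show "mon m c \<in> mon0 ty TYPE('N) m \<longleftrightarrow> indep_mod 0 m c" for c :: "nat \<Rightarrow> ('a, 'N) vec"
        using qE by (simp add: mon_in_monomials_star_iff)
      show "alpha m = alpha_val ty CARD('a) n m"
        unfolding alpha_def alpha_val_def qE alpha_num.simps powr_0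
        by (simp only: if_True add_0_right times_divide_eq_right of_nat_1 mult_1_left refl)
    qed
  next
    case qE_1
    then interpret code_setting "\<lambda>x. x" "\<lambda>_. 0" 0 all_one 1 n \<F>
      using code_setting_qE[OF N, of ty all_one] assms(2,3) by simp
    show ?thesis
    proof (rule kneser_hecke_spectrum[OF _ _ nu])
      show "mon m c \<in> mon0 ty TYPE('N) m \<longleftrightarrow> indep_mod all_one m c" for c :: "nat \<Rightarrow> ('a, 'N) vec"
        using qE_1 by (simp add: mon_in_monomials_one_iff)
      assume "m + (if all_one = (0 :: ('a, 'N) vec) then 0 else 1) \<le> n"
      then have le: "m + 1 \<le> n" by (simp only: nonzero if_False)
      show "alpha m = alpha_val ty CARD('a) n m"
        unfolding alpha_def alpha_val_def qE_1 alpha_num.simps powr_1[OF le]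
        by (simp only: nonzero if_False times_divide_eq_right of_nat_1 mult_1_left)
    qed
  next
    case qH
    then obtain r where r: "CARD('a) = r ^ 2" using assms(2) by auto
    interpret code_setting "\<lambda>x. x ^ r" "\<lambda>_. 0" 0 0 r n \<F>
      using code_setting_qH[OF N r, of ty 0] assms(3) qH by simp
    \<comment> \<open>The factor sqrt q of the table is \<open>\<kappa>\<close> = r.\<close>
    have sqrt: "sqrt (real CARD('a)) = real r" unfolding r by simp
    show ?thesis
    proof (rule kneser_hecke_spectrum[OF _ _ nu])
      show "mon m c \<in> mon0 ty TYPE('N) m \<longleftrightarrow> indep_mod 0 m c" for c :: "nat \<Rightarrow> ('a, 'N) vec"
        using qH by (simp add: mon_in_monomials_star_iff)
      show "alpha m = alpha_val ty CARD('a) n m"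
        unfolding alpha_def alpha_val_def qH alpha_num.simps powr_0 sqrt
        by (simp only: if_True add_0_right times_divide_eq_right refl)
    qed
  next
    case qH_1
    then obtain r where r: "CARD('a) = r ^ 2" using assms(2) by auto
    interpret code_setting "\<lambda>x. x ^ r" "\<lambda>_. 0" 0 all_one r n \<F>
      using code_setting_qH[OF N r, of ty all_one] assms(3) qH_1 by simp
    have sqrt: "sqrt (real CARD('a)) = real r" unfolding r by simp
    show ?thesis
    proof (rule kneser_hecke_spectrum[OF _ _ nu])
      show "mon m c \<in> mon0 ty TYPE('N) m \<longleftrightarrow> indep_mod all_one m c" for c :: "nat \<Rightarrow> ('a, 'N) vec"
        using qH_1 by (simp add: mon_in_monomials_one_iff)
      assume "m + (if all_one = (0 :: ('a, 'N) vec) then 0 else 1) \<le> n"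
      then have le: "m + 1 \<le> n" by (simp only: nonzero if_False)
      show "alpha m = alpha_val ty CARD('a) n m"
        unfolding alpha_def alpha_val_def qH_1 alpha_num.simps powr_1[OF le] sqrt
        by (simp only: nonzero if_False times_divide_eq_right of_nat_1 mult_1_left)
    qed
  qed
qed

end
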